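(* Let $n\ge 1$. There exists an action of $\mathfrak{S}_n$ on the set of regions of the Linial arrangement $\mathcal{L}_n$ whose graded Frobenius characteristic is $G_n(\mathsf{x};\bar\lambda,0,\bar\rho,0)$. That is, there exist an action of $\mathfrak{S}_n$ on the set of regions and a partition of this set into $\mathfrak{S}_n$-stable subsets $R_0,R_1,\dots,R_{n-1}$ such that $$\sum_{k=0}^{n-1}\bar\lambda^{\,n-1-k}\bar\rho^{\,k}\,\mathrm{Frob}(\mathbb{C}R_k)=G_n(\mathsf{x};\bar\lambda,0,\bar\rho,0),$$ where $\mathrm{Frob}(\mathbb{C}R_k)$ is the Frobenius characteristic of the permutation representation of $\mathfrak{S}_n$ on $R_k$.
   Context: The Linial arrangement $\mathcal{L}_n$ is the hyperplane arrangement in $\mathbb{R}^n$ consisting of the hyperplanes $x_i-x_j=1$ for $1\le i<j\le n$. Its regions are the connected components of the complement of the union of the hyperplanes. A (plane binary) tree is a rooted tree in which every node has at most one left child and at most one right child (it may have only one of the two), and no other children. A labeled tree is a tree whose nodes are labeled with positive integers, repetitions allowed; $\mathcal{T}^{\ell}_n$ is the set of labeled trees on $n$ nodes. Write $v^\ell$ for the label of $v$. If $v$ is the left child of $w$, the edge is a left ascent if $v^\ell\le w^\ell$ and a left descent otherwise. If $w$ is the right child of $v$, the edge is a right ascent if $v^\ell\le w^\ell$ and a right descent otherwise. $\mathrm{lasc},\mathrm{ldes},\mathrm{rasc},\mathrm{rdes}$ count these edges. With $\mathsf{x}^T=\prod_{v\in T}x_{v^\ell}$, $$G_n(\mathsf{x};\bar\lambda,\lambda,\bar\rho,\rho)=\sum_{T\in\mathcal{T}^\ell_n}\bar\lambda^{\mathrm{lasc}(T)}\lambda^{\mathrm{ldes}(T)}\bar\rho^{\,\mathrm{rasc}(T)}\rho^{\,\mathrm{rdes}(T)}\,\mathsf{x}^T.$$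 *)

theory Defs
  imports
    "HOL-Analysis.Analysis"
    "HOL-Algebra.Group_Action"
    "HOL-Algebra.Sym_Groups"
    "HOL-Combinatorics.Orbits"
    "HOL-Computational_Algebra.Polynomial"
    "HOL-Library.Poly_Mapping"
    "HOL-Library.Tree"
begin

section \<open>Formal power series in countably many variables\<close>

text \<open>A series in the variables \<open>x\<^sub>i\<close> is its family of coefficients; the monomial
  with exponents \<open>e\<^sub>i\<close> is the finitely supported function \<open>i \<mapsto> e\<^sub>i\<close>. The variable with
  index 0 is never used below: labels and variables are indexed by the positive integers.\<close>

typedef 'a mfps = "UNIV :: ((nat \<Rightarrow>\<^sub>0 nat) \<Rightarrow> 'a) set"
  morphisms mfps_coeff Abs_mfps
  by simp

lemma mfps_coeff_Abs [simp]: "mfps_coeff (Abs_mfps f) = f"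
  by (simp add: Abs_mfps_inverse)

lemma mfps_eqI: "(\<And>m. mfps_coeff f m = mfps_coeff g m) \<Longrightarrow> f = g"
  by (metis ext mfps_coeff_inverse)

lemma finite_monomial_splits: "finite {(a, b). a + b = (m :: nat \<Rightarrow>\<^sub>0 nat)}"
proof -
  define A where "A = {a :: nat \<Rightarrow>\<^sub>0 nat. \<forall>k. Poly_Mapping.lookup a k \<le> Poly_Mapping.lookup m k}"
  define B where "B = (\<Union>k\<in>Poly_Mapping.keys m. {..Poly_Mapping.lookup m k})"
  define F where "F = {f. \<forall>k. (k \<in> Poly_Mapping.keys m \<longrightarrow> f k \<in> B)
      \<and> (k \<notin> Poly_Mapping.keys m \<longrightarrow> f k = 0)}"
  have "Poly_Mapping.lookup ` A \<subseteq> F"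
    by (auto simp: A_def B_def F_def in_keys_iff) (metis le_zero_eq)
  moreover have "finite F"
    unfolding F_def
    by (rule finite_set_of_finite_funs) (auto simp: B_def)
  ultimately have "finite (Poly_Mapping.lookup ` A)" by (rule finite_subset)
  then have "finite A"
    by (rule finite_imageD) (auto simp: inj_on_def Poly_Mapping.lookup_inject)
  then have "finite (A \<times> A)" by simp
  moreover have "{(a, b). a + b = m} \<subseteq> A \<times> A"
    by (auto simp: A_def lookup_add)
  ultimately show ?thesis by (rule rev_finite_subset)
qed

instantiation mfps :: (comm_ring_1) comm_ring_1
begin

definition "0 = Abs_mfps (\<lambda>_. 0)"
definition "1 = Abs_mfps (\<lambda>m. if m = 0 then 1 else 0)"
definition "f + g = Abs_mfps (\<lambda>m. mfps_coeff f m + mfps_coeff g m)"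
definition "f - g = Abs_mfps (\<lambda>m. mfps_coeff f m - mfps_coeff g m)"
definition "- f = Abs_mfps (\<lambda>m. - mfps_coeff f m)"
definition "f * g = Abs_mfps (\<lambda>m. \<Sum>(a, b) | a + b = m. mfps_coeff f a * mfps_coeff g b)"

instance
proof
  fix f g h :: "'a mfps"
  let ?S = "\<lambda>m :: nat \<Rightarrow>\<^sub>0 nat. {(a, b). a + b = m}"
  show "f * g * h = f * (g * h)"
  proof (rule mfps_eqI)
    fix m
    have "mfps_coeff (f * g * h) m =
        (\<Sum>p\<in>?S m. \<Sum>q\<in>?S (fst p).
          mfps_coeff f (fst q) * mfps_coeff g (snd q) * mfps_coeff h (snd p))"
      by (simp add: times_mfps_def sum_distrib_right case_prod_unfold)
    also have "\<dots> = (\<Sum>(p, q)\<in>(SIGMA p:?S m. ?S (fst p)).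
          mfps_coeff f (fst q) * mfps_coeff g (snd q) * mfps_coeff h (snd p))"
      by (rule sum.Sigma) (auto intro: finite_monomial_splits)
    also have "\<dots> = (\<Sum>(p, q)\<in>(SIGMA p:?S m. ?S (snd p)).
          mfps_coeff f (fst p) * (mfps_coeff g (fst q) * mfps_coeff h (snd q)))"
      by (rule sum.reindex_bij_witness
            [where i = "\<lambda>((a, s), (b, c)). ((a + b, c), (a, b))"
               and j = "\<lambda>((s, c), (a, b)). ((a, b + c), (b, c))"])
         (auto simp: ac_simps)
    also have "\<dots> = (\<Sum>p\<in>?S m. \<Sum>q\<in>?S (snd p).
          mfps_coeff f (fst p) * (mfps_coeff g (fst q) * mfps_coeff h (snd q)))"
      by (rule sum.Sigma [symmetric]) (auto intro: finite_monomial_splits)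
    also have "\<dots> = mfps_coeff (f * (g * h)) m"
      by (simp add: times_mfps_def sum_distrib_left case_prod_unfold)
    finally show "mfps_coeff (f * g * h) m = mfps_coeff (f * (g * h)) m" .
  qed
  show "f * g = g * f"
  proof (rule mfps_eqI)
    fix m
    have "(\<Sum>p\<in>?S m. mfps_coeff f (fst p) * mfps_coeff g (snd p)) =
        (\<Sum>p\<in>?S m. mfps_coeff g (fst p) * mfps_coeff f (snd p))"
      by (rule sum.reindex_bij_witness [where i = prod.swap and j = prod.swap])
         (auto simp: add.commute mult.commute)
    then show "mfps_coeff (f * g) m = mfps_coeff (g * f) m"
      by (simp add: times_mfps_def case_prod_unfold)
  qed
  show "1 * f = f"
  proof (rule mfps_eqI)
    fix m
    have "mfps_coeff (1 * f) m =
        (\<Sum>p\<in>?S m. (if fst p = 0 then 1 else 0) * mfps_coeff f (snd p))"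
      by (simp add: times_mfps_def one_mfps_def case_prod_unfold)
    also have "\<dots> = (\<Sum>p\<in>?S m. if p = (0, m) then mfps_coeff f m else 0)"
      by (rule sum.cong) auto
    also have "\<dots> = mfps_coeff f m"
      by (simp add: sum.delta [OF finite_monomial_splits])
    finally show "mfps_coeff (1 * f) m = mfps_coeff f m" .
  qed
  show "(f + g) * h = f * h + g * h"
    by (rule mfps_eqI)
       (simp add: times_mfps_def plus_mfps_def sum.distrib case_prod_unfold algebra_simps)
  show "(0 :: 'a mfps) \<noteq> 1"
  proof
    assume "(0 :: 'a mfps) = 1"
    then have "mfps_coeff (0 :: 'a mfps) 0 = mfps_coeff 1 0" by simp
    then show False by (simp add: zero_mfps_def one_mfps_def)
  qed
qed (auto intro!: mfps_eqI simp: zero_mfps_def plus_mfps_def minus_mfps_def uminus_mfps_def)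

end

definition mfps_smult :: "'a :: comm_ring_1 \<Rightarrow> 'a mfps \<Rightarrow> 'a mfps" where
  "mfps_smult c f = Abs_mfps (\<lambda>m. c * mfps_coeff f m)"

definition mfps_map :: "('a \<Rightarrow> 'b) \<Rightarrow> 'a mfps \<Rightarrow> 'b mfps" where
  "mfps_map h f = Abs_mfps (\<lambda>m. h (mfps_coeff f m))"

section \<open>The Frobenius characteristic\<close>

text \<open>The power sum \<open>p\<^sub>k = \<Sum>\<^sub>i\<^sub>\<ge>\<^sub>1 x\<^sub>i\<^sup>k\<close>, for \<open>k \<ge> 1\<close>.\<close>

definition power_sum :: "nat \<Rightarrow> complex mfps" where
  "power_sum k = Abs_mfps (\<lambda>m. if \<exists>i\<ge>1. m = Poly_Mapping.single i k then 1 else 0)"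

text \<open>The product \<open>p\<^bsub>\<mu>\<^esub>\<close>, where \<open>\<mu>\<close> is the cycle type of the permutation \<open>w\<close> of
  \<open>{1..n}\<close>: the factors are indexed by the supports of the cycles, fixed points included.
  (The theory \<open>Group_Action\<close> has an unrelated constant named \<open>orbit\<close>.)\<close>

definition power_sum_cycle_type :: "nat \<Rightarrow> (nat \<Rightarrow> nat) \<Rightarrow> complex mfps" where
  "power_sum_cycle_type n w = (\<Prod>c\<in>Orbits.orbit w ` {1..n}. power_sum (card c))"

text \<open>A matrix representation on the complex vector space with finite basis \<open>B\<close> assigns to
  each group element \<open>w\<close> the entries \<open>\<rho> w r s\<close> (row \<open>r\<close>, column \<open>s\<close>) for \<open>r, s \<in> B\<close>.\<close>

definition rep_character :: "'b set \<Rightarrow> ('g \<Rightarrow> 'b \<Rightarrow> 'b \<Rightarrow> complex) \<Rightarrow> 'g \<Rightarrow> complex" where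
  "rep_character B \<rho> w = (\<Sum>b\<in>B. \<rho> w b b)"

definition perm_rep :: "('g \<Rightarrow> 'b \<Rightarrow> 'b) \<Rightarrow> 'g \<Rightarrow> 'b \<Rightarrow> 'b \<Rightarrow> complex" where
  "perm_rep \<phi> w r s = (if \<phi> w s = r then 1 else 0)"

definition Frob :: "nat \<Rightarrow> 'b set \<Rightarrow> ((nat \<Rightarrow> nat) \<Rightarrow> 'b \<Rightarrow> 'b \<Rightarrow> complex) \<Rightarrow> complex mfps" where
  "Frob n B \<rho> = mfps_smult (1 / fact n)
     (\<Sum>w\<in>carrier (sym_group n). mfps_smult (rep_character B \<rho> w) (power_sum_cycle_type n w))"

section \<open>The Linial arrangement\<close>

text \<open>The points of \<open>Euclidean_space n\<close> have their coordinates indexed by \<open>0, \<dots>, n - 1\<close>.\<close>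

definition linial_hyperplanes :: "nat \<Rightarrow> (nat \<Rightarrow> real) set set" where
  "linial_hyperplanes n =
     {{x \<in> topspace (Euclidean_space n). x i - x j = 1} | i j. i < j \<and> j < n}"

definition linial_regions :: "nat \<Rightarrow> (nat \<Rightarrow> real) set set" where
  "linial_regions n = connected_components_of
     (subtopology (Euclidean_space n)
        (topspace (Euclidean_space n) - \<Union>(linial_hyperplanes n)))"

section \<open>Labeled plane binary trees\<close>

text \<open>\<open>\<langle>\<rangle>\<close> stands for an absent child, so \<open>size\<close> counts the nodes.\<close>

fun lasc :: "nat tree \<Rightarrow> nat" where
  "lasc \<langle>\<rangle> = 0"
| "lasc \<langle>l, a, r\<rangle> = (case l of \<langle>\<rangle> \<Rightarrow> 0 | \<langle>_, b, _\<rangle> \<Rightarrow> if b \<le> a then 1 else 0) + lasc l + lasc r"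

fun ldes :: "nat tree \<Rightarrow> nat" where
  "ldes \<langle>\<rangle> = 0"
| "ldes \<langle>l, a, r\<rangle> = (case l of \<langle>\<rangle> \<Rightarrow> 0 | \<langle>_, b, _\<rangle> \<Rightarrow> if b \<le> a then 0 else 1) + ldes l + ldes r"

fun rasc :: "nat tree \<Rightarrow> nat" where
  "rasc \<langle>\<rangle> = 0"
| "rasc \<langle>l, a, r\<rangle> = (case r of \<langle>\<rangle> \<Rightarrow> 0 | \<langle>_, b, _\<rangle> \<Rightarrow> if a \<le> b then 1 else 0) + rasc l + rasc r"

fun rdes :: "nat tree \<Rightarrow> nat" where
  "rdes \<langle>\<rangle> = 0"
| "rdes \<langle>l, a, r\<rangle> = (case r of \<langle>\<rangle> \<Rightarrow> 0 | \<langle>_, b, _\<rangle> \<Rightarrow> if a \<le> b then 0 else 1) + rdes l + rdes r"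

definition labeled_trees :: "nat \<Rightarrow> nat tree set" where
  "labeled_trees n = {T. size T = n \<and> (\<forall>i\<in>set_tree T. 1 \<le> i)}"

fun tree_monomial :: "nat tree \<Rightarrow> (nat \<Rightarrow>\<^sub>0 nat)" where
  "tree_monomial \<langle>\<rangle> = 0"
| "tree_monomial \<langle>l, a, r\<rangle> = tree_monomial l + Poly_Mapping.single a 1 + tree_monomial r"

text \<open>The arguments are, in this order, the weights of left ascents, left descents, right
  ascents and right descents. The sum giving a coefficient is finite, because only finitely
  many trees have a given monomial.\<close>

definition G_series ::
    "nat \<Rightarrow> 'a :: comm_ring_1 \<Rightarrow> 'a \<Rightarrow> 'a \<Rightarrow> 'a \<Rightarrow> 'a mfps" where
  "G_series n lbar l rbar r = Abs_mfps (\<lambda>m.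
     \<Sum>T | T \<in> labeled_trees n \<and> tree_monomial T = m.
       lbar ^ lasc T * l ^ ldes T * rbar ^ rasc T * r ^ rdes T)"

section \<open>The ring of coefficients\<close>

text \<open>The polynomial ring in two commuting indeterminates over the complex numbers, realised
  as iterated univariate polynomials.\<close>

definition scalar :: "complex \<Rightarrow> complex poly poly" where
  "scalar c = [:[:c:]:]"

definition lambda_bar :: "complex poly poly" where
  "lambda_bar = [:[:0, 1:]:]"

definition rho_bar :: "complex poly poly" where
  "rho_bar = [:0, 1:]"

end

(*
  Let G be the sum of a^(left edges) b^(right edges) x^T over the trees T with no descents.
  Cutting off the last node k of the right spine of T leaves its left subtree M and the remaining
  tree R, both with entries bounded by k. Peeling off the larger of the root of M and the end of
  the right spine of R, over and over, turns T into a weakly decreasing sequence whose gaps carry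
  "left", "right" or a further tree; this gives G = sum_m h_m (a + b + a b G)^(m-1). Hence G is
  a sum of products of complete symmetric functions with coefficients monomials in a and b,
  i.e. the graded Frobenius characteristic of an action of the symmetric group on pairs of a shape
  and a distribution of 1..n over the spines of that shape.

  It remains to see that this set has as many elements as there are regions, since the action can
  then be carried over by any bijection. By deletion and contraction, the numbers r_k of regions
  and the numbers A_q(k) of integer points of [0,q)^k off the hyperplanes satisfy
  sum_k (n choose k) (-1)^k r_k A_q(n-k) = A_(q-1)(n) for large q. Splitting integer points at the
  first unused value gives a recursion for A_q, and eliminating A_q shows that the exponential
  generating function f of r_k satisfies f^2 = exp(x (1 + f)). The series 1 + g, with g the
  exponential generating function of the set above, satisfies the same equation.
*)
theory Submission
  imports Defs "HOL-Combinatorics.Multiset_Permutations"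
begin

section \<open>Regions as sign patterns\<close>

text \<open>A tree in a gap obeys no inequality with the entries around it. Let k and k' be the
  entries before and after the gap, so k' is at most k. If the root of the tree is at least k', the
  tree becomes the right subtree of k'; otherwise its root is below k', hence below k, and it
  becomes the left subtree of k. Either way the gap accounts for one left and one right edge, which
  is the origin of the summand a b G. The spines of a shape are therefore independent weakly
  decreasing sequences, and each contributes one complete symmetric function.

  On the side of the regions, the identity for large q says that lowering q by one multiplies the
  exponential generating function of the A_q by f(-x), up to any fixed degree. The factor
  accompanying each r comes from compositions, since the values below r are taken in weakly
  increasing order of the indices.\<close>

definition avoids :: "('v \<times> 'v \<times> int) set \<Rightarrow> ('v \<Rightarrow> 'a :: ring_1) \<Rightarrow> bool" where
  "avoids A x \<longleftrightarrow> (\<forall>(u, v, c)\<in>A. x u - x v \<noteq> of_int c)"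

text \<open>An edge \<open>(u, v, c)\<close> stands for the hyperplane \<open>x u - x v = c\<close>.
  Arbitrary vertices and integer offsets are allowed because contraction leaves the Linial family.
  \<open>avoids\<close> is stated over any ring with 1, so that it serves real points and integer
  points alike.\<close>

definition sign_pattern :: "('v \<times> 'v \<times> int) set \<Rightarrow> ('v \<Rightarrow> real) \<Rightarrow> ('v \<times> 'v \<times> int) set" where
  "sign_pattern A x = {(u, v, c) \<in> A. x u - x v > of_int c}"

definition sign_patterns :: "('v \<times> 'v \<times> int) set \<Rightarrow> ('v \<times> 'v \<times> int) set set" where
  "sign_patterns A = sign_pattern A ` {x. avoids A x}"

definition linial :: "nat set \<Rightarrow> (nat \<times> nat \<times> int) set" where
  "linial V = {(i, j, 1) | i j. i \<in> V \<and> j \<in> V \<and> i < j}"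

lemma sign_pattern_eq_iff:
  "sign_pattern A x = sign_pattern A y \<longleftrightarrow>
     (\<forall>(u, v, c)\<in>A. (x u - x v > of_int c) = (y u - y v > of_int c))"
  unfolding sign_pattern_def set_eq_iff by fastforce

text \<open>Both open sides of a hyperplane are convex. This makes the cells connected, and it also
  yields the point on the new hyperplane in \<open>card_sign_patterns_insert\<close>.\<close>

lemma avoids_convex:
  assumes "avoids A x" "avoids A y" "sign_pattern A x = sign_pattern A y" "0 \<le> t" "t \<le> 1"
  defines "z \<equiv> \<lambda>i. (1 - t) * x i + t * y i"
  shows "avoids A z \<and> sign_pattern A z = sign_pattern A x"
proof -
  have d: "z u - z v = (1 - t) * (x u - x v) + t * (y u - y v)" for u v
    by (simp add: z_def algebra_simps)
  have pos: "z u - z v > c" if "x u - x v > c" "y u - y v > c" for u v c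
  proof -
    have "(1 - t) * (c - (x u - x v)) + t * (c - (y u - y v)) < 0"
    proof (cases "t = 0")
      case False
      then have "t * (c - (y u - y v)) < 0" using assms that by (simp add: mult_pos_neg)
      moreover have "(1 - t) * (c - (x u - x v)) \<le> 0"
        using assms that by (intro mult_nonneg_nonpos) auto
      ultimately show ?thesis by linarith
    qed (use that in auto)
    then show ?thesis unfolding d by (simp add: algebra_simps)
  qed
  have neg: "z u - z v < c" if "x u - x v < c" "y u - y v < c" for u v c
    using pos[of "-c" v u] that by simp
  have "(z u - z v > of_int c) = (x u - x v > of_int c) \<and> z u - z v \<noteq> of_int c"
    if "(u, v, c) \<in> A" for u v c
  proof -
    have "(x u - x v > of_int c) = (y u - y v > of_int c)" "x u - x v \<noteq> of_int c" "y u - y v \<noteq> of_int c"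
      using that assms(1-3) unfolding sign_pattern_eq_iff avoids_def by blast+
    then show ?thesis
      using pos[of "of_int c" u v] neg[of u v "of_int c"] by argo
  qed
  then show ?thesis unfolding sign_pattern_eq_iff avoids_def by blast
qed

text \<open>The complement of a block is a union of open blocks, so every block is clopen, and a
  connected set that meets a clopen set lies inside it.\<close>

lemma connected_components_of_open_partition:
  assumes "\<Union>\<C> = topspace X" and "pairwise disjnt \<C>" and "{} \<notin> \<C>"
    and op: "\<And>C. C \<in> \<C> \<Longrightarrow> openin X C" and con: "\<And>C. C \<in> \<C> \<Longrightarrow> connectedin X C"
  shows "connected_components_of X = \<C>"
proof -
  have comp: "connected_component_of_set X a = C" if C: "C \<in> \<C>" and a: "a \<in> C" for a C
  proof
    show "C \<subseteq> connected_component_of_set X a"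
      using connected_component_of_maximal[OF con[OF C] a] by blast
    let ?K = "connected_component_of_set X a"
    have "topspace X - C = \<Union>(\<C> - {C})"
      using assms(1) C diff_Union_pairwise_disjoint[OF assms(2), of "{C}"] by simp
    then have "openin X (topspace X - C)"
      using op by auto
    then have "closedin X C"
      using op[OF C] by (simp add: closedin_def openin_subset)
    moreover have "connectedin X ?K"
      by (rule connectedin_connected_component_of)
    moreover have "a \<in> ?K"
      using C a assms(1) by (auto simp: connected_component_of_refl)
    ultimately show "?K \<subseteq> C"
      using connectedin_clopen_cases[of X ?K C] op[OF C] a by (auto simp: disjnt_def)
  qed
  show ?thesis
  proof
    show "connected_components_of X \<subseteq> \<C>"
    proof
      fix K assume "K \<in> connected_components_of X"
      then obtain a where "a \<in> topspace X" "K = connected_component_of_set X a"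
        by (auto simp: connected_components_of_def)
      then show "K \<in> \<C>" using assms(1) comp by blast
    qed
    show "\<C> \<subseteq> connected_components_of X"
    proof
      fix C assume C: "C \<in> \<C>"
      then obtain a where a: "a \<in> C" using assms(3) by fastforce
      then have "a \<in> topspace X" using assms(1) C by auto
      with comp[OF C a] show "C \<in> connected_components_of X"
        unfolding connected_components_of_def by blast
    qed
  qed
qed

text \<open>The cells of equal sign pattern are open, because there are finitely many hyperplanes,
  and connected by segments. Patterns range over all real functions, points of
  \<open>Euclidean_space n\<close> only over those vanishing from index \<open>n\<close> on;
  truncating a function there changes no pattern.\<close>

lemma card_linial_regions:
  "card (linial_regions n) = card (sign_patterns (linial {..<n}))"
proof -
  let ?A = "linial {..<n}"
  define T where "T = {x :: nat \<Rightarrow> real. \<forall>i\<ge>n. x i = 0}"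
  define S where "S = {x \<in> T. avoids ?A x}"
  define cell where "cell P = {x \<in> S. sign_pattern ?A x = P}" for P
  have S_eq: "topspace (Euclidean_space n) - \<Union>(linial_hyperplanes n) = S"
  proof
    show "topspace (Euclidean_space n) - \<Union>(linial_hyperplanes n) \<subseteq> S"
    proof
      fix x assume x: "x \<in> topspace (Euclidean_space n) - \<Union>(linial_hyperplanes n)"
      have "x i - x j \<noteq> 1" if "i < j" "j < n" for i j
      proof
        assume "x i - x j = 1"
        then have "x \<in> \<Union>(linial_hyperplanes n)"
          using that x unfolding linial_hyperplanes_def by blast
        with x show False by simp
      qed
      with x show "x \<in> S"
        by (auto simp: S_def T_def topspace_Euclidean_space avoids_def linial_def)
    qed
    show "S \<subseteq> topspace (Euclidean_space n) - \<Union>(linial_hyperplanes n)"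
      by (fastforce simp: S_def T_def linial_hyperplanes_def topspace_Euclidean_space avoids_def linial_def)
  qed
  define X where "X = subtopology (Euclidean_space n) S"
  \<comment> \<open>\<open>Euclidean_space n\<close> is a subspace of the product topology, which is
    the standard topology of the function type.\<close>
  have X: "X = top_of_set S"
    unfolding X_def Euclidean_space_def euclidean_product_topology subtopology_subtopology
    by (rule arg_cong[of _ _ "\<lambda>U. top_of_set U"]) (auto simp: S_def T_def)
  have finA: "finite ?A"
  proof (rule finite_subset)
    show "?A \<subseteq> {..<n} \<times> {..<n} \<times> {1}" by (auto simp: linial_def)
  qed simp
  have opn: "open {x :: nat \<Rightarrow> real. x u - x v > c}" "open {x :: nat \<Rightarrow> real. x u - x v < c}" for u v c
    by (intro open_Collect_less continuous_intros continuous_on_product_coordinates)+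
  have "connected_components_of X = cell ` sign_patterns ?A"
  proof (rule connected_components_of_open_partition)
    have tr: "\<exists>y\<in>S. sign_pattern ?A y = sign_pattern ?A x" if "avoids ?A x" for x
      using that
      by (intro bexI[of _ "\<lambda>i. if i < n then x i else 0"])
         (auto simp: S_def T_def sign_pattern_eq_iff avoids_def linial_def)
    show "\<Union>(cell ` sign_patterns ?A) = topspace X"
      by (auto simp: X cell_def sign_patterns_def S_def)
    show "pairwise disjnt (cell ` sign_patterns ?A)"
      by (auto simp: pairwise_def disjnt_def cell_def)
    show "{} \<notin> cell ` sign_patterns ?A"
      using tr by (fastforce simp: cell_def sign_patterns_def)
  next
    fix C assume "C \<in> cell ` sign_patterns ?A"
    then obtain z where z: "avoids ?A z" and C: "C = cell (sign_pattern ?A z)"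
      by (auto simp: sign_patterns_def)
    \<comment> \<open>Off the hyperplanes, failing \<open>>\<close> means \<open><\<close>, so a
      cell is cut out of \<open>S\<close> by finitely many open half spaces.\<close>
    have C_eq: "C = S \<inter> (\<Inter>(u, v, c)\<in>?A. if z u - z v > of_int c
         then {x. x u - x v > of_int c} else {x. x u - x v < of_int c})" (is "_ = S \<inter> ?I")
    proof -
      have "x \<in> ?I \<longleftrightarrow> sign_pattern ?A x = sign_pattern ?A z" if "x \<in> S" for x
      proof -
        have "avoids ?A x" using that by (simp add: S_def)
        then show ?thesis
          unfolding sign_pattern_eq_iff avoids_def
          by (fastforce split: if_splits)
      qed
      then show ?thesis unfolding C cell_def by blast
    qed
    show "openin X C"
      unfolding C_eq X
      by (intro openin_open_Int open_INT finA) (auto simp: opn)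
    have "connected C"
    proof -
      have "\<exists>T. connected T \<and> T \<subseteq> C \<and> x \<in> T \<and> y \<in> T" if x: "x \<in> C" and y: "y \<in> C" for x y
      proof -
        define p where "p = (\<lambda>t :: real. \<lambda>i. (1 - t) * x i + t * y i)"
        have "continuous_on {0..1} p"
          unfolding p_def by (intro continuous_on_coordinatewise_then_product continuous_intros)
        then have "connected (p ` {0..1})"
          by (rule connected_continuous_image) simp
        moreover have "p ` {0..1} \<subseteq> C"
        proof (safe)
          fix t :: real assume t: "t \<in> {0..1}"
          have "p t \<in> T" using x y by (auto simp: C cell_def S_def T_def p_def)
          moreover have "avoids ?A (p t) \<and> sign_pattern ?A (p t) = sign_pattern ?A z"
            using avoids_convex[of ?A x y t] x y t unfolding p_def C cell_def S_def by auto
          ultimately show "p t \<in> C" by (simp add: C cell_def S_def)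
        qed
        moreover have "x \<in> p ` {0..1}" by (rule image_eqI[of _ _ 0]) (auto simp: p_def)
        moreover have "y \<in> p ` {0..1}" by (rule image_eqI[of _ _ 1]) (auto simp: p_def)
        ultimately show ?thesis by blast
      qed
      then have "\<forall>x\<in>C. \<forall>y\<in>C. connected_component C x y"
        by (simp only: connected_component_def) blast
      then show ?thesis
        by (simp only: connected_iff_connected_component[of C])
    qed
    then show "connectedin X C"
      unfolding X connectedin_subtopology using C by (auto simp: cell_def)
  qed
  moreover have "inj_on cell (sign_patterns ?A)"
  proof (rule inj_onI)
    fix P Q assume P: "P \<in> sign_patterns ?A" and eq: "cell P = cell Q"
    then obtain x where x: "avoids ?A x" "P = sign_pattern ?A x" by (auto simp: sign_patterns_def)
    then have "(\<lambda>i. if i < n then x i else 0) \<in> cell P"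
      by (auto simp: cell_def S_def T_def sign_pattern_eq_iff avoids_def linial_def)
    then show "P = Q" using eq by (auto simp: cell_def)
  qed
  ultimately show ?thesis
    unfolding linial_regions_def S_eq X_def[symmetric] by (simp add: card_image)
qed

section \<open>Deletion and contraction\<close>

text \<open>On the hyperplane \<open>x u - x v = c\<close> the coordinate at \<open>u\<close> is
  eliminated by \<open>x u = x v + c\<close>, which shifts the offsets of the edges at
  \<open>u\<close>. Edges may become equal, and edges between \<open>u\<close> and \<open>v\<close>
  become loops.\<close>

definition contract :: "'v \<times> 'v \<times> int \<Rightarrow> ('v \<times> 'v \<times> int) \<Rightarrow> ('v \<times> 'v \<times> int)" where
  "contract e = (case e of (u, v, c) \<Rightarrow> \<lambda>(s, t, d).
     (if s = u then v else s, if t = u then v else t,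
      d - (if s = u then c else 0) + (if t = u then c else 0)))"

definition induced :: "('v \<times> 'v \<times> int) set \<Rightarrow> 'v set \<Rightarrow> ('v \<times> 'v \<times> int) set" where
  "induced A S = {(u, v, c) \<in> A. u \<in> S \<and> v \<in> S}"

text \<open>After contractions a vertex represents a rigid group of original vertices;
  \<open>lo\<close> and \<open>hi\<close> are the extreme offsets in the group, all of which has to
  lie in \<open>[0, q)\<close>.\<close>

definition placements ::
    "int \<Rightarrow> 'v set \<Rightarrow> ('v \<Rightarrow> int) \<Rightarrow> ('v \<Rightarrow> int) \<Rightarrow> ('v \<times> 'v \<times> int) set \<Rightarrow> ('v \<Rightarrow> int) set" where
  "placements q V lo hi A =
     {h \<in> V \<rightarrow>\<^sub>E UNIV. (\<forall>v\<in>V. 0 \<le> h v + lo v \<and> h v + hi v < q) \<and> avoids A h}"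

lemma avoids_contract:
  assumes "u \<noteq> v"
  shows "avoids (contract (u, v, c) ` A) x \<longleftrightarrow> avoids A (x(u := x v + of_int c))"
  using assms unfolding avoids_def contract_def
  by (auto simp: algebra_simps split: if_splits)

lemma avoids_insert:
  "avoids (insert (u, v, c) A) x \<longleftrightarrow> x u - x v \<noteq> of_int c \<and> avoids A x"
  by (simp add: avoids_def)

section \<open>Region counts under deletion and contraction\<close>

lemma finite_sign_patterns: "finite A \<Longrightarrow> finite (sign_patterns A)"
  by (rule finite_subset[of _ "Pow A"]) (auto simp: sign_patterns_def sign_pattern_def)

lemma sign_pattern_altdef: "sign_pattern A x = {a \<in> A. (\<lambda>(s, t, d). x s - x t > of_int d) a}"
  by (auto simp: sign_pattern_def)

text \<open>Patterns of the contraction are pulled back along \<open>contract\<close>. This is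
  injective even where \<open>contract\<close> identifies edges, because the image of the pulled
  back pattern is the pattern itself.\<close>

lemma card_sign_patterns_contract:
  assumes "u \<noteq> v"
  shows "card (sign_patterns (contract (u, v, c) ` A)) =
    card (sign_pattern A ` {y. avoids A y \<and> y u - y v = of_int c})"
proof -
  let ?k = "contract (u, v, c)"
  let ?f = "\<lambda>P. {a \<in> A. ?k a \<in> P}"
  have *: "sign_pattern A (x(u := x v + of_int c)) = ?f (sign_pattern (?k ` A) x)" for x
  proof -
    have "(\<lambda>(s, t, d). (x(u := x v + of_int c)) s - (x(u := x v + of_int c)) t > of_int d) a \<longleftrightarrow>
        (\<lambda>(s, t, d). x s - x t > of_int d) (?k a)" for a
      using assms by (cases a) (auto simp: contract_def algebra_simps)
    then show ?thesis unfolding sign_pattern_altdef by auto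
  qed
  have "{y :: 'a \<Rightarrow> real. avoids A y \<and> y u - y v = of_int c} =
      (\<lambda>x. x(u := x v + of_int c)) ` {x. avoids (?k ` A) x}" (is "?L = ?g ` ?R")
  proof
    show "?L \<subseteq> ?g ` ?R"
    proof
      fix y assume y: "y \<in> ?L"
      then have "y = ?g y" by (auto simp: fun_eq_iff algebra_simps)
      moreover have "y \<in> ?R" unfolding mem_Collect_eq avoids_contract[OF assms]
        using y calculation by simp
      ultimately show "y \<in> ?g ` ?R" by blast
    qed
  qed (use assms in \<open>auto simp: avoids_contract\<close>)
  then have "sign_pattern A ` ?L = ?f ` sign_patterns (?k ` A)"
    by (simp only: sign_patterns_def image_image *)
  moreover have "inj_on ?f (sign_patterns (?k ` A))"
  proof (rule inj_on_inverseI[where g = "image ?k"])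
    fix P assume "P \<in> sign_patterns (?k ` A)"
    then have "P \<subseteq> ?k ` A" by (auto simp: sign_patterns_def sign_pattern_def)
    then show "?k ` ?f P = P" by blast
  qed
  ultimately show ?thesis by (simp add: card_image)
qed

text \<open>Finitely many strict inequalities survive a small change of one coordinate. Moving
  \<open>u\<close> up and down takes a point of a new hyperplane to both of its sides without
  leaving its old cell.\<close>

lemma avoids_perturb:
  fixes y :: "'v \<Rightarrow> real"
  assumes "finite A" "avoids A y"
  shows "\<exists>e>0. \<forall>d. \<bar>d\<bar> < e \<longrightarrow> avoids A (y(u := y u + d)) \<and>
    sign_pattern A (y(u := y u + d)) = sign_pattern A y"
  using assms
proof (induction A rule: finite_induct)
  case empty
  then show ?case by (auto simp: avoids_def sign_pattern_def intro: exI[of _ 1])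
next
  case (insert a A)
  obtain s t c where a: "a = (s, t, c)" by (cases a)
  from insert obtain e where e: "e > 0" "\<And>d. \<bar>d\<bar> < e \<Longrightarrow> avoids A (y(u := y u + d)) \<and>
    sign_pattern A (y(u := y u + d)) = sign_pattern A y"
    unfolding a avoids_insert by blast
  define e' where "e' = min e \<bar>y s - y t - of_int c\<bar>"
  have "e' > 0" using e(1) insert.prems by (simp add: e'_def avoids_def a)
  moreover have "avoids (insert a A) (y(u := y u + d)) \<and>
      sign_pattern (insert a A) (y(u := y u + d)) = sign_pattern (insert a A) y" if "\<bar>d\<bar> < e'" for d
  proof -
    let ?z = "y(u := y u + d)"
    have "\<bar>(?z s - ?z t) - (y s - y t)\<bar> < \<bar>y s - y t - of_int c\<bar>"
      using that by (auto simp: e'_def)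
    then have "?z s - ?z t \<noteq> of_int c \<and> (?z s - ?z t > of_int c) = (y s - y t > of_int c)"
      by linarith
    moreover have "avoids A ?z" "sign_pattern A ?z = sign_pattern A y"
      using e(2)[of d] that by (auto simp: e'_def)
    ultimately show ?thesis
      unfolding a avoids_insert sign_pattern_eq_iff by simp
  qed
  ultimately show ?case by blast
qed

text \<open>A new hyperplane splits exactly the cells that it meets. Such a cell has points on both
  sides and is counted twice in \<open>card ?L + card ?G\<close>; conversely, by convexity, a cell
  with points on both sides contains a point of the hyperplane. The cells met are the regions of the
  contraction.\<close>

lemma card_sign_patterns_insert:
  assumes "finite A" "u \<noteq> v" "(u, v, c) \<notin> A"
  shows "card (sign_patterns (insert (u, v, c) A)) =
    card (sign_patterns A) + card (sign_patterns (contract (u, v, c) ` A))"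
proof -
  let ?e = "(u, v, c)"
  let ?H = "\<lambda>Q. sign_pattern A ` {y. avoids A y \<and> Q (y u - y v)}"
  let ?L = "?H (\<lambda>x. x < of_int c)" and ?G = "?H (\<lambda>x. x > of_int c)" and ?E = "?H (\<lambda>x. x = of_int c)"
  have fin: "finite (?H Q)" for Q
    by (rule finite_subset[OF _ finite_sign_patterns[OF assms(1)]]) (auto simp: sign_patterns_def)
  have sub: "P \<subseteq> A" if "P \<in> ?H Q" for P Q
    using that by (auto simp: sign_pattern_def)
  have "sign_patterns (insert ?e A) = ?L \<union> insert ?e ` ?G"
  proof -
    have "sign_pattern (insert ?e A) y =
        (if y u - y v > of_int c then insert ?e (sign_pattern A y) else sign_pattern A y)" for y
      by (auto simp: sign_pattern_def)
    then show ?thesis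
      unfolding sign_patterns_def avoids_insert by (fastforce simp: image_iff not_less)
  qed
  moreover have "?L \<inter> insert ?e ` ?G = {}"
    using sub assms(3) by blast
  moreover have "inj_on (insert ?e) ?G"
  proof (rule inj_onI)
    fix P Q assume "P \<in> ?G" "Q \<in> ?G" "insert ?e P = insert ?e Q"
    moreover have "?e \<notin> P" "?e \<notin> Q" using sub[OF calculation(1)] sub[OF calculation(2)] assms(3) by auto
    ultimately show "P = Q" using insert_ident by metis
  qed
  ultimately have "card (sign_patterns (insert ?e A)) = card ?L + card ?G"
    using card_Un_disjoint[of ?L "insert ?e ` ?G"] fin[of "\<lambda>x. x < of_int c"] fin[of "\<lambda>x. x > of_int c"]
    by (simp only: finite_imageI card_image)
  also have "\<dots> = card (?L \<union> ?G) + card (?L \<inter> ?G)"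
    using card_Un_Int[of ?L ?G] fin[of "\<lambda>x. x < of_int c"] fin[of "\<lambda>x. x > of_int c"] by simp
  also have "?L \<inter> ?G = ?E"
  proof
    show "?L \<inter> ?G \<subseteq> ?E"
    proof
      fix P assume P: "P \<in> ?L \<inter> ?G"
      then obtain x y where x: "avoids A x" "x u - x v < of_int c" "P = sign_pattern A x"
        and y: "avoids A y" "y u - y v > of_int c" "P = sign_pattern A y" by blast
      \<comment> \<open>The parameter at which the segment from \<open>x\<close> to \<open>y\<close>
        crosses the hyperplane \<open>x u - x v = c\<close>.\<close>
      define t where "t = (of_int c - (x u - x v)) / ((y u - y v) - (x u - x v))"
      have t: "0 \<le> t" "t \<le> 1" using x(2) y(2) by (auto simp: t_def)
      define z where "z = (\<lambda>i. (1 - t) * x i + t * y i)"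
      have "t * ((y u - y v) - (x u - x v)) = of_int c - (x u - x v)"
        using x(2) y(2) by (simp add: t_def)
      then have "z u - z v = of_int c" by (simp add: z_def algebra_simps)
      moreover have "avoids A z \<and> sign_pattern A z = P"
        using avoids_convex[of A x y t] x y t unfolding z_def by simp
      ultimately show "P \<in> ?E" by blast
    qed
    show "?E \<subseteq> ?L \<inter> ?G"
    proof
      fix P assume "P \<in> ?E"
      then obtain y where y: "avoids A y" "y u - y v = of_int c" "P = sign_pattern A y" by blast
      obtain e where e: "e > 0" "\<And>d. \<bar>d\<bar> < e \<Longrightarrow> avoids A (y(u := y u + d)) \<and>
        sign_pattern A (y(u := y u + d)) = sign_pattern A y"
        using avoids_perturb[OF assms(1) y(1), of u] by blast
      have "P \<in> ?L"
        using e(2)[of "- e / 2"] e(1) y assms(2)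
        by (intro image_eqI[of _ _ "y(u := y u + (- e / 2))"]) auto
      moreover have "P \<in> ?G"
        using e(2)[of "e / 2"] e(1) y assms(2)
        by (intro image_eqI[of _ _ "y(u := y u + e / 2)"]) auto
      ultimately show "P \<in> ?L \<inter> ?G" by blast
    qed
  qed
  also have "?L \<union> ?G = sign_patterns A"
  proof -
    have "sign_patterns A = ?L \<union> ?G \<union> ?E"
      unfolding sign_patterns_def image_Un[symmetric]
      by (rule arg_cong[of _ _ "image _"]) (auto simp: not_less less_le)
    then show ?thesis using \<open>?L \<inter> ?G = ?E\<close> by blast
  qed
  also have "card ?E = card (sign_patterns (contract (u, v, c) ` A))"
    by (rule card_sign_patterns_contract[OF assms(2), symmetric])
  finally show ?thesis .
qed

section \<open>Integer points under deletion and contraction\<close>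

lemma placements_iff:
  "h \<in> placements q V lo hi A \<longleftrightarrow> (\<forall>x. x \<notin> V \<longrightarrow> h x = undefined) \<and>
     (\<forall>v\<in>V. 0 \<le> h v + lo v \<and> h v + hi v < q) \<and> avoids A h"
  unfolding placements_def mem_Collect_eq PiE_iff extensional_def by simp

lemma finite_placements:
  assumes "finite V"
  shows "finite (placements q V lo hi A)"
proof -
  have "placements q V lo hi A \<subseteq> (\<Pi>\<^sub>E v\<in>V. {- lo v..<q - hi v})"
  proof
    fix h assume "h \<in> placements q V lo hi A"
    then have bounds: "\<And>x. x \<in> V \<Longrightarrow> 0 \<le> h x + lo x \<and> h x + hi x < q"
      and undef: "\<And>x. x \<notin> V \<Longrightarrow> h x = undefined"
      by (simp_all add: placements_iff)
    have "h x \<in> {- lo x..<q - hi x}" if "x \<in> V" for x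
      using bounds[OF that] by (simp add: algebra_simps)
    then show "h \<in> (\<Pi>\<^sub>E v\<in>V. {- lo v..<q - hi v})"
      using undef by (rule PiE_I)
  qed
  moreover have "finite (\<Pi>\<^sub>E v\<in>V. {- lo v..<q - hi v})"
    using assms by (simp add: finite_PiE)
  ultimately show ?thesis by (rule finite_subset)
qed

text \<open>The placements lost by adding the edge satisfy \<open>h u = h v + c\<close>, so they are
  determined on \<open>V - {u}\<close>. The range condition at \<open>u\<close> becomes a second
  range condition at \<open>v\<close>, with offsets shifted by \<open>c\<close>; \<open>min\<close>
  and \<open>max\<close> merge it with the first.\<close>

lemma card_placements_insert:
  assumes "finite V" "u \<in> V" "v \<in> V" "u \<noteq> v" "A \<subseteq> V \<times> V \<times> UNIV"
  shows "card (placements q V lo hi (insert (u, v, c) A)) +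
      card (placements q (V - {u}) (lo(v := min (lo v) (lo u + c))) (hi(v := max (hi v) (hi u + c)))
        (contract (u, v, c) ` A)) =
    card (placements q V lo hi A)" (is "card ?I + card ?C = card ?P")
proof -
  let ?D = "{h \<in> ?P. h u - h v = c}"
  let ?g = "\<lambda>h :: 'a \<Rightarrow> int. h(u := h v + c)"
  have "bij_betw ?g ?C ?D"
  proof (rule bij_betwI[where g = "\<lambda>h. h(u := undefined)"])
    show "?g \<in> ?C \<rightarrow> ?D"
    proof
      fix h assume "h \<in> ?C"
      then have h: "\<And>x. x \<notin> V - {u} \<Longrightarrow> h x = undefined" "avoids (contract (u, v, c) ` A) h"
        and b: "\<And>x. x \<in> V - {u} \<Longrightarrow> 0 \<le> h x + (lo(v := min (lo v) (lo u + c))) x \<and>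
          h x + (hi(v := max (hi v) (hi u + c))) x < q"
        unfolding placements_iff by blast+
      have h': "avoids A (?g h)" using h(2) by (simp only: avoids_contract[OF assms(4)] of_int_eq_id id_apply)
      have b1: "0 \<le> h x + lo x \<and> h x + hi x < q" if "x \<in> V" "x \<noteq> u" "x \<noteq> v" for x
        using b[of x] that by simp
      have b2: "0 \<le> h v + min (lo v) (lo u + c)" "h v + max (hi v) (hi u + c) < q"
        using b[of v] assms(3,4) by simp_all
      have "0 \<le> ?g h x + lo x \<and> ?g h x + hi x < q" if "x \<in> V" for x
        using b1[OF that] b2 assms(4) by (cases "x = u"; cases "x = v") auto
      moreover have "?g h x = undefined" if "x \<notin> V" for x
        using h(1)[of x] that assms(2) by auto
      ultimately have "?g h \<in> ?P" using h' unfolding placements_iff by blast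
      then show "?g h \<in> ?D" using assms(4) by simp
    qed
    show "(\<lambda>h. h(u := undefined)) \<in> ?D \<rightarrow> ?C"
    proof
      fix h assume h: "h \<in> ?D"
      let ?h = "h(u := undefined)"
      have hp: "\<And>x. x \<notin> V \<Longrightarrow> h x = undefined" "avoids A h" "h v + c = h u"
        and bounds: "\<And>x. x \<in> V \<Longrightarrow> 0 \<le> h x + lo x \<and> h x + hi x < q"
        using h unfolding placements_iff by auto
      have "?g ?h = h" using assms(4) hp(3) by (auto simp: fun_eq_iff)
      then have "avoids (contract (u, v, c) ` A) ?h"
        using hp(2) by (simp only: avoids_contract[OF assms(4)] of_int_eq_id id_apply)
      moreover have "0 \<le> ?h x + (lo(v := min (lo v) (lo u + c))) x \<and>
          ?h x + (hi(v := max (hi v) (hi u + c))) x < q" if "x \<in> V - {u}" for x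
        using bounds[of x] bounds[OF assms(2)] hp(3) that by (cases "x = v") auto
      moreover have "?h x = undefined" if "x \<notin> V - {u}" for x
        using hp(1)[of x] that by auto
      ultimately show "?h \<in> ?C" unfolding placements_iff by blast
    qed
    show "(?g h)(u := undefined) = h" if "h \<in> ?C" for h
      using that by (auto simp: placements_iff fun_eq_iff)
    show "?g (h(u := undefined)) = h" if "h \<in> ?D" for h
      using that assms(4) by (auto simp: fun_eq_iff)
  qed
  then have "card ?C = card ?D" by (rule bij_betw_same_card)
  moreover have "?P = ?I \<union> ?D" "?I \<inter> ?D = {}"
    by (auto simp: placements_def avoids_insert)
  moreover have "finite ?I" "finite ?D" using finite_placements[OF assms(1)] by auto
  ultimately show ?thesis by (metis (no_types, lifting) card_Un_disjoint)
qed

section \<open>The alternating sum over induced arrangements\<close>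

lemma induced_subset: "induced A S \<subseteq> A"
  by (auto simp: induced_def)

lemma finite_induced: "finite A \<Longrightarrow> finite (induced A S)"
  by (rule finite_subset[OF induced_subset])

lemma sign_patterns_empty [simp]: "sign_patterns {} = {{}}"
  by (auto simp: sign_patterns_def sign_pattern_def avoids_def)

lemma induced_contract_in:
  assumes "u \<in> S" "v \<in> S" "u \<noteq> v"
  shows "induced (contract (u, v, c) ` A) (S - {u}) = contract (u, v, c) ` induced A S"
proof -
  have *: "contract (u, v, c) a \<in> (S - {u}) \<times> (S - {u}) \<times> UNIV \<longleftrightarrow> a \<in> S \<times> S \<times> UNIV" for a
    using assms by (cases a) (auto simp: contract_def)
  have **: "induced A S = A \<inter> S \<times> S \<times> UNIV" for A :: "('a \<times> 'a \<times> int) set" and S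
    by (auto simp: induced_def)
  have "f ` A \<inter> P' = f ` (A \<inter> P)" if "\<And>a. f a \<in> P' \<longleftrightarrow> a \<in> P"
    for f :: "'a \<times> 'a \<times> int \<Rightarrow> 'a \<times> 'a \<times> int" and P P'
    using that by blast
  from this[OF *] show ?thesis unfolding ** .
qed

lemma induced_contract_notin:
  assumes "u \<notin> S" "v \<notin> S"
  shows "induced (contract (u, v, c) ` A) S = induced A S"
proof -
  have fixed: "contract (u, v, c) a = a" if "a \<in> induced A S" for a
    using that assms by (auto simp: induced_def contract_def)
  show ?thesis
  proof
    show "induced A S \<subseteq> induced (contract (u, v, c) ` A) S"
    proof
      fix a assume a: "a \<in> induced A S"
      then have "a \<in> contract (u, v, c) ` A"
        using fixed[OF a] by (intro rev_image_eqI[of a]) (auto simp: induced_def)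
      then show "a \<in> induced (contract (u, v, c) ` A) S"
        using a by (auto simp: induced_def)
    qed
    show "induced (contract (u, v, c) ` A) S \<subseteq> induced A S"
      using assms by (auto simp: induced_def contract_def split: if_splits)
  qed
qed

lemma induced_empty [simp]: "induced {} S = {}"
  by (simp add: induced_def)

lemma induced_insert:
  "induced (insert (u, v, c) A) S =
    (if u \<in> S \<and> v \<in> S then insert (u, v, c) (induced A S) else induced A S)"
  by (auto simp: induced_def)

lemma placements_cong:
  assumes "\<And>x. x \<in> V \<Longrightarrow> lo x = lo' x" "\<And>x. x \<in> V \<Longrightarrow> hi x = hi' x"
  shows "placements q V lo hi A = placements q V lo' hi' A"
  using assms by (simp add: placements_def cong: ball_cong)

lemma card_placements_empty:
  assumes "finite V" "\<And>v. v \<in> V \<Longrightarrow> hi v - lo v \<le> q"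
  shows "int (card (placements q V lo hi {})) = (\<Prod>v\<in>V. q - hi v + lo v)"
proof -
  have "placements q V lo hi {} = (\<Pi>\<^sub>E v\<in>V. {- lo v..<q - hi v})"
  proof (rule Set.set_eqI)
    fix h
    have "(0 \<le> h v + lo v \<and> h v + hi v < q) = (h v \<in> {- lo v..<q - hi v})" for v
      by auto
    then show "h \<in> placements q V lo hi {} \<longleftrightarrow> h \<in> (\<Pi>\<^sub>E v\<in>V. {- lo v..<q - hi v})"
      by (auto simp: placements_iff PiE_iff extensional_def avoids_def)
  qed
  moreover have "int (nat (q - hi v - - lo v)) = q - hi v + lo v" if "v \<in> V" for v
    using assms(2)[OF that] by simp
  ultimately show ?thesis
    using assms(1) by (simp add: card_PiE of_nat_prod)
qed

text \<open>One term of a convolution: the vertices in \<open>S\<close> carry a region, the others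
  an integer point. The sign turns the region counts into the coefficients of f(-x).\<close>

definition sign_placements ::
    "int \<Rightarrow> 'v set \<Rightarrow> ('v \<Rightarrow> int) \<Rightarrow> ('v \<Rightarrow> int) \<Rightarrow> ('v \<times> 'v \<times> int) set \<Rightarrow> 'v set \<Rightarrow> int" where
  "sign_placements q V lo hi A S = (-1) ^ card S * int (card (sign_patterns (induced A S)))
     * int (card (placements q (V - S) lo hi (induced A (V - S))))"

text \<open>The edge matters only if \<open>S\<close> contains both of its ends or neither. With
  neither, the number of placements drops by that of the contraction. With both, the number of
  regions grows by that of the contraction, but \<open>S\<close> also loses a vertex when
  \<open>u\<close> is merged into \<open>v\<close>, so the sign changes. Both cases thus subtract a
  term of the contraction.\<close>

lemma sum_sign_placements_insert:
  fixes lo hi :: "'v \<Rightarrow> int"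
  assumes V: "finite V" "u \<in> V" "v \<in> V" "u \<noteq> v" and A: "A \<subseteq> V \<times> V \<times> UNIV" "finite A" "(u, v, c) \<notin> A"
  defines "lo' \<equiv> lo(v := min (lo v) (lo u + c))" and "hi' \<equiv> hi(v := max (hi v) (hi u + c))"
  shows "(\<Sum>S\<in>Pow V. sign_placements q V lo hi (insert (u, v, c) A) S) =
    (\<Sum>S\<in>Pow V. sign_placements q V lo hi A S) -
    (\<Sum>S\<in>Pow (V - {u}). sign_placements q (V - {u}) lo' hi' (contract (u, v, c) ` A) S)"
proof -
  let ?e = "(u, v, c)" and ?lift = "\<lambda>S. if v \<in> S then insert u S else S"
  let ?F = "sign_placements q V lo hi A"
  define D where "D S = sign_placements q V lo hi (insert ?e A) S - ?F S" for S
  have D: "D (?lift S) = - sign_placements q (V - {u}) lo' hi' (contract ?e ` A) S"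
    if S: "S \<in> Pow (V - {u})" for S
  proof (cases "v \<in> S")
    case True
    let ?S = "insert u S"
    have [simp]: "finite S" "u \<notin> S" using S V(1) by (auto intro: finite_subset)
    have "?S - {u} = S" by simp
    then have c: "induced (contract ?e ` A) S = contract ?e ` induced A ?S"
      using induced_contract_in[of u ?S v c A] True V(4) by simp
    have "card (sign_patterns (insert ?e (induced A ?S))) =
        card (sign_patterns (induced A ?S)) + card (sign_patterns (contract ?e ` induced A ?S))"
      using A V(4) finite_induced[of A ?S] induced_subset[of A ?S]
      by (intro card_sign_patterns_insert) auto
    moreover have "placements q (V - {u} - S) lo' hi' (induced (contract ?e ` A) (V - {u} - S)) =
        placements q (V - ?S) lo hi (induced A (V - ?S))"
    proof -
      have W: "V - {u} - S = V - ?S" by auto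
      have "induced (contract ?e ` A) (V - ?S) = induced A (V - ?S)"
        using True by (intro induced_contract_notin) auto
      moreover have "placements q (V - ?S) lo' hi' B = placements q (V - ?S) lo hi B" for B
        using True by (intro placements_cong) (auto simp: lo'_def hi'_def)
      ultimately show ?thesis by (simp only: W)
    qed
    ultimately show ?thesis
      using True unfolding D_def sign_placements_def
      by (simp add: induced_insert c algebra_simps)
  next
    case False
    have "u \<notin> S" using S by auto
    let ?W = "V - S"
    have W: "u \<in> ?W" "v \<in> ?W" "V - {u} - S = ?W - {u}" using V False \<open>u \<notin> S\<close> by auto
    have "card (placements q ?W lo hi (insert ?e (induced A ?W))) +
        card (placements q (?W - {u}) lo' hi' (contract ?e ` induced A ?W)) =
        card (placements q ?W lo hi (induced A ?W))"
      unfolding lo'_def hi'_def using V W by (intro card_placements_insert) (auto simp: induced_def)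
    moreover have ind: "induced (contract ?e ` A) (?W - {u}) = contract ?e ` induced A ?W"
      using W V by (intro induced_contract_in) auto
    moreover have indS: "induced (contract ?e ` A) S = induced A S"
      using False \<open>u \<notin> S\<close> by (rule induced_contract_notin[rotated])
    ultimately have "card (placements q ?W lo hi (insert ?e (induced A ?W))) +
        card (placements q (?W - {u}) lo' hi' (induced (contract ?e ` A) (?W - {u}))) =
        card (placements q ?W lo hi (induced A ?W))"
      by simp
    then have *: "int (card (placements q ?W lo hi (insert ?e (induced A ?W)))) =
      int (card (placements q ?W lo hi (induced A ?W))) -
      int (card (placements q (?W - {u}) lo' hi' (induced (contract ?e ` A) (?W - {u}))))"
      by linarith
    have "induced (insert ?e A) S = induced A S" "induced (insert ?e A) ?W = insert ?e (induced A ?W)"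
      using W \<open>u \<notin> S\<close> by (simp_all add: induced_insert)
    then show ?thesis
      using False unfolding D_def sign_placements_def W(3) indS
      by (simp add: * algebra_simps)
  qed
  have inj: "inj_on ?lift (Pow (V - {u}))"
    by (rule inj_onI) (auto split: if_splits)
  \<comment> \<open>A set outside the range of \<open>?lift\<close> contains just one end of the
    edge, and then the edge lies in neither induced arrangement.\<close>
  have "D S = 0" if S: "S \<in> Pow V - ?lift ` Pow (V - {u})" for S
  proof -
    have "(u \<in> S) \<noteq> (v \<in> S)"
    proof
      assume eq: "(u \<in> S) = (v \<in> S)"
      have "S - {u} \<in> Pow (V - {u})" using S by auto
      moreover have "S = ?lift (S - {u})"
        using eq V(4) by (cases "u \<in> S") (simp_all add: insert_absorb)
      then show False using S by blast
    qed
    then show ?thesis by (auto simp: D_def sign_placements_def induced_insert)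
  qed
  then have "(\<Sum>S\<in>Pow V. D S) = (\<Sum>S\<in>?lift ` Pow (V - {u}). D S)"
    using V(1,2) by (intro sum.mono_neutral_right) auto
  also have "\<dots> = (\<Sum>S\<in>Pow (V - {u}). D (?lift S))"
    using inj by (simp only: sum.reindex o_def)
  also have "\<dots> = - (\<Sum>S\<in>Pow (V - {u}). sign_placements q (V - {u}) lo' hi' (contract ?e ` A) S)"
    using D by (simp only: sum_negf[symmetric] cong: sum.cong)
  finally show ?thesis
    by (simp add: D_def sum_subtractf)
qed

text \<open>A loop compares 0 with its offset, so for a nonzero offset every point lies off it and
  on the same side. Contraction creates such loops from parallel hyperplanes.\<close>

lemma sign_patterns_insert_loop:
  assumes "c \<noteq> 0"
  shows "card (sign_patterns (insert (u, u, c) A)) = card (sign_patterns A)"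
proof (cases "(u, u, c) \<in> A")
  case False
  have "sign_patterns (insert (u, u, c) A) = (if c < 0 then insert (u, u, c) else id) ` sign_patterns A"
  proof -
    have 1: "avoids (insert (u, u, c) A) x \<longleftrightarrow> avoids A x" for x :: "'a \<Rightarrow> real"
      using assms by (simp add: avoids_insert)
    have 2: "sign_pattern (insert (u, u, c) A) x =
        (if c < 0 then insert (u, u, c) else id) (sign_pattern A x)" for x
      by (auto simp: sign_pattern_def)
    show ?thesis
      unfolding sign_patterns_def image_image by (rule image_cong) (auto simp: 1 2)
  qed
  moreover have "inj_on (if c < 0 then insert (u, u, c) else id) (sign_patterns A)"
  proof (rule inj_on_inverseI[where g = "\<lambda>P. P - {(u, u, c)}"])
    fix P assume "P \<in> sign_patterns A"
    then have "P \<subseteq> A" by (auto simp: sign_patterns_def sign_pattern_def)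
    then show "(if c < 0 then insert (u, u, c) else id) P - {(u, u, c)} = P" using False by auto
  qed
  ultimately show ?thesis by (simp add: card_image)
qed (simp add: insert_absorb)

text \<open>A discrete form of Zaslavsky's theorem: both sides obey the same deletion-contraction
  recursion. A contracted vertex stands for several boxes and occupies the boxes from
  \<open>h v + lo v\<close> to \<open>h v + hi v\<close>.\<close>

theorem sum_sign_placements:
  assumes "finite V" "A \<subseteq> V \<times> V \<times> UNIV" "finite A"
  shows "\<exists>Q. \<forall>q\<ge>Q. (\<Sum>S\<in>Pow V. sign_placements q V lo hi A S) = int (card (placements (q - 1) V lo hi A))"
  using assms
proof (induction "card A" arbitrary: A V lo hi rule: less_induct)
  case less
  show ?case
  proof (cases "A = {}")
    case True
    obtain Q where Q: "\<And>v. v \<in> V \<Longrightarrow> hi v - lo v \<le> Q"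
      using bdd_above_finite[of "(\<lambda>v. hi v - lo v) ` V"] less.prems(1) by (auto simp: bdd_above_def)
    \<comment> \<open>Without edges there is one region, and the alternating sum is the expansion of
      a product of factors \<open>- 1 + (q - hi v + lo v)\<close>. The 1 added to \<open>Q\<close>
      keeps the interval lengths nonnegative at \<open>q - 1\<close> as well.\<close>
    have "(\<Sum>S\<in>Pow V. sign_placements q V lo hi A S) = int (card (placements (q - 1) V lo hi A))"
      if q: "q \<ge> Q + 1" for q
    proof -
      have "sign_placements q V lo hi A S = (\<Prod>v\<in>S. - 1) * (\<Prod>v\<in>V - S. q - hi v + lo v)"
        if "S \<in> Pow V" for S
      proof -
        have "int (card (placements q (V - S) lo hi {})) = (\<Prod>v\<in>V - S. q - hi v + lo v)"
          using less.prems(1) Q q by (intro card_placements_empty) force+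
        then show ?thesis
          by (simp add: True sign_placements_def)
      qed
      then have "(\<Sum>S\<in>Pow V. sign_placements q V lo hi A S) =
          (\<Sum>S\<in>Pow V. (\<Prod>v\<in>S. - 1) * (\<Prod>v\<in>V - S. q - hi v + lo v))"
        by (rule sum.cong[OF refl])
      also have "\<dots> = (\<Prod>v\<in>V. - 1 + (q - hi v + lo v))"
        by (rule prod_add[OF less.prems(1), symmetric])
      also have "\<dots> = int (card (placements (q - 1) V lo hi A))"
        using Q q less.prems(1) unfolding True
        by (subst card_placements_empty) (force intro!: prod.cong)+
      finally show ?thesis .
    qed
    then show ?thesis by blast
  next
    case False
    then obtain u v c where e: "(u, v, c) \<in> A" by auto
    define B where "B = A - {(u, v, c)}"
    have A: "A = insert (u, v, c) B" "(u, v, c) \<notin> B" using e by (auto simp: B_def)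
    have uv: "u \<in> V" "v \<in> V" using less.prems(2) e by auto
    have B: "B \<subseteq> V \<times> V \<times> UNIV" "finite B" "card B < card A"
      using less.prems A by auto
    obtain Q where Q: "\<And>q. q \<ge> Q \<Longrightarrow> (\<Sum>S\<in>Pow V. sign_placements q V lo hi B S) =
        int (card (placements (q - 1) V lo hi B))"
      using less.hyps[OF B(3) less.prems(1) B(1,2)] by blast
    show ?thesis
    proof (cases "u = v")
      case True
      show ?thesis
      proof (cases "c = 0")
        case c: True
        \<comment> \<open>A loop of offset 0 excludes every point. Its vertex lies in
          \<open>S\<close> or in \<open>V - S\<close>, so each term has a vanishing factor.\<close>
        have "sign_patterns (insert (u, u, 0) X) = {}" for X
          by (auto simp: sign_patterns_def avoids_def)
        moreover have "placements q W lo hi (insert (u, u, 0) X) = {}" for q W X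
          by (auto simp: placements_def avoids_def)
        ultimately have "sign_placements q V lo hi A S = 0" "placements q V lo hi A = {}" for q S
          using uv unfolding A(1) True[symmetric] c sign_placements_def induced_insert
          by (auto split: if_splits)
        then show ?thesis by simp
      next
        case c: False
        have "placements q W lo hi (insert (u, u, c) X) = placements q W lo hi X" for q W X
          using c by (auto simp: placements_def avoids_insert)
        then have "sign_placements q V lo hi A S = sign_placements q V lo hi B S"
          "placements q V lo hi A = placements q V lo hi B" for q S
          using c unfolding A(1) True[symmetric] sign_placements_def induced_insert
          by (auto simp: sign_patterns_insert_loop)
        then show ?thesis using Q by auto
      qed
    next
      case False
      let ?C = "contract (u, v, c) ` B"
      let ?lo = "lo(v := min (lo v) (lo u + c))" and ?hi = "hi(v := max (hi v) (hi u + c))"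
      have "card ?C < card A"
        using card_image_le[OF B(2), of "contract (u, v, c)"] B(3) by linarith
      moreover have "?C \<subseteq> (V - {u}) \<times> (V - {u}) \<times> UNIV"
        using B(1) uv False by (auto simp: contract_def split: if_splits)
      ultimately obtain Q' where Q': "\<And>q. q \<ge> Q' \<Longrightarrow>
          (\<Sum>S\<in>Pow (V - {u}). sign_placements q (V - {u}) ?lo ?hi ?C S) =
          int (card (placements (q - 1) (V - {u}) ?lo ?hi ?C))"
        using less.hyps[of ?C "V - {u}" ?lo ?hi] less.prems(1) B(2) by blast
      have "(\<Sum>S\<in>Pow V. sign_placements q V lo hi A S) = int (card (placements (q - 1) V lo hi A))"
        if "q \<ge> max Q Q'" for q
      proof -
        have "int (card (placements (q - 1) V lo hi A)) + int (card (placements (q - 1) (V - {u}) ?lo ?hi ?C)) =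
            int (card (placements (q - 1) V lo hi B))"
          unfolding A(1) of_nat_add[symmetric]
          by (rule arg_cong[OF card_placements_insert[OF less.prems(1) uv False B(1)]])
        moreover have "(\<Sum>S\<in>Pow V. sign_placements q V lo hi A S) =
            int (card (placements (q - 1) V lo hi B)) - int (card (placements (q - 1) (V - {u}) ?lo ?hi ?C))"
          unfolding A(1) sum_sign_placements_insert[OF less.prems(1) uv False B(1,2) A(2)]
          using Q[of q] Q'[of q] that by (simp only: max.bounded_iff)
        ultimately show ?thesis by linarith
      qed
      then show ?thesis by blast
    qed
  qed
qed

section \<open>Box counts for the Linial arrangement\<close>

lemma Collect_image_eq:
  "(\<And>a. Q (g a) = P a) \<Longrightarrow> {b \<in> g ` A. Q b} = g ` {a \<in> A. P a}"
  by blast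

lemma linial_relabel:
  assumes "finite V"
  obtains f where "bij_betw f {..<card V} V"
    "linial V = (\<lambda>(u, v, c). (f u, f v, c)) ` linial {..<card V}"
proof -
  obtain f where f: "bij_betw f {..<card V} V" "strict_mono_on {..<card V} f"
    using ex_bij_betw_strict_mono_card[OF assms] by blast
  have "linial V = (\<lambda>(u, v, c). (f u, f v, c)) ` linial {..<card V}" (is "_ = ?F ` _")
  proof
    show "linial V \<subseteq> ?F ` linial {..<card V}"
    proof
      fix e assume "e \<in> linial V"
      then obtain i j where e: "e = (i, j, 1)" "i \<in> V" "j \<in> V" "i < j" by (auto simp: linial_def)
      obtain a b where ab: "a < card V" "b < card V" "i = f a" "j = f b"
        using e(2,3) bij_betw_imp_surj_on[OF f(1)] by (metis imageE lessThan_iff)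
      then have "a < b"
        using e(4) strict_mono_on_less[OF f(2), of a b] by simp
      then show "e \<in> ?F ` linial {..<card V}"
        using ab e by (intro image_eqI[of _ _ "(a, b, 1)"]) (auto simp: linial_def)
    qed
    show "?F ` linial {..<card V} \<subseteq> linial V"
    proof -
      have "f i \<in> V" if "i < card V" for i
        using bij_betw_apply[OF f(1)] that by simp
      then show ?thesis
        using f(2) by (auto simp: linial_def strict_mono_on_def)
    qed
  qed
  with f(1) show ?thesis by (rule that)
qed

lemma card_sign_patterns_relabel:
  assumes f: "bij_betw f U V" and A: "A \<subseteq> U \<times> U \<times> UNIV"
  shows "card (sign_patterns ((\<lambda>(u, v, c). (f u, f v, c)) ` A)) = card (sign_patterns A)"
proof -
  let ?F = "\<lambda>(u, v, c :: int). (f u, f v, c)"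
  have inj: "inj_on f U" using f by (simp add: bij_betw_def)
  have injF: "inj_on ?F (U \<times> U \<times> UNIV)"
    using inj by (auto simp: inj_on_def)
  have av: "avoids (?F ` A) y \<longleftrightarrow> avoids A (y \<circ> f)" for y :: "'b \<Rightarrow> real"
    by (auto simp: avoids_def)
  have sp: "sign_pattern (?F ` A) y = ?F ` sign_pattern A (y \<circ> f)" for y
  proof -
    have *: "(\<lambda>(s, t, d). y s - y t > of_int d) (?F a) = (\<lambda>(s, t, d). (y \<circ> f) s - (y \<circ> f) t > of_int d) a" for a
      by (cases a) simp
    show ?thesis unfolding sign_pattern_altdef by (rule Collect_image_eq) (rule *)
  qed
  have "sign_patterns (?F ` A) = image ?F ` sign_patterns A"
  proof
    show "sign_patterns (?F ` A) \<subseteq> image ?F ` sign_patterns A"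
      by (auto simp: sign_patterns_def av sp)
    show "image ?F ` sign_patterns A \<subseteq> sign_patterns (?F ` A)"
    proof
      fix P assume "P \<in> image ?F ` sign_patterns A"
      then obtain x where x: "avoids A x" "P = ?F ` sign_pattern A x" by (auto simp: sign_patterns_def)
      \<comment> \<open>Patterns only involve values on \<open>U\<close>, so \<open>x\<close> may be
        carried to \<open>V\<close> along the inverse of \<open>f\<close>, whatever happens
        elsewhere.\<close>
      define y where "y = x \<circ> inv_into U f"
      have y: "y (f a) = x a" if "a \<in> U" for a using inj that by (simp add: y_def)
      have "avoids A (y \<circ> f)" "sign_pattern A (y \<circ> f) = sign_pattern A x"
      proof -
        have "(y \<circ> f) s - (y \<circ> f) t = x s - x t" if "(s, t, d) \<in> A" for s t d
          using A y that by auto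
        then show "avoids A (y \<circ> f)" "sign_pattern A (y \<circ> f) = sign_pattern A x"
          using x(1) unfolding avoids_def sign_pattern_eq_iff by fastforce+
      qed
      then show "P \<in> sign_patterns (?F ` A)"
        unfolding sign_patterns_def x(2) using av sp by (metis (no_types, lifting) imageI mem_Collect_eq)
    qed
  qed
  moreover have "inj_on (image ?F) (sign_patterns A)"
  proof (rule inj_on_subset[OF inj_on_image_Pow])
    show "inj_on ?F A" using injF A by (rule inj_on_subset)
    show "sign_patterns A \<subseteq> Pow A" by (auto simp: sign_patterns_def sign_pattern_def)
  qed
  ultimately show ?thesis by (simp add: card_image)
qed

definition region_count :: "nat \<Rightarrow> nat" where
  "region_count n = card (sign_patterns (linial {..<n}))"

lemma card_sign_patterns_linial: "finite V \<Longrightarrow> card (sign_patterns (linial V)) = region_count (card V)"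
proof -
  assume "finite V"
  then obtain f where f: "bij_betw f {..<card V} V"
    "linial V = (\<lambda>(u, v, c). (f u, f v, c)) ` linial {..<card V}"
    using linial_relabel by metis
  show ?thesis
    unfolding region_count_def f(2)
    by (rule card_sign_patterns_relabel[OF f(1)]) (auto simp: linial_def)
qed

text \<open>The integer points of the cube over \<open>V\<close> off the Linial hyperplanes, read as
  placing the elements of \<open>V\<close> into \<open>q\<close> boxes. The condition uses
  \<open>h j + 1\<close> because subtraction of natural numbers truncates.\<close>

definition boxes :: "nat \<Rightarrow> nat set \<Rightarrow> (nat \<Rightarrow> nat) set" where
  "boxes q V = {h \<in> V \<rightarrow>\<^sub>E {..<q}. \<forall>i\<in>V. \<forall>j\<in>V. i < j \<longrightarrow> h i \<noteq> h j + 1}"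

definition box_count :: "nat \<Rightarrow> nat \<Rightarrow> nat" where
  "box_count q n = card (boxes q {..<n})"

lemma finite_boxes: "finite V \<Longrightarrow> finite (boxes q V)"
  unfolding boxes_def by (rule finite_subset[of _ "V \<rightarrow>\<^sub>E {..<q}"]) (auto intro: finite_PiE)

lemma card_boxes:
  assumes "finite V"
  shows "card (boxes q V) = box_count q (card V)"
proof -
  obtain f where f: "bij_betw f {..<card V} V" "strict_mono_on {..<card V} f"
    using ex_bij_betw_strict_mono_card[OF assms] by blast
  let ?U = "{..<card V}" and ?g = "inv_into {..<card V} f"
  note bij = f(1)
  have less: "f i < f j \<longleftrightarrow> i < j" if "i \<in> ?U" "j \<in> ?U" for i j
    using strict_mono_on_less[OF f(2)] that by blast
  have fV: "f i \<in> V" if "i \<in> ?U" for i using bij that by (auto simp: bij_betw_def)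
  have gU: "?g v \<in> ?U" "f (?g v) = v" if "v \<in> V" for v
    using bij_betw_imp_surj_on[OF bij] that inv_into_into[of v f ?U] f_inv_into_f[of v f ?U] by auto
  have gf: "?g (f i) = i" if "i \<in> ?U" for i
    using bij that by (simp add: bij_betw_def inv_into_f_f)
  have gless: "?g i < ?g j" if "i \<in> V" "j \<in> V" "i < j" for i j
    using less[of "?g i" "?g j"] gU that by simp
  have "bij_betw (\<lambda>h. restrict (h \<circ> f) ?U) (boxes q V) (boxes q ?U)"
  proof (rule bij_betwI[where g = "\<lambda>h. restrict (h \<circ> ?g) V"])
    show "(\<lambda>h. restrict (h \<circ> f) ?U) \<in> boxes q V \<rightarrow> boxes q ?U"
    proof
      fix h assume h: "h \<in> boxes q V"
      have "h v < q" if "v \<in> V" for v using h that by (auto simp: boxes_def PiE_iff)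
      moreover have "h (f i) \<noteq> h (f j) + 1" if "i \<in> ?U" "j \<in> ?U" "i < j" for i j
        using h fV less that unfolding boxes_def by blast
      ultimately show "restrict (h \<circ> f) ?U \<in> boxes q ?U"
        unfolding boxes_def using fV by (simp add: PiE_iff)
    qed
    show "(\<lambda>h. restrict (h \<circ> ?g) V) \<in> boxes q ?U \<rightarrow> boxes q V"
    proof
      fix h assume h: "h \<in> boxes q ?U"
      have "h v < q" if "v \<in> ?U" for v using h that by (auto simp: boxes_def PiE_iff)
      moreover have "h (?g i) \<noteq> h (?g j) + 1" if "i \<in> V" "j \<in> V" "i < j" for i j
        using h gU gless that unfolding boxes_def by blast
      ultimately show "restrict (h \<circ> ?g) V \<in> boxes q V"
        unfolding boxes_def using gU by (simp add: PiE_iff)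
    qed
    show "restrict (restrict (h \<circ> f) ?U \<circ> ?g) V = h" if "h \<in> boxes q V" for h
      using that gU by (auto simp: boxes_def PiE_iff extensional_def fun_eq_iff)
    show "restrict (restrict (h \<circ> ?g) V \<circ> f) ?U = h" if "h \<in> boxes q ?U" for h
      using that fV gf by (auto simp: boxes_def PiE_iff extensional_def fun_eq_iff)
  qed
  then show ?thesis unfolding box_count_def by (rule bij_betw_same_card)
qed

lemma card_placements_linial:
  "card (placements (int q) V (\<lambda>_. 0) (\<lambda>_. 0) (linial V)) = card (boxes q V)"
proof -
  have "bij_betw (\<lambda>h. restrict (\<lambda>v. int (h v)) V) (boxes q V) (placements (int q) V (\<lambda>_. 0) (\<lambda>_. 0) (linial V))"
  proof (rule bij_betwI[where g = "\<lambda>h. restrict (\<lambda>v. nat (h v)) V"])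
    show "(\<lambda>h. restrict (\<lambda>v. int (h v)) V) \<in> boxes q V \<rightarrow> placements (int q) V (\<lambda>_. 0) (\<lambda>_. 0) (linial V)"
    proof
      fix h assume h: "h \<in> boxes q V"
      have "h v < q" if "v \<in> V" for v using h that by (auto simp: boxes_def PiE_iff)
      moreover have "int (h i) - int (h j) \<noteq> 1" if "i \<in> V" "j \<in> V" "i < j" for i j
      proof -
        have "h i \<noteq> h j + 1" using h that unfolding boxes_def by blast
        then show ?thesis by linarith
      qed
      ultimately show "restrict (\<lambda>v. int (h v)) V \<in> placements (int q) V (\<lambda>_. 0) (\<lambda>_. 0) (linial V)"
        by (auto simp: placements_iff avoids_def linial_def)
    qed
    show "(\<lambda>h. restrict (\<lambda>v. nat (h v)) V) \<in> placements (int q) V (\<lambda>_. 0) (\<lambda>_. 0) (linial V) \<rightarrow> boxes q V"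
    proof
      fix h assume h: "h \<in> placements (int q) V (\<lambda>_. 0) (\<lambda>_. 0) (linial V)"
      have b: "0 \<le> h v" "h v < int q" if "v \<in> V" for v using h that by (auto simp: placements_iff)
      moreover have "nat (h i) \<noteq> nat (h j) + 1" if "i \<in> V" "j \<in> V" "i < j" for i j
      proof -
        have "h i - h j \<noteq> 1" using h that unfolding placements_iff avoids_def linial_def by fastforce
        then show ?thesis using b[of i] b[of j] that by linarith
      qed
      ultimately show "restrict (\<lambda>v. nat (h v)) V \<in> boxes q V"
        by (auto simp: boxes_def nat_less_iff)
    qed
    show "restrict (\<lambda>v. nat (restrict (\<lambda>v. int (h v)) V v)) V = h" if "h \<in> boxes q V" for h
      using that by (auto simp: boxes_def PiE_iff extensional_def fun_eq_iff)
    show "restrict (\<lambda>v. int (restrict (\<lambda>v. nat (h v)) V v)) V = h"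
      if "h \<in> placements (int q) V (\<lambda>_. 0) (\<lambda>_. 0) (linial V)" for h
      using that by (auto simp: placements_iff fun_eq_iff)
  qed
  then show ?thesis by (metis bij_betw_same_card)
qed

lemma sum_Pow_card:
  fixes g :: "nat \<Rightarrow> 'a :: comm_semiring_1"
  assumes "finite V"
  shows "(\<Sum>S\<in>Pow V. g (card S)) = (\<Sum>k\<le>card V. of_nat (card V choose k) * g k)"
proof -
  have "(\<Sum>S\<in>Pow V. g (card S)) = (\<Sum>k\<in>{..card V}. \<Sum>S | S \<in> Pow V \<and> card S = k. g (card S))"
    using assms by (intro sum.group[symmetric]) (auto simp: card_mono)
  also have "\<dots> = (\<Sum>k\<le>card V. of_nat (card V choose k) * g k)"
    using n_subsets[OF assms] by (intro sum.cong) auto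
  finally show ?thesis .
qed

text \<open>An arrangement induced from a Linial one is Linial up to an increasing relabeling, so
  each term of the alternating sum depends on the size of \<open>S\<close> only.\<close>

theorem region_count_box_count:
  "\<exists>Q. \<forall>q\<ge>Q. (\<Sum>k\<le>n. of_nat (n choose k) * ((-1) ^ k * int (region_count k) * int (box_count q (n - k)))) =
    int (box_count (q - 1) n)"
proof -
  let ?V = "{..<n}" and ?A = "linial {..<n}"
  have A: "?A \<subseteq> ?V \<times> ?V \<times> {1}" by (auto simp: linial_def)
  then have "finite ?A" by (rule finite_subset) auto
  then obtain Q where Q: "\<And>q. q \<ge> Q \<Longrightarrow> (\<Sum>S\<in>Pow ?V. sign_placements q ?V (\<lambda>_. 0) (\<lambda>_. 0) ?A S) =
      int (card (placements (q - 1) ?V (\<lambda>_. 0) (\<lambda>_. 0) ?A))"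
    using sum_sign_placements[of ?V ?A "\<lambda>_. 0" "\<lambda>_. 0"] A by blast
  \<comment> \<open>The lower bound 1 makes the truncated \<open>q - 1\<close> agree with the
    integer difference.\<close>
  have "(\<Sum>k\<le>n. of_nat (n choose k) * ((-1) ^ k * int (region_count k) * int (box_count q (n - k)))) =
      int (box_count (q - 1) n)" if q: "q \<ge> max 1 (nat Q)" for q
  proof -
    have "sign_placements (int q) ?V (\<lambda>_. 0) (\<lambda>_. 0) ?A S =
        (-1) ^ card S * int (region_count (card S)) * int (box_count q (n - card S))"
      if "S \<in> Pow ?V" for S
    proof -
      have ind: "induced ?A T = linial T" if "T \<subseteq> ?V" for T
        using that by (auto simp: induced_def linial_def)
      have S: "finite S" "S \<subseteq> ?V" "finite (?V - S)" using that finite_subset by auto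
      have "card (?V - S) = n - card S" using S by (simp add: card_Diff_subset)
      then show ?thesis
        unfolding sign_placements_def ind[OF S(2)] ind[OF Diff_subset] card_placements_linial
          card_boxes[OF S(3)] card_sign_patterns_linial[OF S(1)] by simp
    qed
    then have "(\<Sum>k\<le>n. of_nat (n choose k) * ((-1) ^ k * int (region_count k) * int (box_count q (n - k)))) =
      (\<Sum>S\<in>Pow ?V. sign_placements (int q) ?V (\<lambda>_. 0) (\<lambda>_. 0) ?A S)"
      using sum_Pow_card[of ?V "\<lambda>k. (-1) ^ k * int (region_count k) * int (box_count q (n - k))"] by simp
    also have "\<dots> = int (card (placements (int q - 1) ?V (\<lambda>_. 0) (\<lambda>_. 0) ?A))"
      using Q[of "int q"] q by (simp add: nat_le_iff)
    also have "int q - 1 = int (q - 1)" using q by simp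
    finally show ?thesis
      unfolding card_placements_linial card_boxes[OF finite_lessThan] by simp
  qed
  then show ?thesis by blast
qed

definition mono_surjs :: "nat \<Rightarrow> nat set \<Rightarrow> (nat \<Rightarrow> nat) set" where
  "mono_surjs r T = {h \<in> T \<rightarrow>\<^sub>E {..<r}. h ` T = {..<r} \<and> (\<forall>i\<in>T. \<forall>j\<in>T. i < j \<longrightarrow> h i \<le> h j)}"

text \<open>The number of compositions of \<open>n\<close> into \<open>r\<close> parts, the parts
  being the sizes of the fibres.\<close>

definition mono_surj_count :: "nat \<Rightarrow> nat \<Rightarrow> nat" where
  "mono_surj_count n r = (case r of 0 \<Rightarrow> if n = 0 then 1 else 0 | Suc r' \<Rightarrow> if n = 0 then 0 else (n - 1) choose r')"

lemma finite_mono_surjs: "finite T \<Longrightarrow> finite (mono_surjs r T)"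
  unfolding mono_surjs_def by (rule finite_subset[of _ "T \<rightarrow>\<^sub>E {..<r}"]) (auto intro: finite_PiE)

lemma mono_surjs_iff:
  "h \<in> mono_surjs r T \<longleftrightarrow> (\<forall>x. x \<notin> T \<longrightarrow> h x = undefined) \<and> h ` T = {..<r} \<and>
     (\<forall>i\<in>T. \<forall>j\<in>T. i < j \<longrightarrow> h i \<le> h j)"
  by (auto simp: mono_surjs_def PiE_iff extensional_def)

text \<open>The maximum is sent to the top value \<open>r\<close>. The remaining elements either
  still reach \<open>r\<close> or cover just the values below it, which is Pascal's rule for
  compositions.\<close>

lemma card_mono_surjs_insert_max:
  assumes T: "finite T" "T \<noteq> {}" and m: "\<And>x. x \<in> T \<Longrightarrow> x < m"
  shows "card (mono_surjs (Suc r) (insert m T)) = card (mono_surjs (Suc r) T) + card (mono_surjs r T)"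
proof -
  have mT: "m \<notin> T" using m by blast
  have "bij_betw (\<lambda>h. restrict h T) (mono_surjs (Suc r) (insert m T)) (mono_surjs (Suc r) T \<union> mono_surjs r T)"
  proof (rule bij_betwI[where g = "\<lambda>h. h(m := r)"])
    have top: "h m = r" if h: "h \<in> mono_surjs (Suc r) (insert m T)" for h
    proof -
      have "r \<in> h ` insert m T" "h m \<in> {..<Suc r}" using h by (auto simp: mono_surjs_iff)
      then obtain i where "i \<in> insert m T" "h i = r" by auto
      moreover have "h i \<le> h m" if "i \<in> insert m T" for i
        using h m that by (auto simp: mono_surjs_iff)
      ultimately show ?thesis using \<open>h m \<in> {..<Suc r}\<close> by force
    qed
    show "(\<lambda>h. restrict h T) \<in> mono_surjs (Suc r) (insert m T) \<rightarrow> mono_surjs (Suc r) T \<union> mono_surjs r T"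
    proof
      fix h assume h: "h \<in> mono_surjs (Suc r) (insert m T)"
      have "insert r (h ` T) = {..<Suc r}" using h top[OF h] by (simp add: mono_surjs_iff)
      then have "h ` T = {..<Suc r} \<or> h ` T = {..<r}"
        by (cases "r \<in> h ` T") (auto simp: lessThan_Suc)
      then show "restrict h T \<in> mono_surjs (Suc r) T \<union> mono_surjs r T"
        using h by (auto simp: mono_surjs_iff)
    qed
    show "(\<lambda>h. h(m := r)) \<in> mono_surjs (Suc r) T \<union> mono_surjs r T \<rightarrow> mono_surjs (Suc r) (insert m T)"
    proof
      fix h assume h: "h \<in> mono_surjs (Suc r) T \<union> mono_surjs r T"
      then have im: "h ` T = {..<Suc r} \<or> h ` T = {..<r}" by (auto simp: mono_surjs_iff)
      then have le: "h i \<le> r" if "i \<in> T" for i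
      proof -
        have "h i \<in> {..<Suc r} \<union> {..<r}" using im that by blast
        then show ?thesis by auto
      qed
      have "(h(m := r)) ` insert m T = insert r (h ` T)" using mT by (auto simp: image_iff)
      then have "(h(m := r)) ` insert m T = {..<Suc r}"
        using im by (auto simp: lessThan_Suc)
      moreover have "(h(m := r)) i \<le> (h(m := r)) j" if "i \<in> insert m T" "j \<in> insert m T" "i < j" for i j
        using h m le that by (fastforce simp: mono_surjs_iff)
      ultimately show "h(m := r) \<in> mono_surjs (Suc r) (insert m T)"
        using h mT by (auto simp: mono_surjs_iff)
    qed
    show "(restrict h T)(m := r) = h" if "h \<in> mono_surjs (Suc r) (insert m T)" for h
      using top[OF that] that by (auto simp: mono_surjs_iff fun_eq_iff)
    show "restrict (h(m := r)) T = h" if "h \<in> mono_surjs (Suc r) T \<union> mono_surjs r T" for h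
      using that mT by (auto simp: mono_surjs_iff fun_eq_iff)
  qed
  moreover have "mono_surjs (Suc r) T \<inter> mono_surjs r T = {}"
    by (auto simp: mono_surjs_iff)
  ultimately show ?thesis
    using finite_mono_surjs[OF T(1)] by (simp add: bij_betw_same_card card_Un_disjoint)
qed

lemma card_mono_surjs: "finite T \<Longrightarrow> card (mono_surjs r T) = mono_surj_count (card T) r"
proof (induction T arbitrary: r rule: finite_linorder_max_induct)
  case empty
  have "mono_surjs r {} = (if r = 0 then {\<lambda>_. undefined} else {})"
    by (auto simp: mono_surjs_iff)
  then show ?case by (simp add: mono_surj_count_def split: nat.split)
next
  case (insert m T)
  have mT: "m \<notin> T" using insert by blast
  show ?case
  proof (cases r)
    case 0
    then have "mono_surjs r (insert m T) = {}" by (auto simp: mono_surjs_iff)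
    then show ?thesis using 0 insert mT by (simp add: mono_surj_count_def)
  next
    case (Suc r')
    show ?thesis
    proof (cases "T = {}")
      case True
      have "r' = 0" if "h \<in> mono_surjs r {m}" for h
      proof -
        have "card {h m} = card {..<Suc r'}" using that by (simp add: mono_surjs_iff Suc)
        then show ?thesis by simp
      qed
      moreover have "mono_surjs (Suc 0) {m} = {(\<lambda>_. undefined)(m := 0)}"
        by (auto simp: mono_surjs_iff fun_eq_iff)
      ultimately have "mono_surjs r {m} = (if r' = 0 then {(\<lambda>_. undefined)(m := 0)} else {})"
        using Suc by auto
      then show ?thesis using True by (simp add: mono_surj_count_def Suc)
    next
      case False
      then obtain c where "card T = Suc c" using insert.hyps(1) by (metis card_0_eq not0_implies_Suc)
      then show ?thesis
        using card_mono_surjs_insert_max[OF insert.hyps(1) False, of m r'] insert mT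
        by (cases r') (simp_all add: Suc mono_surj_count_def)
    qed
  qed
qed

lemma boxes_iff:
  "h \<in> boxes q V \<longleftrightarrow> (\<forall>x. x \<notin> V \<longrightarrow> h x = undefined) \<and> (\<forall>i\<in>V. h i < q) \<and>
     (\<forall>i\<in>V. \<forall>j\<in>V. i < j \<longrightarrow> h i \<noteq> h j + 1)"
  by (auto simp: boxes_def PiE_iff extensional_def)

text \<open>For neighbouring values the excluded equation says that the larger value belongs to the
  larger index. All values below \<open>r\<close> occur, so intermediate elements extend this to any
  two values below \<open>r\<close>.\<close>

lemma boxes_levels:
  assumes h: "h \<in> boxes q V" and full: "{..<r} \<subseteq> h ` V"
  shows "s \<in> V \<Longrightarrow> t \<in> V \<Longrightarrow> h t < h s \<Longrightarrow> h s < r \<Longrightarrow> t < s"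
proof (induction "h s - h t" arbitrary: s rule: less_induct)
  case less
  show ?case
  proof (cases "h s = h t + 1")
    case True
    then have "\<not> s < t" using h less.prems by (auto simp: boxes_iff)
    then show ?thesis using less.prems by (metis linorder_neqE_nat less_irrefl)
  next
    case False
    obtain u where u: "u \<in> V" "h u = h s - 1"
      using full less.prems(4) by (metis imageE lessThan_iff less_imp_diff_less subsetD)
    have "t < u" using less.prems False u by (intro less.hyps) auto
    moreover have "h s = h u + 1" using u less.prems(3) by simp
    then have "\<not> s < u" using h u(1) less.prems(1) unfolding boxes_iff by blast
    moreover have "s \<noteq> u" using \<open>h s = h u + 1\<close> by auto
    ultimately show ?thesis by linarith
  qed
qed

lemma card_boxes_first_gap:
  assumes V: "finite V" "card V \<le> N" "N < q"
  shows "card (boxes q V) =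
    (\<Sum>T\<in>Pow V. \<Sum>r\<le>N. card (mono_surjs r T) * card (boxes (q - 1 - r) (V - T)))"
proof -
  define D where "D = (SIGMA p : Pow V \<times> {..N}. mono_surjs (snd p) (fst p) \<times> boxes (q - 1 - snd p) (V - fst p))"
  define K where "K = (\<lambda>((T, r), (f, g)). \<lambda>i :: nat.
    if i \<in> T then f i else if i \<in> V then g i + r + 1 else (undefined :: nat))"
  define gap where "gap h = (LEAST r. r \<notin> h ` V)" for h :: "nat \<Rightarrow> nat"
  define J where "J h = (({i \<in> V. h i < gap h}, gap h),
     (restrict h {i \<in> V. h i < gap h}, restrict (\<lambda>i. h i - (gap h + 1)) (V - {i \<in> V. h i < gap h})))"
    for h :: "nat \<Rightarrow> nat"
  have gap: "gap h \<notin> h ` V" "{..<gap h} \<subseteq> h ` V" for h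
  proof -
    have "\<exists>r. r \<notin> h ` V" using V(1) ex_new_if_finite[of "h ` V"] by blast
    then show "gap h \<notin> h ` V" unfolding gap_def by (rule LeastI_ex)
    show "{..<gap h} \<subseteq> h ` V" unfolding gap_def using not_less_Least by blast
  qed
  have "bij_betw J (boxes q V) D"
  proof (rule bij_betwI[where g = K])
    show "J \<in> boxes q V \<rightarrow> D"
    proof
      fix h assume h: "h \<in> boxes q V"
      let ?r = "gap h" and ?T = "{i \<in> V. h i < gap h}"
      have "card {..<?r} \<le> card (h ` V)" using gap(2) V(1) by (intro card_mono) auto
      then have r: "?r \<le> N" using card_image_le[OF V(1), of h] V(2) by simp
      have "restrict h ?T \<in> mono_surjs ?r ?T"
      proof -
        have "h i \<le> h j" if "i \<in> ?T" "j \<in> ?T" "i < j" for i j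
          using boxes_levels[OF h gap(2), of i j] that by (auto simp: not_less[symmetric])
        moreover have "h ` ?T = {..<?r}" using gap(2)[of h] by auto
        ultimately show ?thesis by (auto simp: mono_surjs_iff)
      qed
      moreover have "restrict (\<lambda>i. h i - (?r + 1)) (V - ?T) \<in> boxes (q - 1 - ?r) (V - ?T)"
      proof -
        have *: "h i > ?r \<and> h i < q" if "i \<in> V - ?T" for i
        proof -
          have "h i \<noteq> ?r" using gap(1)[of h] that by (metis DiffD1 imageI)
          then show ?thesis using h that by (auto simp: boxes_iff)
        qed
        have "h i - (?r + 1) \<noteq> h j - (?r + 1) + 1" if "i \<in> V - ?T" "j \<in> V - ?T" "i < j" for i j
        proof -
          have "h i \<noteq> h j + 1" using h that by (auto simp: boxes_iff)
          then show ?thesis using *[OF that(1)] *[OF that(2)] by linarith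
        qed
        moreover have "h i - (?r + 1) < q - 1 - ?r" if "i \<in> V - ?T" for i
          using *[OF that] by linarith
        ultimately show ?thesis by (auto simp: boxes_iff)
      qed
      ultimately show "J h \<in> D" using r by (auto simp: D_def J_def)
    qed
    show "K \<in> D \<rightarrow> boxes q V"
    proof
      fix x assume "x \<in> D"
      then obtain T r f g where x: "x = ((T, r), (f, g))" "T \<subseteq> V" "r \<le> N" "f \<in> mono_surjs r T"
        "g \<in> boxes (q - 1 - r) (V - T)" by (auto simp: D_def)
      have f: "f i < r" if "i \<in> T" for i using x(4) that by (auto simp: mono_surjs_iff)
      have fle: "f i \<le> f j" if "i \<in> T" "j \<in> T" "i < j" for i j using x(4) that by (auto simp: mono_surjs_iff)
      have g: "g i + r + 1 < q" if "i \<in> V - T" for i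
      proof -
        have "g i < q - 1 - r" using x(5) that by (auto simp: boxes_iff)
        then show ?thesis by linarith
      qed
      have gne: "g i \<noteq> g j + 1" if "i \<in> V - T" "j \<in> V - T" "i < j" for i j
        using x(5) that by (auto simp: boxes_iff)
      let ?h = "K x"
      have h: "?h i = (if i \<in> T then f i else if i \<in> V then g i + r + 1 else undefined)" for i
        by (simp add: K_def x)
      have "?h i < q" if "i \<in> V" for i
        using f[of i] g[of i] that x(3) V(3) unfolding h by (cases "i \<in> T") auto
      moreover have "?h i \<noteq> ?h j + 1" if "i \<in> V" "j \<in> V" "i < j" for i j
        using f[of i] f[of j] fle[of i j] gne[of i j] that unfolding h
        by (cases "i \<in> T"; cases "j \<in> T") force+
      ultimately show "?h \<in> boxes q V" unfolding boxes_iff using h x(2) by auto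
    qed
    show "K (J h) = h" if h: "h \<in> boxes q V" for h
    proof
      fix i
      have "gap h < h i" if "i \<in> V" "\<not> h i < gap h"
        using gap(1)[of h] that by (metis imageI linorder_neqE_nat)
      then show "K (J h) i = h i" using h by (auto simp: K_def J_def boxes_iff)
    qed
    show "J (K x) = x" if "x \<in> D" for x
    proof -
      obtain T r f g where x': "x = ((T, r), (f, g))" by (metis prod.collapse)
      then have x: "x = ((T, r), (f, g))" "T \<subseteq> V" "r \<le> N" "f \<in> mono_surjs r T"
        "g \<in> boxes (q - 1 - r) (V - T)" using that unfolding D_def x' by auto
      let ?h = "K x"
      have h: "?h i = (if i \<in> T then f i else if i \<in> V then g i + r + 1 else undefined)" for i
        by (simp add: K_def x)
      have f: "f ` T = {..<r}" using x(4) by (simp add: mono_surjs_iff)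
      have fr: "f i < r" if "i \<in> T" for i using f that by blast
      have "?h i \<noteq> r" if "i \<in> V" for i
        using fr[of i] that by (cases "i \<in> T") (auto simp: h)
      then have "r \<notin> ?h ` V" by blast
      moreover have "r \<le> s" if "s \<notin> ?h ` V" for s
      proof (rule ccontr)
        assume "\<not> r \<le> s"
        then obtain i where "i \<in> T" "f i = s" using f by (metis imageE lessThan_iff not_le)
        then have "?h i = s" "i \<in> V" using x(2) by (auto simp: h)
        then show False using that by blast
      qed
      ultimately have gr: "gap ?h = r" unfolding gap_def by (rule Least_equality)
      have T: "{i \<in> V. ?h i < r} = T" using fr x(2) by (auto simp: h)
      have "restrict ?h T = f" using x(4) by (auto simp: h mono_surjs_iff fun_eq_iff)
      moreover have "restrict (\<lambda>i. ?h i - (r + 1)) (V - T) = g" using x(5) by (auto simp: h boxes_iff fun_eq_iff)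
      ultimately show ?thesis unfolding J_def gr T by (simp add: x(1))
    qed
  qed
  then have "card (boxes q V) = card D" by (rule bij_betw_same_card)
  also have "\<dots> = (\<Sum>p\<in>Pow V \<times> {..N}. card (mono_surjs (snd p) (fst p) \<times> boxes (q - 1 - snd p) (V - fst p)))"
    unfolding D_def using V(1)
    by (intro card_SigmaI) (auto intro!: finite_mono_surjs finite_boxes intro: finite_subset)
  also have "\<dots> = (\<Sum>T\<in>Pow V. \<Sum>r\<le>N. card (mono_surjs r T) * card (boxes (q - 1 - r) (V - T)))"
    by (simp add: card_cartesian_product sum.cartesian_product case_prod_unfold)
  finally show ?thesis .
qed

text \<open>The range of \<open>r\<close> is bounded by \<open>N\<close> instead of
  \<open>n\<close>, so that one recursion serves all coefficients up to degree
  \<open>N\<close>.\<close>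

theorem box_count_first_gap:
  assumes "n \<le> N" "N < q"
  shows "box_count q n =
    (\<Sum>r\<le>N. \<Sum>k\<le>n. (n choose k) * (mono_surj_count k r * box_count (q - 1 - r) (n - k)))"
proof -
  have "card (mono_surjs r T) * card (boxes (q - 1 - r) ({..<n} - T)) =
      mono_surj_count (card T) r * box_count (q - 1 - r) (n - card T)" if "T \<in> Pow {..<n}" for r T
  proof -
    have "finite T" "T \<subseteq> {..<n}" using that finite_subset by auto
    then show ?thesis by (simp add: card_mono_surjs card_boxes card_Diff_subset)
  qed
  then have "box_count q n = (\<Sum>T\<in>Pow {..<n}. \<Sum>r\<le>N. mono_surj_count (card T) r * box_count (q - 1 - r) (n - card T))"
    unfolding box_count_def[of q] using card_boxes_first_gap[of "{..<n}" N q] assms by simp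
  also have "\<dots> = (\<Sum>r\<le>N. \<Sum>T\<in>Pow {..<n}. mono_surj_count (card T) r * box_count (q - 1 - r) (n - card T))"
    by (rule sum.swap)
  also have "\<dots> = (\<Sum>r\<le>N. \<Sum>k\<le>n. (n choose k) * (mono_surj_count k r * box_count (q - 1 - r) (n - k)))"
    using sum_Pow_card[of "{..<n}" "\<lambda>k. mono_surj_count k r * box_count (q - 1 - r) (n - k)" for r] by simp
  finally show ?thesis .
qed

section \<open>The generating function of the region counts\<close>

definition fps_eq_upto :: "nat \<Rightarrow> 'a fps \<Rightarrow> 'a fps \<Rightarrow> bool" where
  "fps_eq_upto N f g \<longleftrightarrow> (\<forall>n\<le>N. fps_nth f n = fps_nth g n)"

lemma fps_eq_upto_refl [simp]: "fps_eq_upto N f f"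
  by (simp add: fps_eq_upto_def)

lemma fps_eq_upto_trans [trans]: "fps_eq_upto N f g \<Longrightarrow> fps_eq_upto N g h \<Longrightarrow> fps_eq_upto N f h"
  by (simp add: fps_eq_upto_def)

lemma fps_eq_upto_sym: "fps_eq_upto N f g \<longleftrightarrow> fps_eq_upto N g f"
  by (auto simp: fps_eq_upto_def)

lemma fps_eq_upto_mult:
  fixes f :: "'a :: comm_ring_1 fps"
  assumes "fps_eq_upto N f f'" "fps_eq_upto N g g'"
  shows "fps_eq_upto N (f * g) (f' * g')"
  using assms by (auto simp: fps_eq_upto_def fps_mult_nth intro!: sum.cong)

lemma fps_eq_upto_add:
  fixes f :: "'a :: comm_ring_1 fps"
  assumes "fps_eq_upto N f f'" "fps_eq_upto N g g'"
  shows "fps_eq_upto N (f + g) (f' + g')"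
  using assms by (auto simp: fps_eq_upto_def)

lemma fps_eq_upto_power:
  fixes f :: "'a :: comm_ring_1 fps"
  assumes "fps_eq_upto N f f'"
  shows "fps_eq_upto N (f ^ k) (f' ^ k)"
  using assms by (induction k) (auto intro: fps_eq_upto_mult)

lemma fps_eq_upto_sum:
  fixes f :: "'b \<Rightarrow> 'a :: comm_ring_1 fps"
  assumes "\<And>i. i \<in> I \<Longrightarrow> fps_eq_upto N (f i) (g i)"
  shows "fps_eq_upto N (sum f I) (sum g I)"
  using assms by (auto simp: fps_eq_upto_def fps_sum_nth intro!: sum.cong)

lemma fps_eq_upto_cancel:
  fixes f :: "'a :: field fps"
  assumes "fps_eq_upto N (f * h) (g * h)" "fps_nth h 0 \<noteq> 0"
  shows "fps_eq_upto N f g"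
proof -
  have *: "k * h * inverse h = k" for k
    using inverse_mult_eq_1'[OF assms(2)] by (simp only: mult.assoc mult_1_right)
  show ?thesis
    using fps_eq_upto_mult[OF assms(1) fps_eq_upto_refl, of "inverse h"] unfolding * .
qed

lemma fps_eq_upto_compose:
  fixes f :: "'a :: comm_ring_1 fps"
  assumes "fps_eq_upto N g g'"
  shows "fps_eq_upto N (f oo g) (f oo g')"
  unfolding fps_eq_upto_def
proof (intro allI impI)
  fix n assume "n \<le> N"
  then have "fps_nth (g ^ k) n = fps_nth (g' ^ k) n" for k
    using fps_eq_upto_power[OF assms] by (simp add: fps_eq_upto_def)
  then show "fps_nth (f oo g) n = fps_nth (f oo g') n" by (simp add: fps_compose_nth)
qed

lemma fps_compose_eq_upto:
  fixes f g :: "'a :: comm_ring_1 fps"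
  assumes "fps_nth g 0 = 0"
  shows "fps_eq_upto N (f oo g) (\<Sum>k\<le>N. fps_const (fps_nth f k) * g ^ k)"
  unfolding fps_eq_upto_def
proof (intro allI impI)
  fix n assume n: "n \<le> N"
  have "fps_nth (g ^ k) n = 0" if "n < k" for k
    using startsby_zero_power_prefix[OF assms, of k] that by auto
  then have "(\<Sum>k=0..n. fps_nth f k * fps_nth (g ^ k) n) = (\<Sum>k\<le>N. fps_nth f k * fps_nth (g ^ k) n)"
    using n by (intro sum.mono_neutral_left) (auto simp: not_le)
  then show "fps_nth (f oo g) n = fps_nth (\<Sum>k\<le>N. fps_const (fps_nth f k) * g ^ k) n"
    by (simp add: fps_compose_nth fps_sum_nth)
qed

lemma fps_eqI_upto: "(\<And>N. fps_eq_upto N f g) \<Longrightarrow> f = g"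
  by (rule fps_ext) (auto simp: fps_eq_upto_def)

section \<open>Exponential generating functions and elimination of the box counts\<close>

definition box_fps :: "nat \<Rightarrow> real fps" where
  "box_fps q = Abs_fps (\<lambda>n. real (box_count q n) / fact n)"

definition mono_surj_fps :: "nat \<Rightarrow> real fps" where
  "mono_surj_fps r = Abs_fps (\<lambda>n. real (mono_surj_count n r) / fact n)"

text \<open>This is f(-x) for the region series f, the factor by which the series of box counts
  changes when one box is removed.\<close>

definition signed_region_fps :: "real fps" where
  "signed_region_fps = Abs_fps (\<lambda>n. (-1) ^ n * real (region_count n) / fact n)"

lemma fps_egf_mult_nth:
  "fps_nth (Abs_fps (\<lambda>n. a n / fact n) * Abs_fps (\<lambda>n. b n / fact n)) n =
     (\<Sum>k\<le>n. real (n choose k) * (a k * b (n - k))) / fact n"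
proof -
  have "a k / fact k * (b (n - k) / fact (n - k)) = real (n choose k) * (a k * b (n - k)) / fact n"
    if "k \<le> n" for k
    using that by (simp add: binomial_fact)
  then show ?thesis
    by (auto simp: fps_mult_nth atLeast0AtMost sum_divide_distrib intro!: sum.cong)
qed

lemma box_count_0 [simp]: "box_count q 0 = 1"
proof -
  have "boxes q {} = {\<lambda>_. undefined}" by (auto simp: boxes_iff)
  then show ?thesis by (simp add: box_count_def)
qed

lemma box_fps_shift:
  "\<exists>Q. \<forall>q\<ge>Q. fps_eq_upto N (signed_region_fps * box_fps q) (box_fps (q - 1))"
proof -
  have "\<exists>Q. \<forall>q\<ge>Q. fps_nth (signed_region_fps * box_fps q) n = fps_nth (box_fps (q - 1)) n" for n
  proof -
    obtain Q where Q: "\<And>q. q \<ge> Q \<Longrightarrow> (\<Sum>k\<le>n. of_nat (n choose k) *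
      ((-1) ^ k * int (region_count k) * int (box_count q (n - k)))) = int (box_count (q - 1) n)"
      using region_count_box_count by blast
    have "fps_nth (signed_region_fps * box_fps q) n = fps_nth (box_fps (q - 1)) n" if "q \<ge> Q" for q
    proof -
      have "(\<Sum>k\<le>n. real (n choose k) * ((-1) ^ k * real (region_count k) * real (box_count q (n - k)))) =
        of_int (\<Sum>k\<le>n. of_nat (n choose k) * ((-1) ^ k * int (region_count k) * int (box_count q (n - k))))"
        by simp
      also have "\<dots> = real (box_count (q - 1) n)" unfolding Q[OF that] by simp
      finally show ?thesis
        unfolding signed_region_fps_def box_fps_def fps_egf_mult_nth by simp
    qed
    then show ?thesis by blast
  qed
  then obtain Q where Q: "\<And>n q. q \<ge> Q n \<Longrightarrow>
      fps_nth (signed_region_fps * box_fps q) n = fps_nth (box_fps (q - 1)) n" by metis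
  \<comment> \<open>The thresholds of the finitely many degrees up to \<open>N\<close> have a
    maximum.\<close>
  have "fps_eq_upto N (signed_region_fps * box_fps q) (box_fps (q - 1))" if "q \<ge> Max (Q ` {..N})" for q
    unfolding fps_eq_upto_def
  proof (intro allI impI)
    fix n assume "n \<le> N"
    then show "fps_nth (signed_region_fps * box_fps q) n = fps_nth (box_fps (q - 1)) n"
      using that by (intro Q) simp
  qed
  then show ?thesis by blast
qed

lemma box_fps_first_gap:
  assumes "N < q"
  shows "fps_eq_upto N (box_fps q) (\<Sum>r\<le>N. mono_surj_fps r * box_fps (q - 1 - r))"
  unfolding fps_eq_upto_def
proof (intro allI impI)
  fix n assume n: "n \<le> N"
  have "real (box_count q n) = (\<Sum>r\<le>N. \<Sum>k\<le>n. real (n choose k) *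
      (real (mono_surj_count k r) * real (box_count (q - 1 - r) (n - k))))"
    unfolding box_count_first_gap[OF n assms] by simp
  then show "fps_nth (box_fps q) n = fps_nth (\<Sum>r\<le>N. mono_surj_fps r * box_fps (q - 1 - r)) n"
    unfolding fps_sum_nth mono_surj_fps_def box_fps_def fps_egf_mult_nth
    by (simp add: sum_divide_distrib)
qed

lemma sum_mono_surj_fps:
  "fps_eq_upto N (\<Sum>r\<le>N. mono_surj_fps r * signed_region_fps ^ Suc r) 1"
proof -
  let ?R = signed_region_fps
  obtain Q where Q: "\<And>q. q \<ge> Q \<Longrightarrow> fps_eq_upto N (?R * box_fps q) (box_fps (q - 1))"
    using box_fps_shift by blast
  \<comment> \<open>From here \<open>N + 1\<close> single steps down can be taken while every
    application of \<open>Q\<close> stays above its threshold.\<close>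
  define q where "q = Q + N + 2"
  have shift: "fps_eq_upto N (?R ^ r * box_fps q) (box_fps (q - r))" if "r \<le> N + 1" for r
    using that
  proof (induction r)
    case (Suc r)
    have "fps_eq_upto N (?R * (?R ^ r * box_fps q)) (?R * box_fps (q - r))"
      using Suc by (intro fps_eq_upto_mult) auto
    moreover have "fps_eq_upto N (?R * box_fps (q - r)) (box_fps (q - r - 1))"
      using Suc.prems by (intro Q) (auto simp: q_def)
    ultimately show ?case using fps_eq_upto_trans by (simp add: mult.assoc) blast
  qed simp
  have "fps_eq_upto N ((\<Sum>r\<le>N. mono_surj_fps r * ?R ^ Suc r) * box_fps q)
      (\<Sum>r\<le>N. mono_surj_fps r * box_fps (q - 1 - r))"
    unfolding sum_distrib_right mult.assoc
  proof (intro fps_eq_upto_sum fps_eq_upto_mult fps_eq_upto_refl)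
    fix r assume "r \<in> {..N}"
    then show "fps_eq_upto N (?R ^ Suc r * box_fps q) (box_fps (q - 1 - r))"
      using shift[of "Suc r"] by simp
  qed
  moreover have "fps_eq_upto N (box_fps q) (\<Sum>r\<le>N. mono_surj_fps r * box_fps (q - 1 - r))"
    by (rule box_fps_first_gap) (simp add: q_def)
  ultimately have "fps_eq_upto N ((\<Sum>r\<le>N. mono_surj_fps r * ?R ^ Suc r) * box_fps q) (1 * box_fps q)"
    by (simp add: fps_eq_upto_def)
  then show ?thesis
    by (rule fps_eq_upto_cancel) (simp add: box_fps_def)
qed

lemma mono_surj_fps_upto:
  assumes "r \<le> N"
  shows "fps_eq_upto N (mono_surj_fps r)
    (\<Sum>k\<le>N. fps_const (real (mono_surj_count k r) / fact k) * fps_X ^ k)"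
  by (auto simp: fps_eq_upto_def fps_sum_nth mono_surj_fps_def fps_X_power_nth if_distrib
      cong: if_cong)

text \<open>By the binomial theorem the inner sum is \<open>t^2 * (1 + t)^(k - 1)\<close> for
  positive \<open>k\<close>. The factor \<open>1 + t\<close> turns the exponent into
  \<open>k\<close>, as needed for an exponential series; \<open>k = 0\<close> stays
  exceptional.\<close>

lemma sum_mono_surj_count:
  fixes t :: "'a :: comm_ring_1"
  assumes "k \<le> N"
  shows "(1 + t) * (\<Sum>r\<le>N. of_nat (mono_surj_count k r) * t ^ Suc r) =
    (if k = 0 then t * (1 + t) else t\<^sup>2 * (1 + t) ^ k)"
proof (cases k)
  case 0
  then have "(\<Sum>r\<le>N. of_nat (mono_surj_count k r) * t ^ Suc r) = (\<Sum>r\<le>N. if r = 0 then t else 0)"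
    by (intro sum.cong) (auto simp: mono_surj_count_def split: nat.split)
  then show ?thesis using 0 by (simp add: algebra_simps)
next
  case (Suc k')
  obtain N' where N: "N = Suc N'" "k' \<le> N'" using assms Suc by (cases N) auto
  have "(\<Sum>r\<le>N. of_nat (mono_surj_count k r) * t ^ Suc r) =
      (\<Sum>r\<le>N'. of_nat (k' choose r) * t ^ Suc (Suc r))"
    unfolding N(1) sum.atMost_Suc_shift by (simp add: mono_surj_count_def Suc)
  also have "\<dots> = (\<Sum>r\<le>k'. of_nat (k' choose r) * t ^ Suc (Suc r))"
  proof (rule sum.mono_neutral_right)
    show "\<forall>i\<in>{..N'} - {..k'}. of_nat (k' choose i) * t ^ Suc (Suc i) = 0"
      by (simp add: binomial_eq_0)
  qed (use N(2) in auto)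
  also have "\<dots> = t\<^sup>2 * (\<Sum>r\<le>k'. of_nat (k' choose r) * t ^ r * 1 ^ (k' - r))"
    unfolding sum_distrib_left by (intro sum.cong refl) (simp add: power2_eq_square mult_ac)
  also have "\<dots> = t\<^sup>2 * (t + 1) ^ k'"
    by (simp only: binomial_ring)
  finally show ?thesis by (simp add: Suc algebra_simps)
qed

text \<open>Write R for the signed series and E for \<open>exp (x (1 + R))\<close>. Multiplying the
  relation of \<open>sum_mono_surj_fps\<close> by \<open>1 + R\<close> and summing over the degrees
  \<open>k\<close> gives 1 + R = R (1 + R) + R^2 (E - 1), where the 1 subtracted from E accounts for
  the exceptional \<open>k = 0\<close>. Everything but R^2 E = 1 cancels.\<close>

theorem signed_region_fps_equation:
  "signed_region_fps\<^sup>2 * (fps_exp 1 oo (fps_X * (1 + signed_region_fps))) = 1"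
proof -
  let ?R = signed_region_fps
  let ?c = "\<lambda>k. fps_const (1 / fact k :: real)"
  let ?Y = "fps_X * (1 + ?R)"
  have "1 + ?R = ?R * (1 + ?R) + ?R\<^sup>2 * ((fps_exp 1 oo ?Y) - 1)"
  proof (rule fps_eqI_upto)
    fix N
    have "fps_eq_upto N (1 + ?R) ((1 + ?R) * (\<Sum>r\<le>N. mono_surj_fps r * ?R ^ Suc r))"
      using fps_eq_upto_mult[OF fps_eq_upto_refl sum_mono_surj_fps, of N "1 + ?R"]
      by (simp only: mult_1_right fps_eq_upto_sym[of N "1 + ?R"])
    also have "fps_eq_upto N \<dots>
       ((1 + ?R) * (\<Sum>r\<le>N. (\<Sum>k\<le>N. fps_const (real (mono_surj_count k r) / fact k) * fps_X ^ k) * ?R ^ Suc r))"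
      by (intro fps_eq_upto_mult fps_eq_upto_sum mono_surj_fps_upto fps_eq_upto_refl) auto
    also have "\<dots> = (\<Sum>k\<le>N. ?c k * fps_X ^ k * ((1 + ?R) * (\<Sum>r\<le>N. of_nat (mono_surj_count k r) * ?R ^ Suc r)))"
    proof -
      have c: "fps_const (real m / fact k) = of_nat m * ?c k" for m k
        by (simp add: fps_of_nat[symmetric])
      show ?thesis
        unfolding sum_distrib_right sum_distrib_left c
        by (subst sum.swap) (intro sum.cong refl, simp only: mult_ac)
    qed
    also have "\<dots> = (\<Sum>k\<le>N. ?c k * fps_X ^ k * (if k = 0 then ?R * (1 + ?R) else ?R\<^sup>2 * (1 + ?R) ^ k))"
      by (intro sum.cong refl) (simp only: sum_mono_surj_count atMost_iff)
    also have "\<dots> = ?R * (1 + ?R) + ?R\<^sup>2 * ((\<Sum>k\<le>N. fps_const (fps_nth (fps_exp 1) k) * ?Y ^ k) - 1)"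
    proof -
      have e: "fps_nth (fps_exp (1 :: real)) k = 1 / fact k" for k by simp
      have "(\<Sum>k<N. ?c (Suc k) * fps_X ^ Suc k * (?R\<^sup>2 * (1 + ?R) ^ Suc k)) =
          ?R\<^sup>2 * (\<Sum>k<N. ?c (Suc k) * ?Y ^ Suc k)"
        unfolding sum_distrib_left power_mult_distrib by (intro sum.cong refl) (simp only: mult_ac)
      then show ?thesis
        unfolding sum.atMost_shift e by simp
    qed
    also have "fps_eq_upto N \<dots> (?R * (1 + ?R) + ?R\<^sup>2 * ((fps_exp 1 oo ?Y) - 1))"
    proof -
      have "fps_eq_upto N (fps_exp 1 oo ?Y) (\<Sum>k\<le>N. fps_const (fps_nth (fps_exp 1) k) * ?Y ^ k)"
        by (rule fps_compose_eq_upto) simp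
      then have "fps_eq_upto N ((\<Sum>k\<le>N. fps_const (fps_nth (fps_exp 1) k) * ?Y ^ k) - 1) ((fps_exp 1 oo ?Y) - 1)"
        by (simp add: fps_eq_upto_def)
      then show ?thesis by (intro fps_eq_upto_add fps_eq_upto_mult fps_eq_upto_refl)
    qed
    finally show "fps_eq_upto N (1 + ?R) (?R * (1 + ?R) + ?R\<^sup>2 * ((fps_exp 1 oo ?Y) - 1))" .
  qed
  then show ?thesis by (simp add: algebra_simps power2_eq_square)
qed

definition region_fps :: "real fps" where
  "region_fps = Abs_fps (\<lambda>n. real (region_count n) / fact n)"

text \<open>Substituting -x takes R to f and \<open>exp (x (1 + R))\<close> to
  \<open>exp (- x (1 + f))\<close>, whose inverse is \<open>exp (x (1 + f))\<close>.\<close>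

theorem region_fps_equation:
  "region_fps\<^sup>2 = fps_exp 1 oo (fps_X * (1 + region_fps))"
proof -
  let ?R = signed_region_fps and ?f = region_fps
  let ?Y = "fps_X * (1 + ?R)" and ?Z = "fps_X * (1 + ?f)"
  have f: "?f = ?R oo (- fps_X)"
    by (rule fps_ext) (simp add: region_fps_def signed_region_fps_def fps_compose_uminus'
        power_mult_distrib[symmetric])
  have Z: "?Y oo (- fps_X) = - ?Z"
    by (simp add: fps_compose_mult_distrib fps_compose_add_distrib f fps_X_fps_compose_startby0)
  have "(?R\<^sup>2 * (fps_exp 1 oo ?Y)) oo (- fps_X) = 1 oo (- fps_X)"
    by (simp only: signed_region_fps_equation)
  then have "?f\<^sup>2 * (fps_exp 1 oo (- ?Z)) = 1"
    by (simp add: fps_compose_mult_distrib fps_compose_power f fps_compose_assoc[symmetric] Z[unfolded f])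
  moreover have "(fps_exp 1 oo (- ?Z)) * (fps_exp 1 oo ?Z) = (1 :: real fps)"
  proof -
    have "fps_exp 1 oo (- ?Z) = fps_exp 1 oo ((- fps_X) oo ?Z)"
      by (simp add: fps_compose_uminus fps_X_fps_compose_startby0)
    also have "\<dots> = (fps_exp 1 oo (- fps_X)) oo ?Z"
      by (rule fps_compose_assoc) simp_all
    also have "\<dots> = fps_exp (- 1) oo ?Z" by simp
    finally have "(fps_exp 1 oo (- ?Z)) * (fps_exp 1 oo ?Z) = (fps_exp (- 1) * fps_exp 1) oo ?Z"
      by (simp add: fps_compose_mult_distrib)
    also have "fps_exp (- 1) * fps_exp 1 = (1 :: real fps)"
      using fps_exp_add_mult[of "-1 :: real" 1] by simp
    finally show ?thesis by simp
  qed
  ultimately have "?f\<^sup>2 * 1 = 1 * (fps_exp 1 oo ?Z)" by (metis mult.assoc)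
  then show ?thesis by simp
qed

text \<open>Because of the factor x in the exponent, the coefficient of degree n on the right
  depends only on coefficients of lower degree. Once these agree, the coefficient of
  \<open>(f - h) * (f + h)\<close> in degree n is twice the difference of the coefficients of
  \<open>f\<close> and \<open>h\<close>.\<close>

lemma fps_square_exp_unique:
  fixes f h :: "real fps"
  assumes f: "f\<^sup>2 = fps_exp 1 oo (fps_X * (1 + f))" "fps_nth f 0 = 1"
    and h: "h\<^sup>2 = fps_exp 1 oo (fps_X * (1 + h))" "fps_nth h 0 = 1"
  shows "f = h"
proof (rule fps_ext)
  fix n show "fps_nth f n = fps_nth h n"
  proof (induction n rule: less_induct)
    case (less n)
    show ?case
    proof (cases "n = 0")
      case False
      have "fps_eq_upto n (fps_X * (1 + f)) (fps_X * (1 + h))"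
        using less by (auto simp: fps_eq_upto_def)
      then have "fps_eq_upto n (f\<^sup>2) (h\<^sup>2)"
        unfolding f(1) h(1) by (rule fps_eq_upto_compose)
      then have "fps_nth ((f - h) * (f + h)) n = 0"
        by (simp add: fps_eq_upto_def power2_eq_square algebra_simps)
      moreover have "fps_nth ((f - h) * (f + h)) n = (\<Sum>i=0..n. if i = n then fps_nth (f - h) n * fps_nth (f + h) 0 else 0)"
        unfolding fps_mult_nth using less by (intro sum.cong) auto
      ultimately show ?thesis using f(2) h(2) by simp
    qed (use f h in simp)
  qed
qed

section \<open>Gapped sequences and ascending trees\<close>

abbreviation xpow :: "nat \<Rightarrow> nat \<Rightarrow> nat \<Rightarrow>\<^sub>0 nat" where
  "xpow \<equiv> Poly_Mapping.single"

text \<open>A nonempty sequence with a mark in every gap: a left edge, a right edge, or a nonempty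
  tree that is itself encoded as such a sequence. Elements of \<open>unit gapped\<close> are the
  shapes; those of \<open>nat gapped\<close> carry labels.\<close>

datatype 'a gapped =
    Final 'a
  | GapL 'a "'a gapped"
  | GapR 'a "'a gapped"
  | GapT 'a "'a gapped" "'a gapped"

fun first :: "'a gapped \<Rightarrow> 'a" where
  "first (Final k) = k"
| "first (GapL k s) = k"
| "first (GapR k s) = k"
| "first (GapT k t s) = k"

fun labels :: "'a gapped \<Rightarrow> 'a list" where
  "labels (Final k) = [k]"
| "labels (GapL k s) = k # labels s"
| "labels (GapR k s) = k # labels s"
| "labels (GapT k t s) = k # labels t @ labels s"

fun right_weight :: "'a gapped \<Rightarrow> nat" where
  "right_weight (Final k) = 0"
| "right_weight (GapL k s) = right_weight s"
| "right_weight (GapR k s) = Suc (right_weight s)"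
| "right_weight (GapT k t s) = Suc (right_weight t + right_weight s)"

fun decreasing :: "nat gapped \<Rightarrow> bool" where
  "decreasing (Final k) = True"
| "decreasing (GapL k s) = (first s \<le> k \<and> decreasing s)"
| "decreasing (GapR k s) = (first s \<le> k \<and> decreasing s)"
| "decreasing (GapT k t s) = (first s \<le> k \<and> decreasing t \<and> decreasing s)"

fun snoc_node :: "'a tree \<Rightarrow> 'a \<Rightarrow> 'a tree \<Rightarrow> 'a tree" where
  "snoc_node \<langle>\<rangle> k M = \<langle>M, k, \<langle>\<rangle>\<rangle>"
| "snoc_node \<langle>l, a, r\<rangle> k M = \<langle>l, a, snoc_node r k M\<rangle>"

fun root_le :: "nat tree \<Rightarrow> nat \<Rightarrow> bool" where
  "root_le \<langle>\<rangle> k = True"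
| "root_le \<langle>l, a, r\<rangle> k = (a \<le> k)"

fun root_ge :: "nat tree \<Rightarrow> nat \<Rightarrow> bool" where
  "root_ge \<langle>\<rangle> k = True"
| "root_ge \<langle>l, a, r\<rangle> k = (k \<le> a)"

text \<open>Only the end of the right spine is compared, since this is the node to which
  \<open>snoc_node\<close> attaches the next one.\<close>

fun spine_le :: "nat tree \<Rightarrow> nat \<Rightarrow> bool" where
  "spine_le \<langle>\<rangle> k = True"
| "spine_le \<langle>l, a, r\<rangle> k = (if r = \<langle>\<rangle> then a \<le> k else spine_le r k)"

fun ascending :: "nat tree \<Rightarrow> bool" where
  "ascending \<langle>\<rangle> = True"
| "ascending \<langle>l, a, r\<rangle> = (root_le l a \<and> root_ge r a \<and> ascending l \<and> ascending r)"

fun right_edges :: "'a tree \<Rightarrow> nat" where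
  "right_edges \<langle>\<rangle> = 0"
| "right_edges \<langle>l, a, r\<rangle> = (if r = \<langle>\<rangle> then 0 else 1) + right_edges l + right_edges r"

lemma ascending_iff: "ascending T \<longleftrightarrow> ldes T = 0 \<and> rdes T = 0"
proof (induction T)
  case (Node l a r)
  then show ?case by (cases l; cases r) auto
qed simp

lemma rasc_ascending: "ascending T \<Longrightarrow> rasc T = right_edges T"
proof (induction T)
  case (Node l a r)
  then show ?case by (cases l; cases r) auto
qed simp

lemma lasc_ascending: "ascending T \<Longrightarrow> T \<noteq> \<langle>\<rangle> \<Longrightarrow> lasc T + right_edges T + 1 = size T"
proof (induction T)
  case (Node l a r)
  then show ?case by (cases l; cases r) auto
qed simp

section \<open>Appending a node to the right spine\<close>

lemma snoc_node_nonempty [simp]: "snoc_node R k M \<noteq> \<langle>\<rangle>" "\<langle>\<rangle> \<noteq> snoc_node R k M"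
  by (cases R; simp)+

lemma snoc_node_inject [simp]:
  "snoc_node R k M = snoc_node R' k' M' \<longleftrightarrow> R = R' \<and> k = k' \<and> M = M'"
proof (induction R arbitrary: R')
  case Leaf
  then show ?case by (cases R') auto
next
  case (Node l a r)
  then show ?case by (cases R') auto
qed

lemma snoc_node_exists: "T \<noteq> \<langle>\<rangle> \<Longrightarrow> \<exists>R k M. T = snoc_node R k M"
proof (induction T)
  case (Node l a r)
  show ?case
  proof (cases "r = \<langle>\<rangle>")
    case True
    then show ?thesis by (intro exI[of _ "\<langle>\<rangle>"] exI[of _ a] exI[of _ l]) simp
  next
    case False
    then obtain R k M where "r = snoc_node R k M" using Node by blast
    then show ?thesis by (intro exI[of _ "\<langle>l, a, R\<rangle>"] exI[of _ k] exI[of _ M]) simp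
  qed
qed simp

lemma size_snoc_node [simp]: "size (snoc_node R k M) = Suc (size R + size M)"
  by (induction R) auto

lemma tree_monomial_snoc_node [simp]:
  "tree_monomial (snoc_node R k M) = tree_monomial R + tree_monomial M + xpow k 1"
  by (induction R) (auto simp: ac_simps)

lemma right_edges_snoc_node [simp]:
  "right_edges (snoc_node R k M) = right_edges R + right_edges M + (if R = \<langle>\<rangle> then 0 else 1)"
  by (induction R) auto

lemma spine_le_snoc_node [simp]: "spine_le (snoc_node R k M) m \<longleftrightarrow> k \<le> m"
  by (induction R) auto

lemma spine_le_mono: "spine_le R k \<Longrightarrow> k \<le> k' \<Longrightarrow> spine_le R k'"
  by (induction R) (auto split: if_splits)

lemma root_le_mono: "root_le R k \<Longrightarrow> k \<le> k' \<Longrightarrow> root_le R k'"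
  by (cases R) auto

lemma ascending_snoc_node [simp]:
  "ascending (snoc_node R k M) \<longleftrightarrow> ascending R \<and> spine_le R k \<and> ascending M \<and> root_le M k"
proof (induction R)
  case (Node l a r)
  have "root_ge (snoc_node r k M) a \<longleftrightarrow> (if r = \<langle>\<rangle> then a \<le> k else root_ge r a)"
    by (cases r) auto
  then show ?case using Node by auto
qed auto

text \<open>\<open>parts s\<close> lists the last node of the right spine of the tree encoded by \<open>s\<close>: its label,
  its left subtree, and the tree that remains when this node and its left subtree are removed.\<close>

fun parts :: "nat gapped \<Rightarrow> nat \<times> nat tree \<times> nat tree" where
  "parts (Final k) = (k, \<langle>\<rangle>, \<langle>\<rangle>)"
| "parts (GapL k s) = (case parts s of (k', M, R) \<Rightarrow> (k, \<langle>M, k', \<langle>\<rangle>\<rangle>, R))"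
| "parts (GapR k s) = (case parts s of (k', M, R) \<Rightarrow> (k, \<langle>\<rangle>, snoc_node R k' M))"
| "parts (GapT k t s) = (case parts s of (k', M, R) \<Rightarrow> (case parts t of (j, N, S) \<Rightarrow>
     (let X = snoc_node S j N in
      if root_ge X k' then (k, \<langle>M, k', X\<rangle>, R) else (k, X, snoc_node R k' M))))"

definition to_tree :: "nat gapped \<Rightarrow> nat tree" where
  "to_tree s = (case parts s of (k, M, R) \<Rightarrow> snoc_node R k M)"

lemma parts_GapT:
  assumes "parts s = (k', M, R)"
  shows "parts (GapT k t s) = (if root_ge (to_tree t) k' then (k, \<langle>M, k', to_tree t\<rangle>, R)
    else (k, to_tree t, snoc_node R k' M))"
  using assms by (auto simp: to_tree_def Let_def split: prod.splits)

declare parts.simps(4) [simp del]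

lemma to_tree_nonempty [simp]: "to_tree s \<noteq> \<langle>\<rangle>" "\<langle>\<rangle> \<noteq> to_tree s"
  by (auto simp: to_tree_def split: prod.splits)

lemma to_tree_eq_iff: "to_tree s = to_tree t \<longleftrightarrow> parts s = parts t"
  by (auto simp: to_tree_def split: prod.splits)

lemma fst_parts: "fst (parts s) = first s"
proof (cases s)
  case (GapT k t s')
  obtain k' M R where "parts s' = (k', M, R)" by (cases "parts s'")
  then show ?thesis by (simp add: GapT parts_GapT)
qed (auto split: prod.splits)

lemma partsD: "parts s = (k, M, R) \<Longrightarrow> k = first s \<and> to_tree s = snoc_node R k M"
  using fst_parts[of s] by (simp add: to_tree_def)

lemma ascending_to_tree: "decreasing s \<Longrightarrow> ascending (to_tree s)"
proof (induction s)
  case (GapT k t s)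
  obtain k' M R where p: "parts s = (k', M, R)" by (cases "parts s")
  show ?case
    using GapT partsD[OF p] spine_le_mono[of R k' k] root_le_mono[of "to_tree t" k' k]
    unfolding to_tree_def[of "GapT k t s"] parts_GapT[OF p]
    by (cases "to_tree t") auto
qed (auto simp: to_tree_def fst_parts[symmetric] split: prod.splits intro: spine_le_mono)

lemma size_to_tree: "size (to_tree s) = length (labels s)"
proof (induction s)
  case (GapT k t s)
  obtain k' M R where p: "parts s = (k', M, R)" by (cases "parts s")
  show ?case
    using GapT partsD[OF p] unfolding to_tree_def[of "GapT k t s"] parts_GapT[OF p] by auto
qed (auto simp: to_tree_def split: prod.splits)

lemma tree_monomial_to_tree:
  "tree_monomial (to_tree s) = (\<Sum>k\<leftarrow>labels s. xpow k 1)"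
proof (induction s)
  case (Final k)
  then show ?case by (simp add: to_tree_def)
next
  case (GapL k s)
  obtain k' M R where p: "parts s = (k', M, R)" by (cases "parts s")
  show ?case
    using partsD[OF p] p by (simp add: to_tree_def[of "GapL k s"] GapL.IH[symmetric] ac_simps del: One_nat_def)
next
  case (GapR k s)
  obtain k' M R where p: "parts s = (k', M, R)" by (cases "parts s")
  show ?case
    using partsD[OF p] p by (simp add: to_tree_def[of "GapR k s"] GapR.IH[symmetric] ac_simps del: One_nat_def)
next
  case (GapT k t s)
  obtain k' M R where p: "parts s = (k', M, R)" by (cases "parts s")
  show ?case
    using partsD[OF p]
    by (simp add: to_tree_def[of "GapT k t s"] parts_GapT[OF p] GapT.IH[symmetric] ac_simps del: One_nat_def)
qed

lemma right_edges_to_tree: "right_edges (to_tree s) = right_weight s"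
proof (induction s)
  case (GapT k t s)
  obtain k' M R where p: "parts s = (k', M, R)" by (cases "parts s")
  show ?case
    using GapT partsD[OF p] unfolding to_tree_def[of "GapT k t s"] parts_GapT[OF p]
    by (auto split: if_splits)
qed (auto simp: to_tree_def split: prod.splits)

text \<open>The second entry of the sequence is the larger of the root of \<open>M\<close> and the
  end of the right spine of \<open>R\<close>, with ties in favour of \<open>M\<close>. Together with
  whether the adjacent subtree is empty, this comparison reveals the constructor and its
  arguments.\<close>

lemma decreasing_parts_inj:
  "decreasing s \<Longrightarrow> decreasing s' \<Longrightarrow> parts s = parts s' \<Longrightarrow> s = s'"
proof (induction s arbitrary: s')
  case (Final k)
  then show ?case
  proof (cases s')
    case (GapT k' t r)
    obtain j M R where "parts r = (j, M, R)" by (cases "parts r")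
    then show ?thesis using Final GapT by (auto simp: parts_GapT split: if_splits)
  qed (auto split: prod.splits)
next
  case (GapL k s)
  note IH = GapL.IH and prems = GapL.prems
  obtain j M R where p: "parts s = (j, M, R)" by (cases "parts s")
  have R: "spine_le R j" using ascending_to_tree[of s] GapL.prems partsD[OF p] by simp
  show ?case
  proof (cases s')
    case (GapT k' t r)
    obtain j' M' R' where "parts r = (j', M', R')" by (cases "parts r")
    then show ?thesis using GapL.prems p R GapT
      by (cases "to_tree t") (auto simp: parts_GapT split: if_splits)
  next
    case (GapL k' r)
    obtain j' M' R' where "parts r = (j', M', R')" by (cases "parts r")
    then show ?thesis using IH[of r] prems p \<open>s' = GapL k' r\<close> by simp
  next
    case (GapR k' r)
    obtain j' M' R' where "parts r = (j', M', R')" by (cases "parts r")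
    then show ?thesis using prems p GapR by simp
  next
    case (Final k')
    then show ?thesis using prems p Final by simp
  qed
next
  case (GapR k s)
  note IH = GapR.IH and prems = GapR.prems
  obtain j M R where p: "parts s = (j, M, R)" by (cases "parts s")
  show ?case
  proof (cases s')
    case (GapT k' t r)
    obtain j' M' R' where "parts r = (j', M', R')" by (cases "parts r")
    then show ?thesis using GapR.prems p GapT by (auto simp: parts_GapT split: if_splits)
  next
    case (GapL k' r)
    obtain j' M' R' where "parts r = (j', M', R')" by (cases "parts r")
    then show ?thesis using prems p GapL by simp
  next
    case (GapR k' r)
    obtain j' M' R' where "parts r = (j', M', R')" by (cases "parts r")
    then show ?thesis using IH[of r] prems p \<open>s' = GapR k' r\<close> by simp
  next
    case (Final k')
    then show ?thesis using prems p Final by simp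
  qed
next
  case (GapT k t s)
  note IH = GapT.IH and prems = GapT.prems
  obtain j M R where p: "parts s = (j, M, R)" by (cases "parts s")
  have R: "spine_le R j" using ascending_to_tree[of s] prems partsD[OF p] by simp
  show ?case
  proof (cases s')
    case (Final k')
    then show ?thesis using prems p by (auto simp: parts_GapT split: if_splits)
  next
    case (GapL k' r)
    obtain j' M' R' where "parts r = (j', M', R')" by (cases "parts r")
    moreover have "spine_le R' j'"
      using ascending_to_tree[of r] prems GapL partsD[OF calculation] by simp
    ultimately show ?thesis
      using prems p R GapL by (cases "to_tree t") (auto simp: parts_GapT split: if_splits)
  next
    case (GapR k' r)
    obtain j' M' R' where "parts r = (j', M', R')" by (cases "parts r")
    then show ?thesis using prems p GapR by (auto simp: parts_GapT split: if_splits)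
  next
    case (GapT k' t' r)
    obtain j' M' R' where p': "parts r = (j', M', R')" by (cases "parts r")
    have R': "spine_le R' j'"
      using ascending_to_tree[of r] prems \<open>s' = GapT k' t' r\<close> partsD[OF p'] by simp
    have eq: "parts (GapT k t s) = parts (GapT k' t' r)" using prems \<open>s' = GapT k' t' r\<close> by simp
    have "k = k' \<and> to_tree t = to_tree t' \<and> (j, M, R) = (j', M', R')"
    proof (cases "root_ge (to_tree t) j"; cases "root_ge (to_tree t') j'")
      \<comment> \<open>On one side the root \<open>j\<close> of \<open>M\<close> is at least the
        end \<open>j'\<close> of the spine of \<open>R\<close>, on the other side it is smaller, so
        equality of the parts is contradictory.\<close>
      assume a: "root_ge (to_tree t) j" "\<not> root_ge (to_tree t') j'"
      then show ?thesis using eq R by (cases "to_tree t'") (auto simp: parts_GapT[OF p] parts_GapT[OF p'])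
    next
      assume a: "\<not> root_ge (to_tree t) j" "root_ge (to_tree t') j'"
      then show ?thesis using eq R' by (cases "to_tree t") (auto simp: parts_GapT[OF p] parts_GapT[OF p'])
    qed (use eq in \<open>auto simp: parts_GapT[OF p] parts_GapT[OF p']\<close>)
    then have "k = k'" "t = t'" "s = r"
      using IH(1)[of t'] IH(2)[of r] prems \<open>s' = GapT k' t' r\<close> p p'
      by (simp_all add: to_tree_eq_iff)
    then show ?thesis using \<open>s' = GapT k' t' r\<close> by simp
  qed
qed

text \<open>The comparison used for injectivity, run as a recursion: the larger of the root of
  \<open>M\<close> and the end of the right spine of \<open>R\<close> becomes the second entry, and
  a nonempty subtree set free by its removal is encoded in the first gap.\<close>

lemma parts_surj:
  "ascending M \<Longrightarrow> root_le M k \<Longrightarrow> ascending R \<Longrightarrow> spine_le R k \<Longrightarrow>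
    \<exists>s. decreasing s \<and> parts s = (k, M, R)"
proof (induction "size M + size R" arbitrary: k M R rule: less_induct)
  case less
  \<comment> \<open>The end of the right spine of \<open>X\<close> is not counted in the sizes of
    its parts, so the induction applies even to a tree as large as \<open>M\<close> and
    \<open>R\<close> together.\<close>
  have sub: "\<exists>t. decreasing t \<and> to_tree t = X"
    if "ascending X" "X \<noteq> \<langle>\<rangle>" "size X \<le> size M + size R" for X
  proof -
    have "\<exists>R' j N. X = snoc_node R' j N" using that(2) by (rule snoc_node_exists)
    then obtain R' j N where X: "X = snoc_node R' j N" by blast
    have "\<exists>t. decreasing t \<and> parts t = (j, N, R')"
      using that unfolding X by (intro less.hyps) auto
    then show ?thesis unfolding X to_tree_def by fastforce
  qed
  have first_eq: "first s = j" if "parts s = (j, N, S)" for s j N S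
    using fst_parts[of s] that by simp
  show ?case
  proof (cases "\<exists>M1 j X. M = \<langle>M1, j, X\<rangle> \<and> spine_le R j")
    case True
    then obtain M1 j X where M: "M = \<langle>M1, j, X\<rangle>" and R: "spine_le R j" by blast
    obtain s where s: "decreasing s" "parts s = (j, M1, R)"
      using less.hyps[of M1 R j] less.prems M R by auto
    show ?thesis
    proof (cases "X = \<langle>\<rangle>")
      case True
      have "decreasing (GapL k s) \<and> parts (GapL k s) = (k, M, R)"
        using s first_eq[OF s(2)] less.prems M True by simp
      then show ?thesis by blast
    next
      case False
      obtain t where t: "decreasing t" "to_tree t = X"
        using sub[of X] False M less.prems by auto
      have "decreasing (GapT k t s) \<and> parts (GapT k t s) = (k, M, R)"
        using s t first_eq[OF s(2)] less.prems M by (simp add: parts_GapT)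
      then show ?thesis by blast
    qed
  next
    case False
    show ?thesis
    proof (cases "R = \<langle>\<rangle>")
      case True
      then have "M = \<langle>\<rangle>" using False by (cases M) auto
      then have "decreasing (Final k) \<and> parts (Final k) = (k, M, R)" using True by simp
      then show ?thesis by blast
    next
      case R: False
      obtain R' j N where R': "R = snoc_node R' j N" using snoc_node_exists[OF R] by blast
      obtain s where s: "decreasing s" "parts s = (j, N, R')"
        using less.hyps[of N R' j] less.prems R' by auto
      show ?thesis
      proof (cases "M = \<langle>\<rangle>")
        case True
        have "decreasing (GapR k s) \<and> parts (GapR k s) = (k, M, R)"
          using s first_eq[OF s(2)] less.prems R' True by simp
        then show ?thesis by blast
      next
        case M: False
        obtain t where t: "decreasing t" "to_tree t = M"
          using sub[of M] M less.prems by auto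
        have "\<not> root_ge M j" using False R' M by (cases M) auto
        then have "decreasing (GapT k t s) \<and> parts (GapT k t s) = (k, M, R)"
          using s t first_eq[OF s(2)] less.prems R' by (simp add: parts_GapT)
        then show ?thesis by blast
      qed
    qed
  qed
qed

theorem bij_betw_to_tree:
  "bij_betw to_tree {s. decreasing s} {T. ascending T \<and> T \<noteq> \<langle>\<rangle>}"
proof (rule bij_betw_imageI)
  show "inj_on to_tree {s. decreasing s}"
    by (rule inj_onI) (auto simp: to_tree_eq_iff intro: decreasing_parts_inj)
  show "to_tree ` {s. decreasing s} = {T. ascending T \<and> T \<noteq> \<langle>\<rangle>}"
  proof
    show "to_tree ` {s. decreasing s} \<subseteq> {T. ascending T \<and> T \<noteq> \<langle>\<rangle>}"
      by (auto simp: ascending_to_tree)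
    show "{T. ascending T \<and> T \<noteq> \<langle>\<rangle>} \<subseteq> to_tree ` {s. decreasing s}"
    proof
      fix T assume T: "T \<in> {T. ascending T \<and> T \<noteq> \<langle>\<rangle>}"
      then obtain R k M where "T = snoc_node R k M" using snoc_node_exists by blast
      moreover obtain s where "decreasing s" "parts s = (k, M, R)"
        using parts_surj[of M k R] T calculation by auto
      ultimately show "T \<in> to_tree ` {s. decreasing s}"
        by (intro image_eqI[of _ _ s]) (auto simp: to_tree_def)
    qed
  qed
qed

section \<open>Labelings of a fixed shape\<close>

fun spine_length :: "'a gapped \<Rightarrow> nat" where
  "spine_length (Final k) = 1"
| "spine_length (GapL k s) = Suc (spine_length s)"
| "spine_length (GapR k s) = Suc (spine_length s)"
| "spine_length (GapT k t s) = Suc (spine_length s)"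

text \<open>The spines of a gapped sequence are named by lists of numbers, \<open>[]\<close> being the outermost
  one; \<open>spine_ids\<close> gives the name of the spine of every label, in the order of \<open>labels\<close>.\<close>

fun spine_ids :: "'a gapped \<Rightarrow> nat list list" where
  "spine_ids (Final k) = [[]]"
| "spine_ids (GapL k s) = [] # spine_ids s"
| "spine_ids (GapR k s) = [] # spine_ids s"
| "spine_ids (GapT k t s) = [] # map (Cons (spine_length s)) (spine_ids t) @ spine_ids s"

lemma length_spine_ids [simp]: "length (spine_ids s) = length (labels s)"
  by (induction s) auto

lemma spine_length_map [simp]: "spine_length (map_gapped f s) = spine_length s"
  by (induction s) auto

lemma spine_ids_map [simp]: "spine_ids (map_gapped f s) = spine_ids s"
  by (induction s) auto

lemma labels_map [simp]: "labels (map_gapped f s) = map f (labels s)"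
  by (induction s) auto

lemma right_weight_map [simp]: "right_weight (map_gapped f s) = right_weight s"
  by (induction s) auto

lemma spine_ids_bound: "b \<in> set (spine_ids s) \<Longrightarrow> b \<noteq> [] \<Longrightarrow> hd b < spine_length s"
  by (induction s) (auto simp: less_Suc_eq)

text \<open>Labels are compared within one spine only. The relation is not transitive, but
  \<open>sorted_wrt\<close> tests all pairs and hence says that the labels weakly decrease along
  every spine.\<close>

definition class_le :: "'c \<times> 'a :: linorder \<Rightarrow> 'c \<times> 'a \<Rightarrow> bool" where
  "class_le p q \<longleftrightarrow> (fst p = fst q \<longrightarrow> snd q \<le> snd p)"

lemma first_in_spine_ids: "([], first s) \<in> set (zip (spine_ids s) (labels s))"
  by (cases s) auto

lemma zip_spine_ids_GapT:
  "zip (spine_ids (GapT k t s)) (labels (GapT k t s)) =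
    ([], k) # map (\<lambda>(b, y). (spine_length s # b, y)) (zip (spine_ids t) (labels t)) @ zip (spine_ids s) (labels s)"
  by (simp add: zip_map1)

lemma decreasing_first:
  "decreasing s \<Longrightarrow> ([], y) \<in> set (zip (spine_ids s) (labels s)) \<Longrightarrow> y \<le> first s"
proof (induction s)
  case (GapT k t s)
  then show ?case unfolding zip_spine_ids_GapT by (auto intro: order_trans)
qed (auto intro: order_trans)

lemma class_le_first:
  assumes "decreasing s"
  shows "(\<forall>p\<in>set (zip (spine_ids s) (labels s)). class_le ([], k) p) \<longleftrightarrow> first s \<le> k"
proof
  assume "\<forall>p\<in>set (zip (spine_ids s) (labels s)). class_le ([], k) p"
  then have "class_le ([] :: nat list, k) ([], first s)" using first_in_spine_ids[of s] by (rule bspec)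
  then show "first s \<le> k" by (simp add: class_le_def)
next
  assume "first s \<le> k"
  then have "y \<le> k" if "([], y) \<in> set (zip (spine_ids s) (labels s))" for y
    using decreasing_first[OF assms that] by simp
  then show "\<forall>p\<in>set (zip (spine_ids s) (labels s)). class_le ([], k) p"
    by (auto simp: class_le_def)
qed

text \<open>An inner sequence is unconstrained by its surroundings, so the conditions concern each
  spine separately. The prefix \<open>spine_length s\<close> exceeds every leading number used
  inside \<open>s\<close>, which keeps the names of different spines apart.\<close>

lemma decreasing_iff_sorted:
  "decreasing s \<longleftrightarrow> sorted_wrt class_le (zip (spine_ids s) (labels s))"
proof (induction s)
  case (Final k)
  then show ?case by simp
next
  case (GapL k s)
  then show ?case using class_le_first[of s k] by auto
next
  case (GapR k s)
  then show ?case using class_le_first[of s k] by auto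
next
  case (GapT k t s)
  have cross: "class_le (spine_length s # b, y) (c, z)" if "(c, z) \<in> set (zip (spine_ids s) (labels s))" for b y c z
    using spine_ids_bound[of c s] set_zip_leftD[OF that] by (auto simp: class_le_def)
  have 1: "sorted_wrt class_le (map (\<lambda>(b, y). (spine_length s # b, y)) (zip (spine_ids t) (labels t))) \<longleftrightarrow>
      sorted_wrt class_le (zip (spine_ids t) (labels t))"
    unfolding sorted_wrt_map
    by (rule iffI; erule sorted_wrt_mono_rel[rotated]) (auto simp: class_le_def split: prod.splits)
  have "sorted_wrt class_le (zip (spine_ids (GapT k t s)) (labels (GapT k t s))) \<longleftrightarrow>
      (\<forall>p\<in>set (zip (spine_ids s) (labels s)). class_le ([], k) p) \<and> decreasing t \<and> decreasing s"
  proof -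
    let ?Z = "zip (spine_ids s) (labels s)"
      and ?Y = "map (\<lambda>(b, y). (spine_length s # b, y)) (zip (spine_ids t) (labels t))"
    have "class_le ([], k) p" if "p \<in> set ?Y" for p using that by (auto simp: class_le_def)
    moreover have "\<forall>p\<in>set ?Y. \<forall>q\<in>set ?Z. class_le p q" using cross by auto
    ultimately show ?thesis
      using 1 unfolding zip_spine_ids_GapT GapT sorted_wrt.simps sorted_wrt_append set_append by blast
  qed
  also have "\<dots> \<longleftrightarrow> decreasing (GapT k t s)"
    using class_le_first[of s k] by auto
  finally show ?case by simp
qed

lemma gapped_eqI:
  "map_gapped (\<lambda>_. ()) s = map_gapped (\<lambda>_. ()) s' \<Longrightarrow> labels s = labels s' \<Longrightarrow> s = s'"
proof (induction s arbitrary: s')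
  case (GapT k t s)
  from GapT.prems obtain k' t' r where s': "s' = GapT k' t' r" by (cases s') auto
  have "length (labels t) = length (labels t')"
    using GapT.prems(1) s' by (metis (no_types, lifting) gapped.inject(4) gapped.map(4) labels_map length_map)
  then show ?case using GapT s' by auto
next
  case (Final k)
  then show ?case by (cases s') auto
next
  case (GapL k s)
  then show ?case by (cases s') auto
next
  case (GapR k s)
  then show ?case by (cases s') auto
qed

lemma gapped_fill:
  "length w = length (labels (u :: unit gapped)) \<Longrightarrow> \<exists>s. map_gapped (\<lambda>_. ()) s = u \<and> labels s = w"
proof (induction u arbitrary: w)
  case (Final k)
  then obtain x where "w = [x]" by (auto simp: length_Suc_conv)
  then show ?case by (intro exI[of _ "Final x"]) simp
next
  case (GapL k u)
  then obtain x w' where w: "w = x # w'" "length w' = length (labels u)" by (auto simp: length_Suc_conv)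
  then obtain s where "map_gapped (\<lambda>_. ()) s = u" "labels s = w'" using GapL.IH by blast
  then show ?case by (intro exI[of _ "GapL x s"]) (simp add: w)
next
  case (GapR k u)
  then obtain x w' where w: "w = x # w'" "length w' = length (labels u)" by (auto simp: length_Suc_conv)
  then obtain s where "map_gapped (\<lambda>_. ()) s = u" "labels s = w'" using GapR.IH by blast
  then show ?case by (intro exI[of _ "GapR x s"]) (simp add: w)
next
  case (GapT k v u)
  then obtain x w' where w: "w = x # w'" "length w' = length (labels v) + length (labels u)"
    by (auto simp: length_Suc_conv)
  let ?n = "length (labels v)"
  obtain t where t: "map_gapped (\<lambda>_. ()) t = v" "labels t = take ?n w'"
    using GapT.IH(1)[of "take ?n w'"] w by auto
  obtain s where s: "map_gapped (\<lambda>_. ()) s = u" "labels s = drop ?n w'"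
    using GapT.IH(2)[of "drop ?n w'"] w by auto
  show ?case using t s by (intro exI[of _ "GapT x t s"]) (simp add: w)
qed

text \<open>Filling is greedy: the first position of a class takes the largest label available for
  that class. Nothing else is possible, which gives uniqueness in the next lemma.\<close>

lemma class_sorted_fill_exists:
  fixes M :: "('c \<times> nat) multiset"
  shows "image_mset fst M = mset c \<Longrightarrow>
    \<exists>w. length w = length c \<and> mset (zip c w) = M \<and> sorted_wrt class_le (zip c w)"
proof (induction c arbitrary: M)
  case (Cons a c)
  let ?X = "{x. (a, x) \<in># M}"
  have "finite ?X" by (rule finite_subset[of _ "snd ` set_mset M"]) force+
  moreover have "?X \<noteq> {}"
  proof -
    have "a \<in># image_mset fst M" using Cons.prems by simp
    then show ?thesis by auto
  qed
  ultimately have "Max ?X \<in> ?X" "\<And>y. y \<in> ?X \<Longrightarrow> y \<le> Max ?X"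
    by (simp_all only: Max_in Max_ge not_False_eq_True)
  then obtain z where x: "(a, z) \<in># M" "\<And>y. (a, y) \<in># M \<Longrightarrow> y \<le> z" by blast
  then obtain M' where M: "M = add_mset (a, z) M'" by (metis multi_member_split)
  then have "image_mset fst M' = mset c" using Cons.prems by simp
  then obtain w where w: "length w = length c" "mset (zip c w) = M'" "sorted_wrt class_le (zip c w)"
    using Cons.IH by blast
  have "class_le (a, z) p" if "p \<in> set (zip c w)" for p
  proof -
    have "p \<in># M'" using that w(2) by (metis set_mset_mset)
    then have "p \<in># M" using M by (metis insert_iff set_mset_add_mset_insert)
    then show ?thesis using x(2)[of "snd p"] by (cases p) (auto simp: class_le_def)
  qed
  then show ?case
    using w M by (intro exI[of _ "z # w"]) simp
qed simp

lemma class_sorted_fill_unique: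
  fixes w w' :: "nat list"
  shows "length w = length c \<Longrightarrow> length w' = length c \<Longrightarrow> mset (zip c w) = mset (zip c w') \<Longrightarrow>
    sorted_wrt class_le (zip c w) \<Longrightarrow> sorted_wrt class_le (zip c w') \<Longrightarrow> w = w'"
proof (induction c arbitrary: w w')
  case (Cons a c)
  then obtain x v x' v' where w: "w = x # v" "w' = x' # v'" by (auto simp: length_Suc_conv)
  have le: "y \<le> z" if "mset (zip (a # c) (z # u)) = mset (zip (a # c) (y # u'))"
    "sorted_wrt class_le (zip (a # c) (z # u))" for y z u u'
  proof -
    have "(a, y) \<in># mset (zip (a # c) (z # u))" unfolding that(1) by simp
    then show ?thesis using that(2) by (auto simp: class_le_def)
  qed
  have "x = x'" using le[of x v x' v'] le[of x' v' x v] Cons.prems w by (simp add: order_antisym)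
  then show ?case using Cons w by auto
qed simp

text \<open>A weakly decreasing filling of a spine is a multiset of labels, that is, a monomial of a
  complete symmetric function. Doing this for all spines at once leaves a multiset of pairs of a
  spine and a label.\<close>

lemma bij_betw_class_matrices:
  "bij_betw (\<lambda>s. (map_gapped (\<lambda>_. ()) s, mset (zip (spine_ids s) (labels s))))
    {s. decreasing s}
    (SIGMA u : UNIV. {M. image_mset fst M = mset (spine_ids u)})"
proof (rule bij_betw_imageI)
  let ?f = "\<lambda>s :: nat gapped. (map_gapped (\<lambda>_. ()) s, mset (zip (spine_ids s) (labels s)))"
  show "inj_on ?f {s. decreasing s}"
  proof (rule inj_onI)
    fix s s' assume s: "s \<in> {s. decreasing s}" "s' \<in> {s. decreasing s}" and eq: "?f s = ?f s'"
    have shape: "map_gapped (\<lambda>_. ()) s = map_gapped (\<lambda>_. ()) s'" using eq by simp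
    then have c: "spine_ids s = spine_ids s'" by (metis spine_ids_map)
    have "labels s = labels s'"
      using s eq c length_spine_ids[of s] length_spine_ids[of s']
      by (intro class_sorted_fill_unique[of _ "spine_ids s"]) (auto simp: decreasing_iff_sorted)
    then show "s = s'" using gapped_eqI[OF shape] by blast
  qed
  show "?f ` {s. decreasing s} = (SIGMA u : UNIV. {M. image_mset fst M = mset (spine_ids u)})"
  proof
    have "image_mset fst (mset (zip (spine_ids s) (labels s))) = mset (spine_ids s)" for s :: "nat gapped"
      by (simp flip: mset_map)
    then show "?f ` {s. decreasing s} \<subseteq> (SIGMA u : UNIV. {M. image_mset fst M = mset (spine_ids u)})"
      by auto
    show "(SIGMA u : UNIV. {M. image_mset fst M = mset (spine_ids u)}) \<subseteq> ?f ` {s. decreasing s}"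
    proof
      fix p :: "unit gapped \<times> (nat list \<times> nat) multiset"
      assume "p \<in> (SIGMA u : UNIV. {M. image_mset fst M = mset (spine_ids u)})"
      then obtain u M where p: "p = (u, M)" "image_mset fst M = mset (spine_ids u)" by auto
      obtain w where w: "length w = length (spine_ids u)" "mset (zip (spine_ids u) w) = M"
        "sorted_wrt class_le (zip (spine_ids u) w)"
        using class_sorted_fill_exists[OF p(2)] by blast
      then obtain s where s: "map_gapped (\<lambda>_. ()) s = u" "labels s = w"
        using gapped_fill[of w u] by auto
      have "spine_ids s = spine_ids u" using s(1) by (metis spine_ids_map)
      then have "decreasing s" "p = ?f s" using w s p by (simp_all add: decreasing_iff_sorted)
      then show "p \<in> ?f ` {s. decreasing s}" by blast
    qed
  qed
qed

definition shapes :: "nat \<Rightarrow> nat \<Rightarrow> unit gapped set" where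
  "shapes n k = {u. length (labels u) = n \<and> right_weight u = k}"

theorem card_ascending_trees:
  assumes "n \<ge> 1"
  shows "card {T. ascending T \<and> size T = n \<and> right_edges T = k \<and> tree_monomial T = m} =
    card (SIGMA u : shapes n k. {M. image_mset fst M = mset (spine_ids u) \<and>
      (\<Sum>x\<in>#image_mset snd M. xpow x 1) = m})"
proof -
  let ?f = "\<lambda>s :: nat gapped. (map_gapped (\<lambda>_. ()) s, mset (zip (spine_ids s) (labels s)))"
  let ?D = "{s. decreasing s \<and> length (labels s) = n \<and> right_weight s = k \<and>
    (\<Sum>x\<leftarrow>labels s. xpow x 1) = m}"
  have *: "bij_betw f {x \<in> A. P x} {y \<in> B. Q y}"
    if "bij_betw f A B" "\<And>x. x \<in> A \<Longrightarrow> P x = Q (f x)" for f :: "'x \<Rightarrow> 'y" and A B P Q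
    using that unfolding bij_betw_def inj_on_def by auto
  have 1: "bij_betw to_tree ?D {T. ascending T \<and> size T = n \<and> right_edges T = k \<and> tree_monomial T = m}"
  proof -
    have "bij_betw to_tree {s \<in> {s. decreasing s}. length (labels s) = n \<and> right_weight s = k \<and>
         (\<Sum>x\<leftarrow>labels s. xpow x 1) = m}
       {T \<in> {T. ascending T \<and> T \<noteq> \<langle>\<rangle>}. size T = n \<and> right_edges T = k \<and> tree_monomial T = m}"
      by (rule *[OF bij_betw_to_tree])
         (simp only: size_to_tree right_edges_to_tree tree_monomial_to_tree)
    moreover have "{T \<in> {T. ascending T \<and> T \<noteq> \<langle>\<rangle>}. size T = n \<and> right_edges T = k \<and> tree_monomial T = m} =
       {T. ascending T \<and> size T = n \<and> right_edges T = k \<and> tree_monomial T = m}"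
      using assms by auto
    ultimately show ?thesis by (simp only: mem_Collect_eq)
  qed
  have 2: "bij_betw ?f ?D (SIGMA u : shapes n k. {M. image_mset fst M = mset (spine_ids u) \<and>
      (\<Sum>x\<in>#image_mset snd M. xpow x 1) = m})"
  proof -
    have sum: "(\<Sum>x\<in>#image_mset snd (mset (zip (spine_ids s) (labels s))). xpow x (1 :: nat)) =
        (\<Sum>x\<leftarrow>labels s. xpow x 1)" for s :: "nat gapped"
      by (simp flip: mset_map sum_mset_sum_list add: map_snd_zip[OF length_spine_ids])
    have "bij_betw ?f {s \<in> {s. decreasing s}. length (labels s) = n \<and> right_weight s = k \<and>
         (\<Sum>x\<leftarrow>labels s. xpow x 1) = m}
       {p \<in> (SIGMA u : UNIV. {M. image_mset fst M = mset (spine_ids u)}). fst p \<in> shapes n k \<and>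
          (\<Sum>x\<in>#image_mset snd (snd p). xpow x 1) = m}"
      by (rule *[OF bij_betw_class_matrices]) (simp only: fst_conv snd_conv shapes_def mem_Collect_eq
          sum labels_map length_map right_weight_map conj_assoc)
    moreover have "{p \<in> (SIGMA u : UNIV. {M. image_mset fst M = mset (spine_ids u)}). fst p \<in> shapes n k \<and>
          (\<Sum>x\<in>#image_mset snd (snd p). xpow x 1) = m} =
       (SIGMA u : shapes n k. {M. image_mset fst M = mset (spine_ids u) \<and>
      (\<Sum>x\<in>#image_mset snd M. xpow x 1) = m})" by auto
    ultimately show ?thesis by (simp only: mem_Collect_eq)
  qed
  show ?thesis
    using bij_betw_same_card[OF 1] bij_betw_same_card[OF 2] by (simp only:)
qed

section \<open>Coefficients of the Frobenius characteristic\<close>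

lemma mfps_coeff_zero [simp]: "mfps_coeff 0 m = 0"
  by (simp add: zero_mfps_def)

lemma mfps_coeff_add [simp]: "mfps_coeff (f + g) m = mfps_coeff f m + mfps_coeff g m"
  by (simp add: plus_mfps_def)

lemma mfps_coeff_sum: "mfps_coeff (sum f I) m = (\<Sum>i\<in>I. mfps_coeff (f i) m)"
  by (induction I rule: infinite_finite_induct) auto

lemma mfps_coeff_smult [simp]: "mfps_coeff (mfps_smult c f) m = c * mfps_coeff f m"
  by (simp add: mfps_smult_def)

lemma mfps_coeff_map [simp]: "mfps_coeff (mfps_map h f) m = h (mfps_coeff f m)"
  by (simp add: mfps_map_def)

lemma mfps_coeff_mult:
  "mfps_coeff (f * g) m = (\<Sum>(a, b) | a + b = m. mfps_coeff f a * mfps_coeff g b)"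
  by (simp add: times_mfps_def)

lemma rep_character_perm_rep:
  "finite B \<Longrightarrow> rep_character B (perm_rep \<phi>) w = of_nat (card {x \<in> B. \<phi> w x = x})"
  by (simp add: rep_character_def perm_rep_def sum.If_cases Int_def)

section \<open>Products of power sums and functions fixed by a permutation\<close>

lemma keys_sum_single:
  assumes "finite C" "\<And>c. c \<in> C \<Longrightarrow> k c \<ge> (1 :: nat)" "(\<Sum>c\<in>C. xpow (g c) (k c)) = m" "c \<in> C"
  shows "g c \<in> Poly_Mapping.keys m"
proof -
  have "Poly_Mapping.lookup m (g c) = (\<Sum>d\<in>C. Poly_Mapping.lookup (xpow (g d) (k d)) (g c))"
    unfolding assms(3)[symmetric] by (simp add: lookup_sum)
  also have "\<dots> \<ge> Poly_Mapping.lookup (xpow (g c) (k c)) (g c)"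
    using assms(1,4) by (intro member_le_sum) auto
  finally show ?thesis using assms(2)[OF assms(4)] by (auto simp: in_keys_iff)
qed

lemma finite_single_sum_functions:
  assumes "finite C" "\<And>c. c \<in> C \<Longrightarrow> k c \<ge> (1 :: nat)"
  shows "finite {g \<in> C \<rightarrow>\<^sub>E S. (\<Sum>c\<in>C. xpow (g c) (k c)) = m}"
proof (rule finite_subset)
  show "{g \<in> C \<rightarrow>\<^sub>E S. (\<Sum>c\<in>C. xpow (g c) (k c)) = m} \<subseteq> C \<rightarrow>\<^sub>E Poly_Mapping.keys m"
  proof
    fix g assume g: "g \<in> {g \<in> C \<rightarrow>\<^sub>E S. (\<Sum>c\<in>C. xpow (g c) (k c)) = m}"
    then have "g c \<in> Poly_Mapping.keys m" if "c \<in> C" for c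
      using keys_sum_single[of C k g m c] assms that by simp
    then show "g \<in> C \<rightarrow>\<^sub>E Poly_Mapping.keys m"
      using g by (intro PiE_I) (auto simp: PiE_iff extensional_def)
  qed
  show "finite (C \<rightarrow>\<^sub>E Poly_Mapping.keys m)"
    using assms(1) by (intro finite_PiE) auto
qed

text \<open>Expanding the product amounts to choosing one variable for each factor.\<close>

lemma coeff_prod_power_sum:
  assumes "finite C" "\<And>c. c \<in> C \<Longrightarrow> k c \<ge> 1"
  shows "mfps_coeff (\<Prod>c\<in>C. power_sum (k c)) m =
    of_nat (card {g \<in> C \<rightarrow>\<^sub>E {1..}. (\<Sum>c\<in>C. xpow (g c) (k c)) = m})"
  using assms
proof (induction C arbitrary: m rule: finite_induct)
  case empty
  have "{g \<in> {} \<rightarrow>\<^sub>E {1 :: nat..}. (\<Sum>c\<in>{}. xpow (g c) (k c)) = m} =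
      (if m = 0 then {\<lambda>_. undefined} else {})" by auto
  then show ?case by (simp add: one_mfps_def)
next
  case (insert c C)
  let ?G = "\<lambda>C m. {g \<in> C \<rightarrow>\<^sub>E {1 :: nat..}. (\<Sum>c\<in>C. xpow (g c) (k c)) = m}"
  let ?S = "{(a, b). a + b = m}"
  have fin: "finite (?G C b)" for b
    using insert by (intro finite_single_sum_functions) auto
  have "?G (insert c C) m = (\<Union>(a, b)\<in>?S. {g \<in> ?G (insert c C) m.
      xpow (g c) (k c) = a \<and> (\<Sum>c\<in>C. xpow (g c) (k c)) = b})" (is "_ = (\<Union>p\<in>?S. ?H p)")
    using insert.hyps by auto
  moreover have "card (\<Union>p\<in>?S. ?H p) = (\<Sum>p\<in>?S. card (?H p))"
  proof (rule card_UN_disjoint)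
    show "finite ?S" by (rule finite_monomial_splits)
    have "finite (?G (insert c C) m)"
      using insert by (intro finite_single_sum_functions) auto
    then show "\<forall>p\<in>?S. finite (?H p)" by (auto intro: finite_subset[rotated])
  qed auto
  moreover have "of_nat (card (?H (a, b))) = mfps_coeff (power_sum (k c)) a * of_nat (card (?G C b))"
    if "(a, b) \<in> ?S" for a b
  proof (cases "\<exists>i\<ge>1. a = xpow i (k c)")
    case True
    then obtain i where i: "i \<ge> 1" "a = xpow i (k c)" by blast
    have kc: "k c \<ge> 1" using insert.prems by simp
    \<comment> \<open>Since the exponent is positive, the monomial determines its variable.\<close>
    have single: "xpow x (k c) = a \<longleftrightarrow> x = i" for x
    proof
      assume "xpow x (k c) = a"
      then have "Poly_Mapping.lookup (xpow x (k c)) x = Poly_Mapping.lookup (xpow i (k c)) x"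
        using i by simp
      then show "x = i" using kc by (auto simp: lookup_single when_def split: if_splits)
    qed (use i in simp)
    have sumupd: "(\<Sum>x\<in>C. xpow ((g(c := y)) x) (k x)) = (\<Sum>x\<in>C. xpow (g x) (k x))" for g y
      using insert.hyps(2) by (intro sum.cong) auto
    have "bij_betw (\<lambda>g. g(c := i)) (?G C b) (?H (a, b))"
    proof (rule bij_betwI[where g = "\<lambda>g. g(c := undefined)"])
      show "(\<lambda>g. g(c := i)) \<in> ?G C b \<rightarrow> ?H (a, b)"
      proof
        fix g assume g: "g \<in> ?G C b"
        have "(\<Sum>x\<in>insert c C. xpow ((g(c := i)) x) (k x)) = a + b"
          unfolding sum.insert[OF insert.hyps(1,2)] sumupd using g i by simp
        moreover have "g(c := i) \<in> insert c C \<rightarrow>\<^sub>E {1..}"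
          using g i by (auto simp: PiE_iff extensional_def)
        ultimately show "g(c := i) \<in> ?H (a, b)"
          using that sumupd[of g i] g i by auto
      qed
      show "(\<lambda>g. g(c := undefined)) \<in> ?H (a, b) \<rightarrow> ?G C b"
      proof
        fix g assume g: "g \<in> ?H (a, b)"
        then have "g(c := undefined) \<in> C \<rightarrow>\<^sub>E {1..}"
          using insert.hyps(2) by (auto simp: PiE_iff extensional_def)
        then show "g(c := undefined) \<in> ?G C b" using g sumupd[of g undefined] by simp
      qed
      show "(g(c := i))(c := undefined) = g" if "g \<in> ?G C b" for g
        using that insert.hyps(2) by (auto simp: PiE_iff extensional_def fun_eq_iff)
      show "(g(c := undefined))(c := i) = g" if "g \<in> ?H (a, b)" for g
        using that single by (auto simp: fun_eq_iff)
    qed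
    then have "card (?H (a, b)) = card (?G C b)" by (rule bij_betw_same_card[symmetric])
    moreover have "mfps_coeff (power_sum (k c)) a = 1"
      using True by (simp only: power_sum_def mfps_coeff_Abs if_True)
    ultimately show ?thesis by (simp only: mult_1_left)
  next
    case False
    then have "?H (a, b) = {}" by (auto simp: PiE_iff)
    then have "card (?H (a, b)) = 0" by (simp only: card.empty)
    moreover have "mfps_coeff (power_sum (k c)) a = 0"
      using False by (simp only: power_sum_def mfps_coeff_Abs if_False)
    ultimately show ?thesis by (simp only: of_nat_0 mult_zero_left)
  qed
  ultimately have "of_nat (card (?G (insert c C) m)) =
      (\<Sum>(a, b)\<in>?S. mfps_coeff (power_sum (k c)) a * of_nat (card (?G C b)))"
    by (simp only: of_nat_sum) (auto intro!: sum.cong)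
  moreover have "mfps_coeff (\<Prod>c\<in>C. power_sum (k c)) b = of_nat (card (?G C b))" for b
    using insert by simp
  ultimately show ?case
    unfolding prod.insert[OF insert.hyps(1,2)] mfps_coeff_mult by simp
qed

text \<open>A function fixed by \<open>w\<close> is constant on each cycle, hence a choice of one
  variable per cycle; a cycle \<open>c\<close> then contributes that variable to the power
  \<open>card c\<close>.\<close>

lemma coeff_prod_power_sum_orbits:
  fixes A :: "nat set"
  assumes A: "finite A" and w: "w permutes A"
  shows "mfps_coeff (\<Prod>c\<in>Orbits.orbit w ` A. power_sum (card c)) m =
    of_nat (card {f \<in> A \<rightarrow>\<^sub>E {1..}. (\<forall>i\<in>A. f (w i) = f i) \<and>
      (\<Sum>i\<in>A. xpow (f i) 1) = m})"
proof -
  let ?orb = "Orbits.orbit w"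
  let ?C = "?orb ` A"
  have perm: "permutation w" using A w permutation_permutes by blast
  have sub: "?orb i \<subseteq> A" if "i \<in> A" for i using permutes_orbit_subset[OF w that] .
  have self: "i \<in> ?orb i" for i by (rule permutation_self_in_orbit[OF perm])
  have fin: "finite c" if "c \<in> ?C" for c
  proof -
    obtain i where "i \<in> A" "c = ?orb i" using \<open>c \<in> ?C\<close> by blast
    then show ?thesis using finite_subset[OF sub A] by simp
  qed
  have eq: "?orb j = ?orb i" if "j \<in> ?orb i" for i j
    using orbit_cyclic_eq3[OF cyclic_on_orbit'[OF perm] that] .
  have step: "?orb (w i) = ?orb i" for i by (rule permutation_orbit_step[OF perm])
  have wA: "w i \<in> A" if "i \<in> A" for i using w that by (simp only: permutes_in_image)
  have const: "f j = f i" if f: "\<forall>i\<in>A. f (w i) = f i" and "i \<in> A" "j \<in> ?orb i" for f :: "nat \<Rightarrow> nat" and i j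
    using that(3)
  proof induction
    case base
    then show ?case using f that(2) by simp
  next
    case (step j)
    then have "j \<in> A" using sub[OF that(2)] by blast
    then show ?case using f step by simp
  qed
    have sum_orb: "(\<Sum>i\<in>A. xpow (g (?orb i)) (1 :: nat)) = (\<Sum>c\<in>?C. xpow (g c) (card c))" for g :: "nat set \<Rightarrow> nat"
  proof -
    have "(\<Sum>i\<in>A. xpow (g (?orb i)) (1 :: nat)) =
        (\<Sum>c\<in>?C. \<Sum>i\<in>{i \<in> A. ?orb i = c}. xpow (g (?orb i)) 1)"
      using A by (intro sum.group[symmetric]) auto
    also have "\<dots> = (\<Sum>c\<in>?C. xpow (g c) (card c))"
    proof (rule sum.cong[OF refl])
      fix c assume "c \<in> ?C"
      then obtain i where i: "i \<in> A" "c = ?orb i" by blast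
      have "{j \<in> A. ?orb j = c} = c"
        using sub[OF i(1)] self eq unfolding i(2) by blast
      moreover have "(\<Sum>j\<in>c. xpow (g (?orb j)) (1 :: nat)) = (\<Sum>j\<in>c. xpow (g c) 1)"
        using eq unfolding i(2) by (intro sum.cong) auto
      moreover have "(\<Sum>j\<in>J. xpow x (1 :: nat)) = xpow x (card J)" if "finite J" for J :: "nat set" and x :: nat
        using that by (induction J rule: finite_induct) (simp_all add: single_add[symmetric] del: sum_constant)
      ultimately show "(\<Sum>i\<in>{i \<in> A. ?orb i = c}. xpow (g (?orb i)) 1) = xpow (g c) (card c)"
        using fin[OF \<open>c \<in> ?C\<close>] by simp
    qed
    finally show ?thesis .
  qed
  let ?F = "{f \<in> A \<rightarrow>\<^sub>E {1..}. (\<forall>i\<in>A. f (w i) = f i) \<and> (\<Sum>i\<in>A. xpow (f i) 1) = m}"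
  let ?G = "{g \<in> ?C \<rightarrow>\<^sub>E {1 :: nat..}. (\<Sum>c\<in>?C. xpow (g c) (card c)) = m}"
  have "bij_betw (\<lambda>g. restrict (\<lambda>i. g (?orb i)) A) ?G ?F"
  proof (rule bij_betwI[where g = "\<lambda>f. restrict (\<lambda>c. f (SOME i. i \<in> c)) ?C"])
    have some: "(SOME j. j \<in> ?orb i) \<in> ?orb i" for i using self by (rule someI)
    show "(\<lambda>g. restrict (\<lambda>i. g (?orb i)) A) \<in> ?G \<rightarrow> ?F"
    proof
      fix g assume g: "g \<in> ?G"
      have "(\<Sum>i\<in>A. xpow (restrict (\<lambda>i. g (?orb i)) A i) (1 :: nat)) = m"
        using sum_orb[of g] g by simp
      then show "restrict (\<lambda>i. g (?orb i)) A \<in> ?F"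
        using g wA step by (auto simp: PiE_iff)
    qed
    show "(\<lambda>f. restrict (\<lambda>c. f (SOME i. i \<in> c)) ?C) \<in> ?F \<rightarrow> ?G"
    proof
      fix f assume f: "f \<in> ?F"
      let ?g = "restrict (\<lambda>c. f (SOME i. i \<in> c)) ?C"
      have "?g (?orb i) = f i" if "i \<in> A" for i
        using const[of f i "SOME j. j \<in> ?orb i"] f that some by simp
      then have "(\<Sum>i\<in>A. xpow (?g (?orb i)) (1 :: nat)) = m"
        using f by simp
      then have "(\<Sum>c\<in>?C. xpow (?g c) (card c)) = m"
        unfolding sum_orb .
      moreover have "?g \<in> ?C \<rightarrow>\<^sub>E {1..}"
        using f sub some by (fastforce simp: PiE_iff)
      ultimately show "?g \<in> ?G" by blast
    qed
    show "restrict (\<lambda>c. restrict (\<lambda>i. g (?orb i)) A (SOME i. i \<in> c)) ?C = g" if "g \<in> ?G" for g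
    proof
      fix c show "restrict (\<lambda>c. restrict (\<lambda>i. g (?orb i)) A (SOME i. i \<in> c)) ?C c = g c"
      proof (cases "c \<in> ?C")
        case True
        then obtain i where i: "i \<in> A" "c = ?orb i" by blast
        have "(SOME i. i \<in> c) \<in> A" "?orb (SOME i. i \<in> c) = c"
          using some[of i] sub[OF i(1)] eq unfolding i(2) by auto
        then show ?thesis using True by simp
      qed (use that in \<open>auto simp: PiE_iff extensional_def\<close>)
    qed
    show "restrict (\<lambda>i. restrict (\<lambda>c. f (SOME i. i \<in> c)) ?C (?orb i)) A = f" if "f \<in> ?F" for f
    proof
      fix i show "restrict (\<lambda>i. restrict (\<lambda>c. f (SOME i. i \<in> c)) ?C (?orb i)) A i = f i"
        using const[of f i "SOME j. j \<in> ?orb i"] that some[of i]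
        by (cases "i \<in> A") (auto simp: PiE_iff extensional_def)
    qed
  qed
  moreover have "card c \<ge> 1" if "c \<in> ?C" for c
  proof -
    have "c \<noteq> {}" using that self by auto
    then show ?thesis using fin[OF that] by (simp add: Suc_le_eq card_gt_0_iff)
  qed
  ultimately show ?thesis
    using coeff_prod_power_sum[of ?C card m] A by (simp only: bij_betw_same_card finite_imageI)
qed

section \<open>Burnside counting for functions on a finite set\<close>

lemma exists_function_with_content:
  "finite A \<Longrightarrow> size M = card A \<Longrightarrow> \<exists>F\<in>A \<rightarrow>\<^sub>E UNIV. image_mset F (mset_set A) = M"
proof (induction A arbitrary: M rule: finite_induct)
  case empty
  then show ?case by simp
next
  case (insert a A)
  then have "M \<noteq> {#}" by auto
  then obtain x N where M: "M = add_mset x N" by (metis multiset_cases)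
  then obtain F where F: "F \<in> A \<rightarrow>\<^sub>E UNIV" "image_mset F (mset_set A) = N"
    using insert by auto
  have "image_mset (F(a := x)) (mset_set A) = image_mset F (mset_set A)"
    using insert.hyps by (intro image_mset_cong) auto
  then have "image_mset (F(a := x)) (mset_set (insert a A)) = M"
    using insert.hyps F M by simp
  moreover have "F(a := x) \<in> insert a A \<rightarrow>\<^sub>E UNIV" using F by (auto simp: PiE_iff extensional_def)
  ultimately show ?case by blast
qed

text \<open>The functions of a given content form one orbit of the symmetric group, so their
  stabilizers have \<open>(card A)!\<close> elements in total.\<close>

lemma sum_stabilizers_content:
  assumes A: "finite A" and M: "size M = card A"
  shows "(\<Sum>F | F \<in> A \<rightarrow>\<^sub>E UNIV \<and> image_mset F (mset_set A) = M.
    card {w. w permutes A \<and> (\<forall>i\<in>A. F (w i) = F i)}) = fact (card A)"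
proof -
  let ?st = "\<lambda>F. {w. w permutes A \<and> (\<forall>i\<in>A. F (w i) = F i)}"
  let ?P = "{w. w permutes A}" and ?F = "{F. F \<in> A \<rightarrow>\<^sub>E UNIV \<and> image_mset F (mset_set A) = M}"
  obtain F0 where F0: "F0 \<in> A \<rightarrow>\<^sub>E UNIV" "image_mset F0 (mset_set A) = M"
    using exists_function_with_content[OF A M] by blast
  have finP: "finite ?P" using A by (rule finite_permutations)
  have finF: "finite ?F"
  proof (rule finite_subset)
    have "F i \<in> set_mset M" if "i \<in> A" "image_mset F (mset_set A) = M" for F i
      using that A by (auto simp flip: that(2))
    then show "?F \<subseteq> A \<rightarrow>\<^sub>E set_mset M" by (auto simp: PiE_iff extensional_def)
    show "finite (A \<rightarrow>\<^sub>E set_mset M)" using A by (simp add: finite_PiE)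
  qed
  have card_eq: "card (?st F) = card {w \<in> ?P. restrict (F0 \<circ> w) A = F}"
    if F: "F \<in> ?F" for F
  proof -
    have "image_mset F (mset_set A) = image_mset F0 (mset_set A)" using F F0 by simp
    then obtain p where p: "p permutes A" "\<forall>x\<in>A. F x = F0 (p x)"
      using image_mset_eq_implies_permutes[OF A] by blast
    \<comment> \<open>Composition with \<open>p\<close> carries the stabilizer of \<open>F\<close>
      to the fibre over \<open>F\<close> of the map \<open>w \<mapsto> F0 \<circ> w\<close>. The
      fibres partition the symmetric group, which gives the total.\<close>
    have "bij_betw (\<lambda>w. p \<circ> w) (?st F) {w \<in> ?P. restrict (F0 \<circ> w) A = F}"
    proof (rule bij_betwI[where g = "\<lambda>w. inv' p \<circ> w"])
      show "(\<lambda>w. p \<circ> w) \<in> (?st F) \<rightarrow> {w \<in> ?P. restrict (F0 \<circ> w) A = F}"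
      proof
        fix w assume w: "w \<in> (?st F)"
        then have "w i \<in> A" if "i \<in> A" for i using that by (simp add: permutes_in_image)
        then have "F0 (p (w i)) = F i" if "i \<in> A" for i using p(2) w that by simp
        then have "restrict (F0 \<circ> (p \<circ> w)) A = F" using F by (auto simp: PiE_iff extensional_def fun_eq_iff)
        then show "p \<circ> w \<in> {w \<in> ?P. restrict (F0 \<circ> w) A = F}"
          using w p(1) by (simp add: permutes_compose)
      qed
      show "(\<lambda>w. inv' p \<circ> w) \<in> {w \<in> ?P. restrict (F0 \<circ> w) A = F} \<rightarrow> (?st F)"
      proof
        fix w assume w: "w \<in> {w \<in> ?P. restrict (F0 \<circ> w) A = F}"
        then have wA: "w i \<in> A" if "i \<in> A" for i using that by (simp add: permutes_in_image)
        have ip: "inv' p permutes A" using p(1) by (rule permutes_inv)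
        have "F (inv' p (w i)) = F i" if "i \<in> A" for i
        proof -
          have "inv' p (w i) \<in> A" using ip wA[OF that] by (simp add: permutes_in_image)
          then have "F (inv' p (w i)) = F0 (p (inv' p (w i)))" using p(2) by simp
          also have "\<dots> = F0 (w i)" using permutes_inverses(1)[OF p(1)] by simp
          also have "\<dots> = F i" using w that by (auto simp: fun_eq_iff dest: spec[of _ i])
          finally show ?thesis .
        qed
        then show "inv' p \<circ> w \<in> (?st F)"
          using w ip by (simp add: permutes_compose)
      qed
    qed (use permutes_inverses[OF p(1)] in \<open>auto simp: fun_eq_iff\<close>)
    then show ?thesis by (rule bij_betw_same_card)
  qed
  have "(\<Sum>F\<in>?F. card (?st F)) =
      (\<Sum>F\<in>?F. \<Sum>w\<in>{w \<in> ?P. restrict (F0 \<circ> w) A = F}. 1)"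
    using card_eq by (intro sum.cong) auto
  also have "\<dots> = (\<Sum>w\<in>?P. 1)"
  proof (rule sum.group[OF finP finF])
    show "(\<lambda>w. restrict (F0 \<circ> w) A) ` ?P \<subseteq> ?F"
    proof
      fix F assume "F \<in> (\<lambda>w. restrict (F0 \<circ> w) A) ` ?P"
      then obtain w where w: "w permutes A" "F = restrict (F0 \<circ> w) A" by blast
      have "image_mset F (mset_set A) = image_mset F0 (image_mset w (mset_set A))"
        unfolding w(2) multiset.map_comp using A by (intro image_mset_cong) auto
      also have "image_mset w (mset_set A) = mset_set A"
        using w(1) by (simp add: image_mset_mset_set permutes_inj_on permutes_image)
      finally have "image_mset F (mset_set A) = M" unfolding F0(2) .
      moreover have "F \<in> A \<rightarrow>\<^sub>E UNIV" using w(2) by simp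
      ultimately show "F \<in> ?F" by (simp only: mem_Collect_eq)
    qed
  qed
  also have "\<dots> = fact (card A)" using A by (simp add: card_permutations)
  finally show ?thesis .
qed

text \<open>Burnside's lemma: the family is a union of orbits, the orbits are the contents, and
  after exchanging the sums each content receives \<open>fact (card A)\<close>.\<close>

lemma sum_fixed_functions:
  assumes A: "finite A" and fin: "finite \<F>" and sub: "\<F> \<subseteq> A \<rightarrow>\<^sub>E UNIV"
    and closed: "\<And>F G. F \<in> \<F> \<Longrightarrow> G \<in> A \<rightarrow>\<^sub>E UNIV \<Longrightarrow>
      image_mset G (mset_set A) = image_mset F (mset_set A) \<Longrightarrow> G \<in> \<F>"
  shows "(\<Sum>w | w permutes A. card {F \<in> \<F>. \<forall>i\<in>A. F (w i) = F i}) =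
    fact (card A) * card ((\<lambda>F. image_mset F (mset_set A)) ` \<F>)"
proof -
  let ?st = "\<lambda>F. {w. w permutes A \<and> (\<forall>i\<in>A. F (w i) = F i)}"
  let ?c = "\<lambda>F. image_mset F (mset_set A)"
  have finP: "finite {w. w permutes A}" using A by (rule finite_permutations)
  have "(\<Sum>w | w permutes A. card {F \<in> \<F>. \<forall>i\<in>A. F (w i) = F i}) =
      (\<Sum>w | w permutes A. \<Sum>F\<in>\<F>. if \<forall>i\<in>A. F (w i) = F i then 1 else 0)"
    using fin by (simp add: sum.If_cases Int_def)
  also have "\<dots> = (\<Sum>F\<in>\<F>. \<Sum>w | w permutes A. if \<forall>i\<in>A. F (w i) = F i then 1 else 0)"
    by (rule sum.swap)
  also have "\<dots> = (\<Sum>F\<in>\<F>. card (?st F))"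
    using finP by (simp add: sum.If_cases Int_def)
  also have "\<dots> = (\<Sum>M\<in>?c ` \<F>. \<Sum>F\<in>{F \<in> \<F>. ?c F = M}. card (?st F))"
    using fin by (intro sum.group[symmetric]) auto
  also have "\<dots> = (\<Sum>M\<in>?c ` \<F>. fact (card A))"
  proof (rule sum.cong[OF refl])
    fix M assume "M \<in> ?c ` \<F>"
    then obtain F0 where F0: "F0 \<in> \<F>" "M = ?c F0" by blast
    have "{F \<in> \<F>. ?c F = M} = {F. F \<in> A \<rightarrow>\<^sub>E UNIV \<and> ?c F = M}"
      using sub closed F0 by blast
    moreover have "size M = card A" using F0 by simp
    ultimately show "(\<Sum>F\<in>{F \<in> \<F>. ?c F = M}. card (?st F)) = fact (card A)"
      using sum_stabilizers_content[OF A, of M] by simp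
  qed
  finally show ?thesis by (simp add: mult.commute)
qed

text \<open>Matrices of natural numbers with rows indexed by spines and columns by labels, encoded
  as the multiset of their index pairs. The row sums are prescribed by \<open>c\<close> and the
  column sums by \<open>m\<close>, so their number is a coefficient of a product of complete
  symmetric functions.\<close>

definition matrices :: "nat list list \<Rightarrow> (nat \<Rightarrow>\<^sub>0 nat) \<Rightarrow> (nat list \<times> nat) multiset set" where
  "matrices c m = {M. image_mset fst M = mset c \<and> (\<Sum>x\<in>#image_mset snd M. xpow x 1) = m}"

lemma size_matrices: "M \<in> matrices c m \<Longrightarrow> size M = length c"
proof -
  assume "M \<in> matrices c m"
  then have "size (image_mset fst M) = size (mset c)" by (simp only: matrices_def mem_Collect_eq)
  then show ?thesis by (simp only: size_image_mset size_mset)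
qed

text \<open>Distributions of \<open>{1..n}\<close> over the spines, each spine receiving as many
  elements as it has entries. As a set with an action of the symmetric group this is the coset space
  of a Young subgroup.\<close>

definition spine_functions :: "nat \<Rightarrow> 'a gapped \<Rightarrow> (nat \<Rightarrow> nat list) set" where
  "spine_functions n u = {c \<in> {1..n} \<rightarrow>\<^sub>E UNIV. image_mset c (mset_set {1..n}) = mset (spine_ids u)}"

text \<open>The inverse makes this a left action; the restriction keeps the functions
  extensional.\<close>

definition permute_fun :: "nat \<Rightarrow> (nat \<Rightarrow> nat) \<Rightarrow> 'u \<times> (nat \<Rightarrow> 'b) \<Rightarrow> 'u \<times> (nat \<Rightarrow> 'b)" where
  "permute_fun n w = (\<lambda>(u, c). (u, restrict (c \<circ> inv' w) {1..n}))"

lemma finite_spine_functions: "finite (spine_functions n u)"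
proof (rule finite_subset)
  have "c i \<in> set (spine_ids u)" if "i \<in> {1..n}" "image_mset c (mset_set {1..n}) = mset (spine_ids u)" for c i
  proof -
    have "c i \<in># image_mset c (mset_set {1..n})" using that(1) by simp
    then show ?thesis unfolding that(2) by simp
  qed
  then show "spine_functions n u \<subseteq> {1..n} \<rightarrow>\<^sub>E set (spine_ids u)"
    by (auto simp: spine_functions_def PiE_iff extensional_def)
qed (simp add: finite_PiE)

lemma permute_fun_fixed:
  assumes w: "w permutes {1..n}" and c: "c \<in> {1..n} \<rightarrow>\<^sub>E UNIV"
  shows "permute_fun n w (u, c) = (u, c) \<longleftrightarrow> (\<forall>i\<in>{1..n}. c (w i) = c i)"
proof -
  let ?A = "{1..n}"
  have "restrict (c \<circ> inv' w) ?A = c \<longleftrightarrow> (\<forall>i\<in>?A. c (inv' w i) = c i)"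
    using c by (auto simp: fun_eq_iff PiE_iff extensional_def)
  also have "\<dots> \<longleftrightarrow> (\<forall>i\<in>?A. c (w i) = c i)"
  proof
    assume *: "\<forall>i\<in>?A. c (inv' w i) = c i"
    show "\<forall>i\<in>?A. c (w i) = c i"
    proof
      fix i assume "i \<in> ?A"
      then have "w i \<in> ?A" by (simp only: permutes_in_image[OF w])
      then show "c (w i) = c i" using * permutes_inverses(2)[OF w, of i] by metis
    qed
  next
    assume *: "\<forall>i\<in>?A. c (w i) = c i"
    show "\<forall>i\<in>?A. c (inv' w i) = c i"
    proof
      fix i assume "i \<in> ?A"
      then have "inv' w i \<in> ?A" by (simp only: permutes_in_image[OF permutes_inv[OF w]])
      then show "c (inv' w i) = c i" using * permutes_inverses(1)[OF w, of i] by metis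
    qed
  qed
  finally show ?thesis by (simp add: permute_fun_def)
qed

text \<open>A distribution \<open>c\<close> and a coloring \<open>f\<close> combine into one
  function with values in pairs, fixed by \<open>w\<close> exactly if both are. Burnside's lemma
  counts the possible contents of these functions, which are the matrices.\<close>

lemma sum_fixed_spine_functions:
  fixes u :: "'a gapped"
  assumes n: "length (labels u) = n"
  shows "(\<Sum>w | w permutes {1..n}. card {c \<in> spine_functions n u. \<forall>i\<in>{1..n}. c (w i) = c i} *
      card {f \<in> {1..n} \<rightarrow>\<^sub>E UNIV. (\<forall>i\<in>{1..n}. f (w i) = f i) \<and> (\<Sum>i\<in>{1..n}. xpow (f i) 1) = m})
    = fact n * card (matrices (spine_ids u) m)"
proof -
  let ?A = "{1..n}"
  let ?cont = "\<lambda>F. image_mset F (mset_set ?A)"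
  let ?f = "{f \<in> ?A \<rightarrow>\<^sub>E UNIV. (\<Sum>i\<in>?A. xpow (f i) 1) = m}"
  let ?pair = "\<lambda>(c, f). restrict (\<lambda>i. (c i, f i)) ?A"
  define \<F> where "\<F> = ?pair ` (spine_functions n u \<times> ?f)"
  have finf: "finite ?f" by (rule finite_single_sum_functions) auto
  have inj: "inj_on ?pair (spine_functions n u \<times> ?f)"
  proof (rule inj_onI, clarify)
    fix c c' :: "nat \<Rightarrow> nat list" and f f' :: "nat \<Rightarrow> nat"
    assume *: "c \<in> spine_functions n u" "f \<in> ?A \<rightarrow>\<^sub>E UNIV" "c' \<in> spine_functions n u" "f' \<in> ?A \<rightarrow>\<^sub>E UNIV"
      and eq: "restrict (\<lambda>i. (c i, f i)) ?A = restrict (\<lambda>i. (c' i, f' i)) ?A"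
    have "c i = c' i \<and> f i = f' i" for i
    proof (cases "i \<in> ?A")
      case True
      then show ?thesis using fun_cong[OF eq, of i] by simp
    next
      case False
      then show ?thesis using * by (simp add: spine_functions_def PiE_iff extensional_def del: atLeastAtMost_iff)
    qed
    then show "c = c' \<and> f = f'" by (simp add: fun_eq_iff)
  qed
  have mem: "F \<in> \<F> \<longleftrightarrow> F \<in> ?A \<rightarrow>\<^sub>E UNIV \<and> ?cont F \<in> matrices (spine_ids u) m" for F
  proof -
    have sums: "(\<Sum>x\<in>#image_mset snd (?cont F). xpow x (1 :: nat)) =
        (\<Sum>i\<in>?A. xpow (snd (F i)) 1)" for F :: "nat \<Rightarrow> nat list \<times> nat"
      by (simp add: multiset.map_comp o_def sum_unfold_sum_mset)
    show ?thesis
    proof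
      assume "F \<in> \<F>"
      then obtain c f where cf: "c \<in> spine_functions n u" "f \<in> ?f" "F = ?pair (c, f)" by (auto simp: \<F>_def)
      have "image_mset fst (?cont F) = image_mset c (mset_set ?A)"
        unfolding multiset.map_comp cf(3) by (intro image_mset_cong) auto
      then have "image_mset fst (?cont F) = mset (spine_ids u)"
        using cf(1) by (simp only: spine_functions_def mem_Collect_eq)
      moreover have "(\<Sum>i\<in>?A. xpow (snd (F i)) (1 :: nat)) = (\<Sum>i\<in>?A. xpow (f i) 1)"
        unfolding cf(3) by (intro sum.cong) auto
      then have "(\<Sum>i\<in>?A. xpow (snd (F i)) (1 :: nat)) = m"
        using cf(2) by (simp only: mem_Collect_eq)
      moreover have "F \<in> ?A \<rightarrow>\<^sub>E UNIV" unfolding cf(3) by simp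
      ultimately show "F \<in> ?A \<rightarrow>\<^sub>E UNIV \<and> ?cont F \<in> matrices (spine_ids u) m"
        by (simp only: matrices_def sums mem_Collect_eq)
    next
      assume F: "F \<in> ?A \<rightarrow>\<^sub>E UNIV \<and> ?cont F \<in> matrices (spine_ids u) m"
      let ?c = "restrict (fst \<circ> F) ?A" and ?g = "restrict (snd \<circ> F) ?A"
      have "image_mset ?c (mset_set ?A) = image_mset fst (?cont F)"
        unfolding multiset.map_comp by (intro image_mset_cong) auto
      then have "?c \<in> spine_functions n u"
        using F by (simp add: spine_functions_def matrices_def)
      moreover have "(\<Sum>i\<in>?A. xpow (?g i) (1 :: nat)) = (\<Sum>i\<in>?A. xpow (snd (F i)) 1)"
        by (intro sum.cong) auto
      then have "?g \<in> ?f"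
        using F by (simp only: matrices_def sums mem_Collect_eq) simp
      moreover have "F = ?pair (?c, ?g)" using F by (auto simp: PiE_iff extensional_def fun_eq_iff)
      ultimately show "F \<in> \<F>" unfolding \<F>_def by blast
    qed
  qed
  have fixed: "card {c \<in> spine_functions n u. \<forall>i\<in>?A. c (w i) = c i} *
      card {f \<in> ?A \<rightarrow>\<^sub>E UNIV. (\<forall>i\<in>?A. f (w i) = f i) \<and> (\<Sum>i\<in>?A. xpow (f i) 1) = m} =
      card {F \<in> \<F>. \<forall>i\<in>?A. F (w i) = F i}" if w: "w permutes ?A" for w
  proof -
    let ?D = "{c \<in> spine_functions n u. \<forall>i\<in>?A. c (w i) = c i} \<times>
      {f \<in> ?A \<rightarrow>\<^sub>E UNIV. (\<forall>i\<in>?A. f (w i) = f i) \<and> (\<Sum>i\<in>?A. xpow (f i) 1) = m}"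
    have wA: "w i \<in> ?A" if "i \<in> ?A" for i using that by (simp only: permutes_in_image[OF w])
    have fix_iff: "(\<forall>i\<in>?A. ?pair p (w i) = ?pair p i) \<longleftrightarrow>
        (\<forall>i\<in>?A. fst p (w i) = fst p i) \<and> (\<forall>i\<in>?A. snd p (w i) = snd p i)" for p
      using wA by (cases p) (auto simp del: atLeastAtMost_iff)
    have "{F \<in> \<F>. \<forall>i\<in>?A. F (w i) = F i} =
        ?pair ` {p \<in> spine_functions n u \<times> ?f. \<forall>i\<in>?A. ?pair p (w i) = ?pair p i}"
      unfolding \<F>_def by blast
    also have "{p \<in> spine_functions n u \<times> ?f. \<forall>i\<in>?A. ?pair p (w i) = ?pair p i} = ?D"
      unfolding fix_iff by auto
    finally have "card {F \<in> \<F>. \<forall>i\<in>?A. F (w i) = F i} = card (?pair ` ?D)" by (rule arg_cong)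
    also have "\<dots> = card ?D"
      by (rule card_image, rule inj_on_subset[OF inj]) auto
    finally show ?thesis by (simp only: card_cartesian_product)
  qed
  have img: "?cont ` \<F> = matrices (spine_ids u) m"
  proof
    show "matrices (spine_ids u) m \<subseteq> ?cont ` \<F>"
    proof
      fix M assume M: "M \<in> matrices (spine_ids u) m"
      then have "size M = card ?A"
        using n by (simp add: size_matrices)
      then obtain F where "F \<in> ?A \<rightarrow>\<^sub>E UNIV" "?cont F = M"
        using exists_function_with_content[of ?A M] by auto
      then show "M \<in> ?cont ` \<F>" using M mem by blast
    qed
  qed (use mem in blast)
  have "(\<Sum>w | w permutes ?A. card {F \<in> \<F>. \<forall>i\<in>?A. F (w i) = F i}) =
      fact (card ?A) * card (?cont ` \<F>)"
  proof (rule sum_fixed_functions)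
    show "finite \<F>" unfolding \<F>_def using finf finite_spine_functions by (intro finite_imageI finite_cartesian_product)
    show "\<F> \<subseteq> ?A \<rightarrow>\<^sub>E UNIV" using mem by blast
    show "G \<in> \<F>" if "F \<in> \<F>" "G \<in> ?A \<rightarrow>\<^sub>E UNIV" "image_mset G (mset_set ?A) = ?cont F" for F G
      using that mem by simp
  qed simp
  then show ?thesis using fixed img by simp
qed

text \<open>At \<open>w\<close> the character counts the fixed distributions and the coefficient of
  the power sums counts the fixed colorings. Averaging the product over the group counts the orbits
  of pairs.\<close>

theorem coeff_Frob_spine_functions:
  fixes U :: "'a gapped set"
  assumes U: "finite U" "\<And>u. u \<in> U \<Longrightarrow> length (labels u) = n" and m: "0 \<notin> Poly_Mapping.keys m"
  shows "mfps_coeff (Frob n (SIGMA u : U. spine_functions n u) (perm_rep (permute_fun n))) m =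
    of_nat (card (SIGMA u : U. matrices (spine_ids u) m))"
proof -
  let ?C = "\<lambda>w u. {c \<in> spine_functions n u. \<forall>i\<in>{1..n}. c (w i) = c i}"
    and ?E = "\<lambda>w. {f \<in> {1..n} \<rightarrow>\<^sub>E UNIV. (\<forall>i\<in>{1..n}. f (w i) = f i) \<and>
      (\<Sum>i\<in>{1..n}. xpow (f i) 1) = m}"
  let ?A = "{1..n}" and ?B = "SIGMA u : U. spine_functions n u"
  let ?rep = "rep_character ?B (perm_rep (permute_fun n))" and ?psum = "\<lambda>w. mfps_coeff (power_sum_cycle_type n w) m"
  have finB: "finite ?B" using U(1) finite_spine_functions by auto
  have coeff: "?rep w * ?psum w =
      of_nat (\<Sum>u\<in>U. card (?C w u) *
        card (?E w))"
    if w: "w permutes ?A" for w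
  proof -
    have "{x \<in> ?B. permute_fun n w x = x} = (SIGMA u : U. (?C w u))"
    proof -
      have "permute_fun n w (u, c) = (u, c) \<longleftrightarrow> (\<forall>i\<in>?A. c (w i) = c i)" if "c \<in> spine_functions n u" for u :: "'a gapped" and c
        using permute_fun_fixed[OF w, of c u] that by (simp add: spine_functions_def)
      then show ?thesis by blast
    qed
    moreover have "card (SIGMA u : U. (?C w u)) =
        (\<Sum>u\<in>U. card (?C w u))"
    proof (rule card_SigmaI[OF U(1)], rule ballI)
      fix u :: "'a gapped"
      show "finite (?C w u)"
        by (rule finite_subset[OF _ finite_spine_functions[of n u]]) blast
    qed
    ultimately have "rep_character ?B (perm_rep (permute_fun n)) w =
        of_nat (\<Sum>u\<in>U. card (?C w u))"
      by (simp only: rep_character_perm_rep[OF finB])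
    moreover have "mfps_coeff (power_sum_cycle_type n w) m =
        of_nat (card (?E w))"
    proof -
      \<comment> \<open>A value 0 would bring the variable of index 0 into \<open>m\<close>; so
        colorings with arbitrary values may replace those with positive values.\<close>
      have "f i \<ge> 1" if "(\<Sum>i\<in>?A. xpow (f i) 1) = m" "i \<in> ?A" for f i
        using keys_sum_single[of ?A "\<lambda>_. 1" f m i] that m by (cases "f i") auto
      then have "{f \<in> ?A \<rightarrow>\<^sub>E {1..}. (\<forall>i\<in>?A. f (w i) = f i) \<and> (\<Sum>i\<in>?A. xpow (f i) 1) = m} =
        (?E w)"
        by (auto simp: PiE_iff)
      then show ?thesis
        unfolding power_sum_cycle_type_def coeff_prod_power_sum_orbits[OF finite_atLeastAtMost w] by simp
    qed
    ultimately show ?thesis by (simp only: of_nat_mult[symmetric] sum_distrib_right)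
  qed
  have "mfps_coeff (Frob n ?B (perm_rep (permute_fun n))) m =
      1 / fact n * (\<Sum>w | w permutes ?A. ?rep w * ?psum w)"
    by (simp add: Frob_def mfps_coeff_sum sym_group_def)
  also have "\<dots> = 1 / fact n * of_nat (\<Sum>w | w permutes ?A. \<Sum>u\<in>U. card (?C w u) *
        card (?E w))"
  proof -
    have "(\<Sum>w | w permutes ?A. ?rep w * ?psum w) =
      (\<Sum>w | w permutes ?A. of_nat (\<Sum>u\<in>U. card (?C w u) *
        card (?E w)))"
      by (rule sum.cong[OF refl]) (simp only: coeff mem_Collect_eq)
    then show ?thesis by (simp only: of_nat_sum)
  qed
  also have "(\<Sum>w | w permutes ?A. \<Sum>u\<in>U. card (?C w u) *
        card (?E w)) =
      (\<Sum>u\<in>U. \<Sum>w | w permutes ?A. card (?C w u) *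
        card (?E w))"
    by (rule sum.swap)
  also have "\<dots> = (\<Sum>u\<in>U. fact n * card (matrices (spine_ids u) m))"
    by (rule sum.cong[OF refl]) (rule sum_fixed_spine_functions[OF U(2)])
  also have "1 / fact n * of_nat \<dots> = (of_nat (\<Sum>u\<in>U. card (matrices (spine_ids u) m)) :: complex)"
    by (simp add: sum_distrib_left[symmetric])
  also have "(\<Sum>u\<in>U. card (matrices (spine_ids u) m)) = card (SIGMA u : U. matrices (spine_ids u) m)"
  proof -
    have "finite (matrices (spine_ids u) m)" for u :: "'a gapped"
    proof (rule finite_subset)
      let ?S = "set (spine_ids u) \<times> Poly_Mapping.keys m"
      show "matrices (spine_ids u) m \<subseteq> {M. set_mset M \<subseteq> ?S \<and> size M = length (spine_ids u)}"
      proof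
        fix M assume M: "M \<in> matrices (spine_ids u) m"
        have "p \<in> ?S" if "p \<in># M" for p
        proof -
          have "fst p \<in># image_mset fst M" using that by simp
          then have "fst p \<in> set (spine_ids u)" using M by (simp add: matrices_def del: set_image_mset)
          moreover have "snd p \<in> Poly_Mapping.keys m"
          proof -
            from multi_member_split[OF that] obtain N where N: "M = add_mset p N" by blast
            have "Poly_Mapping.lookup m (snd p) \<ge> 1"
              using M unfolding matrices_def N by (auto simp: lookup_add)
            then show ?thesis by (simp add: in_keys_iff)
          qed
          ultimately show ?thesis by (simp add: mem_Times_iff)
        qed
        moreover have "size M = length (spine_ids u)" using M by (rule size_matrices)
        ultimately show "M \<in> {M. set_mset M \<subseteq> ?S \<and> size M = length (spine_ids u)}" by blast
      qed
      show "finite {M. set_mset M \<subseteq> ?S \<and> size M = length (spine_ids u)}"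
        using finite_multisets_of_size[of ?S "length (spine_ids u)"] by (simp add: multisets_of_size_def)
    qed
    then show ?thesis using U(1) by (simp add: card_SigmaI)
  qed
  finally show ?thesis .
qed

section \<open>Counting shapes with distributed labels\<close>

text \<open>The product of the reciprocals of \<open>fact\<close> of the spine lengths, over all
  spines but the outermost. Leaving this one out makes the weight multiplicative along the outermost
  spine; its factorial is divided out separately.\<close>

fun inner_weight :: "'a gapped \<Rightarrow> real" where
  "inner_weight (Final k) = 1"
| "inner_weight (GapL k s) = inner_weight s"
| "inner_weight (GapR k s) = inner_weight s"
| "inner_weight (GapT k t s) = inner_weight t / fact (spine_length t) * inner_weight s"

fun inner_ids :: "'a gapped \<Rightarrow> nat list multiset" where
  "inner_ids (Final k) = {#}"
| "inner_ids (GapL k s) = inner_ids s"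
| "inner_ids (GapR k s) = inner_ids s"
| "inner_ids (GapT k t s) = image_mset (Cons (spine_length s)) (mset (spine_ids t)) + inner_ids s"

definition count_facts :: "'a multiset \<Rightarrow> real" where
  "count_facts M = (\<Prod>x\<in>set_mset M. fact (count M x))"

lemma count_facts_add:
  assumes "set_mset M \<inter> set_mset N = {}"
  shows "count_facts (M + N) = count_facts M * count_facts N"
proof -
  have "count (M + N) x = count M x" if "x \<in># M" for x
    using assms that by (auto simp: not_in_iff)
  moreover have "count (M + N) x = count N x" if "x \<in># N" for x
    using assms that by (auto simp: not_in_iff)
  ultimately show ?thesis
    unfolding count_facts_def set_mset_union using assms by (simp add: prod.union_disjoint)
qed

lemma count_facts_image:
  assumes "inj f"
  shows "count_facts (image_mset f M) = count_facts M"
proof -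
  have "count (image_mset f M) (f x) = count M x" for x
    by (induction M) (use assms in \<open>auto dest: injD\<close>)
  then show ?thesis
    unfolding count_facts_def set_image_mset using assms
    by (subst prod.reindex) (auto intro: inj_on_subset)
qed

lemma count_facts_replicate: "count_facts (replicate_mset n x) = fact n"
  by (cases "n = 0") (auto simp: count_facts_def)

lemma mset_spine_ids: "mset (spine_ids u) = replicate_mset (spine_length u) [] + inner_ids u"
  by (induction u) auto

lemma inner_ids_bound: "b \<in># inner_ids u \<Longrightarrow> b \<noteq> [] \<and> hd b < spine_length u"
  by (induction u) (auto simp: less_Suc_eq)

lemma spine_length_pos [simp]: "0 < spine_length u"
  by (cases u) auto

lemma count_facts_spine_ids:
  "count_facts (mset (spine_ids u)) = fact (spine_length u) * count_facts (inner_ids u)"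
proof -
  have "set_mset (replicate_mset (spine_length u) []) \<inter> set_mset (inner_ids u) = {}"
    using inner_ids_bound[of "[]" u] by auto
  then show ?thesis unfolding mset_spine_ids by (simp add: count_facts_add count_facts_replicate)
qed

text \<open>Different spines have different names, so the multiplicities of the names are the spine
  lengths.\<close>

lemma count_facts_inner_ids: "count_facts (inner_ids u) * inner_weight u = 1"
proof (induction u)
  case (GapT k t s)
  have "set_mset (image_mset (Cons (spine_length s)) (mset (spine_ids t))) \<inter> set_mset (inner_ids s) = {}"
    using inner_ids_bound[of _ s] by fastforce
  then have "count_facts (inner_ids (GapT k t s)) =
      count_facts (mset (spine_ids t)) * count_facts (inner_ids s)"
    by (simp add: count_facts_add count_facts_image)
  then have "count_facts (inner_ids (GapT k t s)) * inner_weight (GapT k t s) =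
      (count_facts (inner_ids t) * inner_weight t) * (count_facts (inner_ids s) * inner_weight s)"
    by (simp add: count_facts_spine_ids)
  then show ?case by (simp only: GapT.IH mult_1_right)
qed (simp_all add: count_facts_def)

text \<open>Listing the values at 1, ..., n turns a distribution into an ordering of the multiset of
  spine names, and these are counted by a multinomial coefficient.\<close>

lemma card_spine_functions:
  assumes n: "length (labels u) = n"
  shows "real (card (spine_functions n u)) = fact n * (inner_weight u / fact (spine_length u))"
proof -
  let ?M = "mset (spine_ids u)"
  have "bij_betw (\<lambda>c. map c [1..<Suc n]) (spine_functions n u) (permutations_of_multiset ?M)"
  proof (rule bij_betwI[where g = "\<lambda>xs. restrict (\<lambda>i. xs ! (i - 1)) {1..n}"])
    have ms: "mset (map c [1..<Suc n]) = image_mset c (mset_set {1..n})" for c :: "nat \<Rightarrow> nat list"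
      unfolding mset_map mset_upt by (simp add: atLeastLessThanSuc_atLeastAtMost)
    show "(\<lambda>c. map c [1..<Suc n]) \<in> spine_functions n u \<rightarrow> permutations_of_multiset ?M"
    proof
      fix c assume "c \<in> spine_functions n u"
      then have "mset (map c [1..<Suc n]) = ?M" unfolding ms by (simp only: spine_functions_def mem_Collect_eq)
      then show "map c [1..<Suc n] \<in> permutations_of_multiset ?M" by (rule permutations_of_multisetI)
    qed
    have inv: "map (restrict (\<lambda>i. xs ! (i - 1)) {1..n}) [1..<Suc n] = xs" if "length xs = n" for xs :: "nat list list"
      using that by (intro nth_equalityI) (auto simp del: upt_Suc)
    have len: "length xs = n" if "xs \<in> permutations_of_multiset ?M" for xs
      using mset_eq_length[OF permutations_of_multisetD[OF that]] n by simp
    show "(\<lambda>xs. restrict (\<lambda>i. xs ! (i - 1)) {1..n}) \<in> permutations_of_multiset ?M \<rightarrow> spine_functions n u"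
    proof
      fix xs assume xs: "xs \<in> permutations_of_multiset ?M"
      have "image_mset (restrict (\<lambda>i. xs ! (i - 1)) {1..n}) (mset_set {1..n}) = mset xs"
        unfolding ms[symmetric] inv[OF len[OF xs]] ..
      then show "restrict (\<lambda>i. xs ! (i - 1)) {1..n} \<in> spine_functions n u"
        using permutations_of_multisetD[OF xs] by (simp add: spine_functions_def)
    qed
    show "map (restrict (\<lambda>i. xs ! (i - 1)) {1..n}) [1..<Suc n] = xs" if "xs \<in> permutations_of_multiset ?M" for xs
      using inv len[OF that] by blast
    show "restrict (\<lambda>i. map c [1..<Suc n] ! (i - 1)) {1..n} = c" if "c \<in> spine_functions n u" for c
    proof
      fix i show "restrict (\<lambda>i. map c [1..<Suc n] ! (i - 1)) {1..n} i = c i"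
        using that by (cases "i \<in> {1..n}") (auto simp: spine_functions_def PiE_iff extensional_def simp del: upt_Suc)
    qed
  qed
  then have "card (spine_functions n u) = card (permutations_of_multiset ?M)"
    by (rule bij_betw_same_card)
  moreover have "card (permutations_of_multiset ?M) * (\<Prod>x\<in>set_mset ?M. fact (count ?M x)) = fact n"
    using card_permutations_of_multiset[of ?M] n by simp
  then have "real (card (permutations_of_multiset ?M) * (\<Prod>x\<in>set_mset ?M. fact (count ?M x))) = real (fact n)"
    by (simp only:)
  then have "real (card (permutations_of_multiset ?M)) * count_facts ?M = fact n"
    by (simp only: count_facts_def of_nat_mult of_nat_prod of_nat_fact)
  ultimately have "real (card (spine_functions n u)) * (fact (spine_length u) * count_facts (inner_ids u)) = fact n"
    by (simp add: count_facts_spine_ids)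
  then have "real (card (spine_functions n u)) * fact (spine_length u) * (count_facts (inner_ids u) * inner_weight u)
      = fact n * inner_weight u"
    by (metis mult.assoc)
  then show ?thesis unfolding count_facts_inner_ids by (simp add: field_simps)
qed

lemma length_labels_pos: "0 < length (labels u)"
  by (cases u) auto

lemma spine_length_le: "spine_length u \<le> length (labels u)"
  by (induction u) auto

section \<open>The exponential generating function of the distributed shapes\<close>

definition gapped_of :: "nat \<Rightarrow> unit gapped set" where
  "gapped_of n = {u. length (labels u) = n}"

definition gapped_of_spine :: "nat \<Rightarrow> nat \<Rightarrow> unit gapped set" where
  "gapped_of_spine n l = {u. length (labels u) = n \<and> spine_length u = l}"

lemma gapped_of_spine_Suc:
  "gapped_of_spine (Suc n) (Suc (Suc l)) = GapL () ` gapped_of_spine n (Suc l) \<union> GapR () ` gapped_of_spine n (Suc l) \<union>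
    (\<lambda>(j, t, s). GapT () t s) ` (SIGMA j : {..n}. gapped_of j \<times> gapped_of_spine (n - j) (Suc l))"
  (is "?L = ?R")
proof
  show "?L \<subseteq> ?R"
  proof
    fix u assume u: "u \<in> ?L"
    show "u \<in> ?R"
    proof (cases u)
      case (GapT k t s)
      then have "(length (labels t), t, s) \<in> (SIGMA j : {..n}. gapped_of j \<times> gapped_of_spine (n - j) (Suc l))"
        using u by (auto simp: gapped_of_spine_def gapped_of_def)
      then have "u \<in> (\<lambda>(j, t, s). GapT () t s) ` (SIGMA j : {..n}. gapped_of j \<times> gapped_of_spine (n - j) (Suc l))"
        using GapT by (intro image_eqI[of _ _ "(length (labels t), t, s)"]) auto
      then show ?thesis by blast
    qed (use u in \<open>auto simp: gapped_of_spine_def\<close>)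
  qed
  show "?R \<subseteq> ?L" by (auto simp: gapped_of_spine_def gapped_of_def)
qed

lemma finite_gapped_of: "finite (gapped_of n)"
proof -
  have "finite {u :: unit gapped. length (labels u) \<le> n}" for n
  proof (induction n)
    case 0
    have "\<not> length (labels u) \<le> 0" for u :: "unit gapped"
      using length_labels_pos[of u] by simp
    then have "{u :: unit gapped. length (labels u) \<le> 0} = {}" by blast
    then show ?case by (simp only: finite.emptyI)
  next
    case (Suc n)
    let ?S = "{u :: unit gapped. length (labels u) \<le> n}"
    have "{u :: unit gapped. length (labels u) \<le> Suc n} \<subseteq>
        {Final ()} \<union> GapL () ` ?S \<union> GapR () ` ?S \<union> (\<lambda>(t, s). GapT () t s) ` (?S \<times> ?S)" (is "_ \<subseteq> ?R")
    proof
      fix u :: "unit gapped" assume "u \<in> {u. length (labels u) \<le> Suc n}"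
      then show "u \<in> ?R" by (cases u) force+
    qed
    then show ?case by (rule finite_subset) (use Suc in simp)
  qed
  from this[of n] show ?thesis by (rule finite_subset[rotated]) (auto simp: gapped_of_def)
qed

lemma finite_gapped_of_spine: "finite (gapped_of_spine n l)"
  by (rule finite_subset[OF _ finite_gapped_of[of n]]) (auto simp: gapped_of_spine_def gapped_of_def)

text \<open>By \<open>card_spine_functions\<close>, the coefficient of degree \<open>n\<close> is
  the size of the set acted on, divided by \<open>fact n\<close>.\<close>

definition gapped_fps :: "real fps" where
  "gapped_fps = Abs_fps (\<lambda>n. \<Sum>u\<in>gapped_of n. inner_weight u / fact (spine_length u))"

definition spine_fps :: "nat \<Rightarrow> real fps" where
  "spine_fps l = Abs_fps (\<lambda>n. \<Sum>u\<in>gapped_of_spine n l. inner_weight u)"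

lemma gapped_of_spine_0: "gapped_of_spine 0 l = {}"
  using length_labels_pos by (auto simp: gapped_of_spine_def)

lemma spine_fps_1: "spine_fps (Suc 0) = fps_X"
proof (rule fps_ext)
  fix n
  have "u = Final ()" if "spine_length u = Suc 0" for u :: "unit gapped"
  proof (cases u)
    case (GapL k s)
    then show ?thesis using that spine_length_pos[of s] by simp
  next
    case (GapR k s)
    then show ?thesis using that spine_length_pos[of s] by simp
  next
    case (GapT k t s)
    then show ?thesis using that spine_length_pos[of s] by simp
  qed simp
  then have "gapped_of_spine n (Suc 0) = (if n = 1 then {Final ()} else {})"
    by (force simp: gapped_of_spine_def)
  then show "fps_nth (spine_fps (Suc 0)) n = fps_nth fps_X n"
    by (simp add: spine_fps_def)
qed

text \<open>Removing the first entry leaves x for the entry and, for the gap after it, 1 for a left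
  edge, 1 for a right edge and \<open>gapped_fps\<close> for a tree.\<close>

lemma spine_fps_Suc: "spine_fps (Suc (Suc l)) = fps_X * (2 + gapped_fps) * spine_fps (Suc l)"
proof (rule fps_ext)
  fix n
  show "fps_nth (spine_fps (Suc (Suc l))) n = fps_nth (fps_X * (2 + gapped_fps) * spine_fps (Suc l)) n"
  proof (cases n)
    case 0
    then show ?thesis by (simp add: spine_fps_def gapped_of_spine_0)
  next
    case (Suc n')
    let ?S = "gapped_of_spine n' (Suc l)"
    let ?D = "SIGMA j : {..n'}. gapped_of j \<times> gapped_of_spine (n' - j) (Suc l)"
    have finD: "finite ?D"
      by (intro finite_SigmaI finite_cartesian_product finite_gapped_of finite_gapped_of_spine) simp
    have injD: "inj_on (\<lambda>(j, t, s). GapT () t s) ?D"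
      by (auto simp: inj_on_def gapped_of_def)
    have "(\<Sum>u\<in>gapped_of_spine (Suc n') (Suc (Suc l)). inner_weight u) =
        (\<Sum>u\<in>GapL () ` ?S. inner_weight u) + (\<Sum>u\<in>GapR () ` ?S. inner_weight u) +
        (\<Sum>u\<in>(\<lambda>(j, t, s). GapT () t s) ` ?D. inner_weight u)"
      unfolding gapped_of_spine_Suc
      by (subst sum.union_disjoint, (use finD finite_gapped_of_spine in auto)[3])+ simp
    also have "(\<Sum>u\<in>GapL () ` ?S. inner_weight u) = (\<Sum>u\<in>?S. inner_weight u)"
      by (subst sum.reindex) (auto simp: inj_on_def)
    also have "(\<Sum>u\<in>GapR () ` ?S. inner_weight u) = (\<Sum>u\<in>?S. inner_weight u)"
      by (subst sum.reindex) (auto simp: inj_on_def)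
    also have "(\<Sum>u\<in>(\<lambda>(j, t, s). GapT () t s) ` ?D. inner_weight u) =
        (\<Sum>(j, t, s)\<in>?D. inner_weight t / fact (spine_length t) * inner_weight s)"
      by (subst sum.reindex[OF injD]) (auto intro!: sum.cong)
    also have "\<dots> = (\<Sum>j\<le>n'. \<Sum>(t, s)\<in>gapped_of j \<times> gapped_of_spine (n' - j) (Suc l).
        inner_weight t / fact (spine_length t) * inner_weight s)"
      by (subst sum.Sigma) (auto intro!: finite_cartesian_product finite_gapped_of finite_gapped_of_spine)
    also have "\<dots> = fps_nth (gapped_fps * spine_fps (Suc l)) n'"
      unfolding fps_mult_nth atLeast0AtMost gapped_fps_def spine_fps_def
      by (simp add: sum_product sum.cartesian_product)
    finally have "fps_nth (spine_fps (Suc (Suc l))) n =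
        2 * fps_nth (spine_fps (Suc l)) n' + fps_nth (gapped_fps * spine_fps (Suc l)) n'"
      by (simp add: spine_fps_def Suc)
    also have "\<dots> = fps_nth ((2 + gapped_fps) * spine_fps (Suc l)) n'"
      by (simp add: distrib_right numeral_fps_const)
    also have "\<dots> = fps_nth (fps_X * (2 + gapped_fps) * spine_fps (Suc l)) n"
      unfolding Suc mult.assoc by simp
    finally show ?thesis .
  qed
qed

text \<open>A spine has one gap fewer than entries; the factor \<open>2 + gapped_fps\<close> on the
  left supplies the missing one and makes a pure power.\<close>

lemma spine_fps_eq: "(2 + gapped_fps) * spine_fps (Suc l) = (fps_X * (2 + gapped_fps)) ^ Suc l"
  by (induction l) (simp_all add: spine_fps_1 spine_fps_Suc mult_ac)

lemma gapped_fps_upto: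
  "fps_eq_upto N gapped_fps (\<Sum>l<N. fps_const (1 / fact (Suc l)) * spine_fps (Suc l))"
  unfolding fps_eq_upto_def
proof (intro allI impI)
  fix n assume n: "n \<le> N"
  have "(\<Sum>u\<in>gapped_of n. inner_weight u / fact (spine_length u)) =
      (\<Sum>l\<in>{Suc 0..N}. \<Sum>u\<in>{u \<in> gapped_of n. spine_length u = l}. inner_weight u / fact (spine_length u))"
  proof (rule sum.group[symmetric])
    show "spine_length ` gapped_of n \<subseteq> {Suc 0..N}"
      using n spine_length_pos order_trans[OF spine_length_le] by (fastforce simp: gapped_of_def Suc_le_eq)
  qed (auto intro: finite_gapped_of)
  also have "\<dots> = (\<Sum>l<N. \<Sum>u\<in>{u \<in> gapped_of n. spine_length u = Suc l}. inner_weight u / fact (spine_length u))"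
    unfolding atLeastLessThanSuc_atLeastAtMost[symmetric] sum.shift_bounds_Suc_ivl
    by (simp add: atLeast0LessThan)
  also have "\<dots> = (\<Sum>l<N. 1 / fact (Suc l) * fps_nth (spine_fps (Suc l)) n)"
  proof (rule sum.cong[OF refl])
    fix l
    have "{u \<in> gapped_of n. spine_length u = Suc l} = gapped_of_spine n (Suc l)"
      by (auto simp: gapped_of_def gapped_of_spine_def)
    then show "(\<Sum>u\<in>{u \<in> gapped_of n. spine_length u = Suc l}. inner_weight u / fact (spine_length u)) =
        1 / fact (Suc l) * fps_nth (spine_fps (Suc l)) n"
      unfolding spine_fps_def fps_nth_Abs_fps sum_distrib_left
      by (auto simp: gapped_of_spine_def intro!: sum.cong)
  qed
  finally show "fps_nth gapped_fps n = fps_nth (\<Sum>l<N. fps_const (1 / fact (Suc l)) * spine_fps (Suc l)) n"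
    by (simp add: gapped_fps_def fps_sum_nth del: fact_Suc)
qed

text \<open>Write g for \<open>gapped_fps\<close>. Sorting by the length of the outermost spine and
  multiplying by 2 + g makes the right side an exponential series without its constant term: (2 + g)
  g = exp (x (2 + g)) - 1. Adding 1 completes the square.\<close>

theorem gapped_fps_equation:
  "(1 + gapped_fps)\<^sup>2 = fps_exp 1 oo (fps_X * (1 + (1 + gapped_fps)))"
proof -
  let ?g = gapped_fps and ?Y = "fps_X * (2 + gapped_fps)"
  have "1 + (2 + ?g) * ?g = fps_exp 1 oo ?Y"
  proof (rule fps_eqI_upto)
    fix N
    have "fps_eq_upto N (1 + (2 + ?g) * ?g)
        (1 + (2 + ?g) * (\<Sum>l<N. fps_const (1 / fact (Suc l)) * spine_fps (Suc l)))"
      by (intro fps_eq_upto_add fps_eq_upto_mult fps_eq_upto_refl gapped_fps_upto)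
    also have "(2 + ?g) * (\<Sum>l<N. fps_const (1 / fact (Suc l)) * spine_fps (Suc l)) =
        (\<Sum>l<N. fps_const (1 / fact (Suc l)) * ?Y ^ Suc l)"
      unfolding sum_distrib_left spine_fps_eq[symmetric] by (intro sum.cong refl) (simp only: mult_ac)
    also have "1 + \<dots> = (\<Sum>l\<le>N. fps_const (fps_nth (fps_exp 1) l) * ?Y ^ l)"
    proof -
      have e: "fps_nth (fps_exp (1 :: real)) k = 1 / fact k" for k by simp
      show ?thesis unfolding e sum.atMost_shift by simp
    qed
    also have "fps_eq_upto N \<dots> (fps_exp 1 oo ?Y)"
      using fps_compose_eq_upto[of ?Y N "fps_exp 1"] by (simp add: fps_eq_upto_sym[of N "fps_exp 1 oo ?Y"])
    finally show "fps_eq_upto N (1 + (2 + ?g) * ?g) (fps_exp 1 oo ?Y)" .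
  qed
  then show ?thesis by (simp add: power2_eq_square algebra_simps)
qed

text \<open>The summand 1 belongs to degree 0, where there is one region but no gapped
  sequence.\<close>

theorem region_fps_eq_gapped: "region_fps = 1 + gapped_fps"
proof (rule fps_square_exp_unique)
  show "region_fps\<^sup>2 = fps_exp 1 oo fps_X * (1 + region_fps)" by (rule region_fps_equation)
  show "(1 + gapped_fps)\<^sup>2 = fps_exp 1 oo fps_X * (1 + (1 + gapped_fps))" by (rule gapped_fps_equation)
  have "linial {..<0} = {}" by (auto simp: linial_def)
  then have "region_count 0 = 1" by (simp add: region_count_def)
  then show "fps_nth region_fps 0 = 1" by (simp add: region_fps_def)
  have "gapped_of 0 = {}" using length_labels_pos by (auto simp: gapped_of_def)
  then show "fps_nth (1 + gapped_fps) 0 = 1" by (simp add: gapped_fps_def)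
qed

theorem region_count_eq:
  assumes "n \<ge> 1"
  shows "region_count n = (\<Sum>u\<in>gapped_of n. card (spine_functions n u))"
proof -
  have "real (region_count n) / fact n = fps_nth (1 + gapped_fps) n"
    unfolding region_fps_eq_gapped[symmetric] by (simp add: region_fps_def)
  then have "real (region_count n) = (\<Sum>u\<in>gapped_of n. fact n * (inner_weight u / fact (spine_length u)))"
    using assms by (simp add: gapped_fps_def field_simps sum_distrib_left)
  also have "\<dots> = (\<Sum>u\<in>gapped_of n. real (card (spine_functions n u)))"
    by (intro sum.cong refl card_spine_functions[symmetric]) (simp add: gapped_of_def)
  finally have "real (region_count n) = real (\<Sum>u\<in>gapped_of n. card (spine_functions n u))" by simp
  then show ?thesis by (simp only: of_nat_eq_iff)
qed

section \<open>The action on the regions\<close>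

text \<open>The maps are restricted to \<open>Y\<close> because elements of
  \<open>BijGroup Y\<close> have to be extensional. That they are bijections follows from the maps
  of the inverse elements.\<close>

lemma group_action_transport:
  assumes G: "group G" and b: "bij_betw b X Y"
    and closed: "\<And>g x. g \<in> carrier G \<Longrightarrow> x \<in> X \<Longrightarrow> act g x \<in> X"
    and one: "\<And>x. x \<in> X \<Longrightarrow> act \<one>\<^bsub>G\<^esub> x = x"
    and mult: "\<And>g h x. g \<in> carrier G \<Longrightarrow> h \<in> carrier G \<Longrightarrow> x \<in> X \<Longrightarrow>
      act (g \<otimes>\<^bsub>G\<^esub> h) x = act g (act h x)"
  shows "group_action G Y (\<lambda>g. restrict (\<lambda>y. b (act g (inv_into X b y))) Y)"
proof -
  let ?i = "inv_into X b" and ?\<phi> = "\<lambda>g. restrict (\<lambda>y. b (act g (inv_into X b y))) Y"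
  have i: "?i y \<in> X" "b (?i y) = y" if "y \<in> Y" for y
    using b that by (auto simp: bij_betw_def inv_into_into f_inv_into_f)
  have bX: "b x \<in> Y" "?i (b x) = x" if "x \<in> X" for x
    using b that by (auto simp: bij_betw_def)
  have \<phi>_closed: "?\<phi> g y \<in> Y" if "g \<in> carrier G" "y \<in> Y" for g y
    using that i bX closed by simp
  have \<phi>_mult: "?\<phi> (g \<otimes>\<^bsub>G\<^esub> h) y = ?\<phi> g (?\<phi> h y)" if "g \<in> carrier G" "h \<in> carrier G" "y \<in> Y" for g h y
    using that i bX closed mult by simp
  have \<phi>_one: "?\<phi> \<one>\<^bsub>G\<^esub> y = y" if "y \<in> Y" for y
    using that i one by simp
  have Bij: "?\<phi> g \<in> Bij Y" if g: "g \<in> carrier G" for g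
  proof -
    have "inv\<^bsub>G\<^esub> g \<in> carrier G" using G g by (rule group.inv_closed)
    moreover have "inv\<^bsub>G\<^esub> g \<otimes>\<^bsub>G\<^esub> g = \<one>\<^bsub>G\<^esub>" "g \<otimes>\<^bsub>G\<^esub> inv\<^bsub>G\<^esub> g = \<one>\<^bsub>G\<^esub>"
      using G g by (simp_all add: group.l_inv group.r_inv)
    ultimately have "bij_betw (?\<phi> g) Y Y"
      using \<phi>_closed \<phi>_mult \<phi>_one g
      by (intro bij_betwI[where g = "?\<phi> (inv\<^bsub>G\<^esub> g)"] funcsetI) metis+
    then show ?thesis by (simp add: Bij_def)
  qed
  have "?\<phi> \<in> hom G (BijGroup Y)"
  proof (rule homI)
    show "?\<phi> g \<in> carrier (BijGroup Y)" if "g \<in> carrier G" for g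
      using Bij[OF that] by (simp add: BijGroup_def)
    show "?\<phi> (g \<otimes>\<^bsub>G\<^esub> h) = ?\<phi> g \<otimes>\<^bsub>BijGroup Y\<^esub> ?\<phi> h" if "g \<in> carrier G" "h \<in> carrier G" for g h
    proof -
      have "?\<phi> g \<otimes>\<^bsub>BijGroup Y\<^esub> ?\<phi> h = compose Y (?\<phi> g) (?\<phi> h)"
        using Bij that by (simp add: BijGroup_def)
      also have "\<dots> = ?\<phi> (g \<otimes>\<^bsub>G\<^esub> h)"
      proof
        fix y show "compose Y (?\<phi> g) (?\<phi> h) y = ?\<phi> (g \<otimes>\<^bsub>G\<^esub> h) y"
          using \<phi>_mult[OF that, of y] by (cases "y \<in> Y") (simp_all add: compose_def)
      qed
      finally show ?thesis by simp
    qed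
  qed
  then show ?thesis
    using G group_BijGroup by (simp add: group_action_def group_hom_def group_hom_axioms_def)
qed

text \<open>\<open>Frob\<close> depends on a permutation representation only through its numbers of
  fixed points, and an injective map compatible with the two actions preserves them.\<close>

lemma Frob_transport:
  assumes b: "inj_on b X" and Z: "finite Z" "Z \<subseteq> X"
    and \<phi>: "\<And>w x. w \<in> carrier (sym_group n) \<Longrightarrow> x \<in> Z \<Longrightarrow> \<phi> w (b x) = b (act w x)"
    and closed: "\<And>w x. w \<in> carrier (sym_group n) \<Longrightarrow> x \<in> Z \<Longrightarrow> act w x \<in> X"
  shows "Frob n (b ` Z) (perm_rep \<phi>) = Frob n Z (perm_rep act)"
proof -
  have "rep_character (b ` Z) (perm_rep \<phi>) w = rep_character Z (perm_rep act) w"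
    if w: "w \<in> carrier (sym_group n)" for w
  proof -
    have "\<phi> w (b x) = b x \<longleftrightarrow> act w x = x" if "x \<in> Z" for x
      using \<phi>[OF w that] closed[OF w that] b Z that by (auto dest: inj_onD)
    then have "{y \<in> b ` Z. \<phi> w y = y} = b ` {x \<in> Z. act w x = x}" by auto
    moreover have "inj_on b {x \<in> Z. act w x = x}"
      using Z by (intro inj_on_subset[OF b]) auto
    ultimately show ?thesis using Z by (simp add: rep_character_perm_rep card_image)
  qed
  then show ?thesis by (simp add: Frob_def cong: sum.cong)
qed

lemma permute_fun_closed:
  assumes w: "w permutes {1..n}" and c: "c \<in> spine_functions n u"
  shows "\<exists>c'\<in>spine_functions n u. permute_fun n w (u, c) = (u, c')"
proof -
  let ?A = "{1..n}" and ?c = "restrict (c \<circ> inv' w) {1..n}"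
  have v: "inv' w permutes ?A" using w by (rule permutes_inv)
  have "image_mset ?c (mset_set ?A) = image_mset c (image_mset (inv' w) (mset_set ?A))"
    unfolding multiset.map_comp by (intro image_mset_cong) auto
  also have "image_mset (inv' w) (mset_set ?A) = mset_set ?A"
    using permutes_inj_on[OF v] permutes_image[OF v] by (simp add: image_mset_mset_set)
  also have "image_mset c (mset_set ?A) = mset (spine_ids u)"
    using c by (simp only: spine_functions_def mem_Collect_eq)
  finally have "image_mset ?c (mset_set ?A) = mset (spine_ids u)" .
  moreover have "?c \<in> ?A \<rightarrow>\<^sub>E UNIV" by simp
  ultimately have "?c \<in> spine_functions n u" by (simp only: spine_functions_def mem_Collect_eq)
  then show ?thesis by (auto simp: permute_fun_def)
qed

lemma permute_fun_id: "c \<in> spine_functions n u \<Longrightarrow> permute_fun n id (u, c) = (u, c)"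
  by (auto simp: permute_fun_def spine_functions_def PiE_iff extensional_def fun_eq_iff)

lemma permute_fun_comp:
  assumes w: "w permutes {1..n}" and v: "v permutes {1..n}"
  shows "permute_fun n (w \<circ> v) x = permute_fun n w (permute_fun n v x)"
proof -
  have i: "inv' (w \<circ> v) = inv' v \<circ> inv' w"
    using w v by (simp add: o_inv_distrib permutes_bij)
  have "inv' w i \<in> {1..n}" if "i \<in> {1..n}" for i
    using that by (simp only: permutes_in_image[OF permutes_inv[OF w]])
  then show ?thesis
    by (cases x) (auto simp: permute_fun_def i fun_eq_iff simp del: atLeastAtMost_iff)
qed

lemma right_weight_less: "right_weight u < length (labels u)"
  by (induction u) auto

section \<open>Coefficients of both sides of the identity\<close>

lemma coeff_Frob_zero_key:
  assumes "0 \<in> Poly_Mapping.keys m"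
  shows "mfps_coeff (Frob n B \<rho>) m = 0"
proof -
  have "mfps_coeff (power_sum_cycle_type n w) m = 0" if w: "w permutes {1..n}" for w
  proof -
    have "(\<Sum>i\<in>{1..n}. xpow (f i) 1) \<noteq> m" if "f \<in> {1..n} \<rightarrow>\<^sub>E {1..}" for f
    proof
      assume m: "(\<Sum>i\<in>{1..n}. xpow (f i) 1) = m"
      have "Poly_Mapping.lookup m 0 = (\<Sum>i\<in>{1..n}. Poly_Mapping.lookup (xpow (f i) 1) 0)"
        unfolding m[symmetric] by (rule lookup_sum)
      also have "\<dots> = 0"
        using that by (intro sum.neutral) (force simp: PiE_iff lookup_single when_def)
      finally show False using assms by (simp add: in_keys_iff)
    qed
    then have empty: "{f \<in> {1..n} \<rightarrow>\<^sub>E {1..}. (\<forall>i\<in>{1..n}. f (w i) = f i) \<and>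
        (\<Sum>i\<in>{1..n}. xpow (f i) 1) = m} = {}" by blast
    show ?thesis
      unfolding power_sum_cycle_type_def coeff_prod_power_sum_orbits[OF finite_atLeastAtMost w] empty by simp
  qed
  then show ?thesis by (simp add: Frob_def mfps_coeff_sum sym_group_def)
qed

lemma keys_tree_monomial: "Poly_Mapping.keys (tree_monomial T) = set_tree T"
proof -
  have "Poly_Mapping.lookup (tree_monomial T) x \<noteq> 0 \<longleftrightarrow> x \<in> set_tree T" for x
    by (induction T) (auto simp: lookup_add lookup_single when_def)
  then show ?thesis by (auto simp: in_keys_iff)
qed

lemma finite_trees: "finite K \<Longrightarrow> finite {T. size T \<le> n \<and> set_tree T \<subseteq> K}"
proof (induction n)
  case (Suc n)
  let ?S = "{T. size T \<le> n \<and> set_tree T \<subseteq> K}"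
  have "{T. size T \<le> Suc n \<and> set_tree T \<subseteq> K} \<subseteq> insert \<langle>\<rangle> ((\<lambda>(l, a, r). \<langle>l, a, r\<rangle>) ` (?S \<times> K \<times> ?S))" (is "_ \<subseteq> ?R")
  proof
    fix T assume "T \<in> {T. size T \<le> Suc n \<and> set_tree T \<subseteq> K}"
    then have T: "size T \<le> Suc n" "set_tree T \<subseteq> K" by auto
    show "T \<in> ?R"
    proof (cases T)
      case (Node l a r)
      then have "(l, a, r) \<in> ?S \<times> K \<times> ?S" using T by auto
      then show ?thesis unfolding Node by (intro insertI2 image_eqI[of _ _ "(l, a, r)"]) simp_all
    qed simp
  qed
  then show ?case by (rule finite_subset) (use Suc in simp)
qed simp

lemma scalar_of_nat: "scalar (of_nat j) = of_nat j"
  by (simp add: scalar_def of_nat_poly)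

text \<open>As \<open>0 ^ 0 = 1\<close>, descent weights 0 select the trees without descents. Such a
  tree has \<open>n - 1\<close> edges, so its number of right edges determines its whole
  weight.\<close>

lemma coeff_G_series:
  fixes a b :: "'a :: comm_ring_1"
  assumes n: "n \<ge> 1"
  shows "mfps_coeff (G_series n a 0 b 0) m = (if 0 \<in> Poly_Mapping.keys m then 0 else
    (\<Sum>k<n. a ^ (n - 1 - k) * b ^ k *
      of_nat (card {T. ascending T \<and> size T = n \<and> right_edges T = k \<and> tree_monomial T = m})))"
proof (cases "0 \<in> Poly_Mapping.keys m")
  case True
  then have empty: "{T. T \<in> labeled_trees n \<and> tree_monomial T = m} = {}"
    by (auto simp: labeled_trees_def keys_tree_monomial)
  show ?thesis using True unfolding G_series_def mfps_coeff_Abs empty by simp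
next
  case False
  let ?S = "{T. size T = n \<and> tree_monomial T = m}"
  let ?P = "{T \<in> ?S. ascending T}" and ?w = "\<lambda>k. a ^ (n - 1 - k) * b ^ k"
  have S: "{T. T \<in> labeled_trees n \<and> tree_monomial T = m} = ?S"
  proof -
    have "1 \<le> i" if "i \<in> set_tree T" "tree_monomial T = m" for i T
    proof -
      have "i \<noteq> 0" using that False keys_tree_monomial[of T] by metis
      then show ?thesis by simp
    qed
    then show ?thesis by (auto simp: labeled_trees_def)
  qed
  have finS: "finite ?S"
    by (rule finite_subset[OF _ finite_trees[of "Poly_Mapping.keys m" n]])
       (auto simp flip: keys_tree_monomial)
  have "mfps_coeff (G_series n a 0 b 0) m =
      (\<Sum>T\<in>?S. if ascending T then ?w (right_edges T) else 0)"
    unfolding G_series_def mfps_coeff_Abs S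
  proof (rule sum.cong[OF refl])
    fix T assume T: "T \<in> ?S"
    show "a ^ lasc T * 0 ^ ldes T * b ^ rasc T * 0 ^ rdes T =
        (if ascending T then ?w (right_edges T) else 0)"
    proof (cases "ascending T")
      case True
      have "T \<noteq> \<langle>\<rangle>" using T n by auto
      then have "lasc T = n - 1 - right_edges T"
        using lasc_ascending[OF True] T by auto
      then show ?thesis using True rasc_ascending[OF True] by (simp add: ascending_iff)
    next
      case False
      then show ?thesis by (auto simp: ascending_iff zero_power)
    qed
  qed
  also have "\<dots> = (\<Sum>T\<in>?P. ?w (right_edges T))"
    by (rule sum.inter_filter[OF finS, symmetric])
  also have "\<dots> = (\<Sum>k\<in>{..<n}. \<Sum>T\<in>{T \<in> ?P. right_edges T = k}.
      ?w (right_edges T))"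
  proof (rule sum.group[symmetric])
    show "right_edges ` ?P \<subseteq> {..<n}"
    proof
      fix k assume "k \<in> right_edges ` ?P"
      then obtain T where T: "T \<in> ?S" "ascending T" "k = right_edges T" by blast
      have "T \<noteq> \<langle>\<rangle>" using T n by auto
      then show "k \<in> {..<n}" using lasc_ascending[OF T(2)] T by auto
    qed
    show "finite ?P"
      by (rule finite_subset[OF _ finS]) blast
  qed simp
  also have "\<dots> = (\<Sum>k<n. ?w k *
      of_nat (card {T. ascending T \<and> size T = n \<and> right_edges T = k \<and> tree_monomial T = m}))"
  proof (rule sum.cong[OF refl])
    fix k
    have "{T \<in> ?P. right_edges T = k} =
        {T. ascending T \<and> size T = n \<and> right_edges T = k \<and> tree_monomial T = m}" by auto
    then show "(\<Sum>T\<in>{T \<in> ?P. right_edges T = k}. ?w (right_edges T)) =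
      ?w k * of_nat (card {T. ascending T \<and> size T = n \<and> right_edges T = k \<and> tree_monomial T = m})"
      by (simp add: mult.commute)
  qed
  finally show ?thesis using False by simp
qed

theorem theorem1p8:
  fixes n :: nat
  assumes "n \<ge> 1"
  shows "\<exists>(\<phi> :: (nat \<Rightarrow> nat) \<Rightarrow> (nat \<Rightarrow> real) set \<Rightarrow> (nat \<Rightarrow> real) set)
           (R :: nat \<Rightarrow> (nat \<Rightarrow> real) set set).
           group_action (sym_group n) (linial_regions n) \<phi>
         \<and> (\<Union>k<n. R k) = linial_regions n
         \<and> disjoint_family_on R {..<n}
         \<and> (\<forall>k<n. \<forall>w\<in>carrier (sym_group n). \<phi> w ` R k \<subseteq> R k)
         \<and> (\<Sum>k<n. mfps_smult (lambda_bar ^ (n - 1 - k) * rho_bar ^ k)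
                     (mfps_map scalar (Frob n (R k) (perm_rep \<phi>))))
           = G_series n lambda_bar 0 rho_bar 0"
proof -
  \<comment> \<open>The degree \<open>k\<close> is the number of right edges of the trees of the
    shape; by \<open>right_weight_less\<close> it stays below \<open>n\<close>.\<close>
  define Z where "Z k = (SIGMA u : shapes n k. spine_functions n u)" for k
  define X where "X = (SIGMA u : gapped_of n. spine_functions n u)"
  have shapes_sub: "shapes n k \<subseteq> gapped_of n" for k
    by (auto simp: shapes_def gapped_of_def)
  then have fin_shapes: "finite (shapes n k)" for k
    using finite_gapped_of finite_subset by blast
  have ZX: "Z k \<subseteq> X" for k using shapes_sub by (auto simp: Z_def X_def)
  have finX: "finite X" unfolding X_def using finite_gapped_of finite_spine_functions by auto
  have finZ: "finite (Z k)" for k using finX ZX finite_subset by blast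
  have UZ: "(\<Union>k<n. Z k) = X"
    using right_weight_less by (auto simp: Z_def X_def shapes_def gapped_of_def)
  have cardX: "card X = card (linial_regions n)"
    unfolding card_linial_regions region_count_def[symmetric] region_count_eq[OF assms] X_def
    by (rule card_SigmaI) (use finite_gapped_of finite_spine_functions in auto)
  \<comment> \<open>Equal values of \<open>card\<close> give a bijection only between finite sets.
    The origin lies off every hyperplane, so the number of regions is positive, and a set of
    positive \<open>card\<close> is finite.\<close>
  moreover have "finite (linial_regions n)"
  proof -
    have "finite (linial {..<n})"
      by (rule finite_subset[of _ "{..<n} \<times> {..<n} \<times> {1}"]) (auto simp: linial_def)
    moreover have "avoids (linial {..<n}) (\<lambda>_. 0 :: real)" by (auto simp: avoids_def linial_def)
    ultimately have "card (linial_regions n) > 0"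
      unfolding card_linial_regions using finite_sign_patterns by (auto simp: card_gt_0_iff sign_patterns_def)
    then show ?thesis by (rule card_ge_0_finite)
  qed
  ultimately obtain b where b: "bij_betw b X (linial_regions n)"
    using finite_same_card_bij[OF finX] by blast
  let ?act = "permute_fun n :: _ \<Rightarrow> unit gapped \<times> (nat \<Rightarrow> nat list) \<Rightarrow> _"
  define \<phi> where "\<phi> w = restrict (\<lambda>y. b (?act w (inv_into X b y))) (linial_regions n)" for w
  define R where "R k = b ` Z k" for k
  have car: "w \<in> carrier (sym_group n) \<longleftrightarrow> w permutes {1..n}" for w by (rule sym_group_carrier)
  have actZ: "?act w x \<in> Z k" if "w permutes {1..n}" "x \<in> Z k" for w x k
    using permute_fun_closed[OF that(1)] that(2) by (fastforce simp: Z_def)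
  have actX: "?act w x \<in> X" if "w permutes {1..n}" "x \<in> X" for w x
    using permute_fun_closed[OF that(1)] that(2) by (fastforce simp: X_def)
  have \<phi>_b: "\<phi> w (b x) = b (?act w x)" if "x \<in> X" for w x
    using bij_betw_apply[OF b that] inv_into_f_f[OF bij_betw_imp_inj_on[OF b] that]
    by (simp add: \<phi>_def)
  have "group_action (sym_group n) (linial_regions n) \<phi>"
    unfolding \<phi>_def
  proof (rule group_action_transport[OF sym_group_is_group b])
    show "?act \<one>\<^bsub>sym_group n\<^esub> x = x" if "x \<in> X" for x
      using that by (auto simp: sym_group_one X_def permute_fun_id)
    show "?act (w \<otimes>\<^bsub>sym_group n\<^esub> v) x = ?act w (?act v x)"
      if "w \<in> carrier (sym_group n)" "v \<in> carrier (sym_group n)" for w v x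
      using that by (simp only: car sym_group_mult permute_fun_comp)
  qed (simp_all only: car actX)
  moreover have "(\<Union>k<n. R k) = linial_regions n"
    unfolding R_def image_UN[symmetric] UZ using b by (rule bij_betw_imp_surj_on)
  moreover have "disjoint_family_on R {..<n}"
  proof -
    have "Z j \<inter> Z k = {}" if "j \<noteq> k" for j k using that by (auto simp: Z_def shapes_def)
    then have "R j \<inter> R k = {}" if "j \<noteq> k" for j k
      using inj_on_image_Int[OF bij_betw_imp_inj_on[OF b] ZX ZX, of j k] that by (simp add: R_def)
    then show ?thesis by (simp add: disjoint_family_on_def)
  qed
  moreover have "\<forall>k<n. \<forall>w\<in>carrier (sym_group n). \<phi> w ` R k \<subseteq> R k"
  proof (intro allI impI ballI image_subsetI)
    fix k w y assume "w \<in> carrier (sym_group n)" "y \<in> R k"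
    then obtain x where x: "x \<in> Z k" "y = b x" and w: "w permutes {1..n}"
      by (auto simp: R_def car)
    then have "\<phi> w y = b (?act w x)" using \<phi>_b ZX by blast
    then show "\<phi> w y \<in> R k" using actZ[OF w x(1)] by (simp add: R_def)
  qed
  moreover have "(\<Sum>k<n. mfps_smult (lambda_bar ^ (n - 1 - k) * rho_bar ^ k)
      (mfps_map scalar (Frob n (R k) (perm_rep \<phi>)))) = G_series n lambda_bar 0 rho_bar 0"
  proof (rule mfps_eqI)
    fix m
    have F: "Frob n (R k) (perm_rep \<phi>) = Frob n (Z k) (perm_rep ?act)" for k
      unfolding R_def
      by (rule Frob_transport[OF bij_betw_imp_inj_on[OF b] finZ ZX])
         (use \<phi>_b actX ZX car in blast)+
    have "scalar (mfps_coeff (Frob n (R k) (perm_rep \<phi>)) m) = (if 0 \<in> Poly_Mapping.keys m then 0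
        else of_nat (card {T. ascending T \<and> size T = n \<and> right_edges T = k \<and> tree_monomial T = m}))" for k
    proof (cases "0 \<in> Poly_Mapping.keys m")
      case True
      then show ?thesis by (simp add: coeff_Frob_zero_key scalar_def)
    next
      case False
      have "mfps_coeff (Frob n (Z k) (perm_rep ?act)) m = of_nat (card (SIGMA u : shapes n k. matrices (spine_ids u) m))"
        unfolding Z_def by (rule coeff_Frob_spine_functions[OF fin_shapes _ False]) (simp add: shapes_def)
      also have "\<dots> = of_nat (card {T. ascending T \<and> size T = n \<and> right_edges T = k \<and> tree_monomial T = m})"
        unfolding card_ascending_trees[OF assms] matrices_def ..
      finally show ?thesis using False by (simp add: F scalar_of_nat)
    qed
    then show "mfps_coeff (\<Sum>k<n. mfps_smult (lambda_bar ^ (n - 1 - k) * rho_bar ^ k)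
        (mfps_map scalar (Frob n (R k) (perm_rep \<phi>)))) m =
        mfps_coeff (G_series n lambda_bar 0 rho_bar 0) m"
      by (simp add: mfps_coeff_sum coeff_G_series[OF assms])
  qed
  ultimately show ?thesis by blast
qed

end
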